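(* The $\mathbf k$-algebra homomorphism $\Psi:\mathcal F\to\mathrm{Mat}_{3\times3}(\mathbf R)$, $\Psi(\mathcal O_A^{(g)})=O_A^{(g)}$, $\Psi(\mathcal O_B^{(g)})=O_B^{(g)}$ for all $g\in Free_2$, descends to the quotient algebra $\mathcal A=\mathcal F/\mathcal I$. In other words, $$\Psi:\mathcal A\to\mathrm{Mat}_{3\times3}(\mathbf R),\qquad \Psi(\mathcal O_A^{(g)})=O_A^{(g)},\quad \Psi(\mathcal O_B^{(g)})=O_B^{(g)}\quad\text{for all } g\in Free_2,$$ defines a homomorphism of algebras over $\mathbf k=\mathbb C(Q)$. Moreover this homomorphism is $PSL(2,\mathbb Z)$-equivariant: for all $x\in\mathcal A$, $$\Psi(\mathbf a(x))=\widehat D_A^{-1}\,\Psi(x)\,\widehat D_A,\qquad \Psi(\mathbf s(x))=\widehat S^{-1}\,\Psi(x)\,\widehat S .$$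
   Context: **Algebra $\mathcal A$.** Let $Free_2=\langle a,b\rangle$ be the free group on two generators and $\sigma$ its automorphism exchanging $a$ and $b$. Let $\mathbf k=\mathbb C(Q)$ and let $\mathcal F=\mathbf k\langle \mathcal O_A^{(g)},\mathcal O_B^{(g)}\mid g\in Free_2\rangle$ be the free associative $\mathbf k$-algebra. Let $\mathcal I\subset\mathcal F$ be the two-sided ideal generated by the following elements, for all $g,g_1,g_2,g_3\in Free_2$ and $X\in\{A,B\}$: - $\mathcal R_{0,A}^{(g)}=\mathcal O_A^{(ag)}-\mathcal O_A^{(g)}$, $\ \mathcal R_{0,B}^{(g)}=\mathcal O_B^{(bg)}-\mathcal O_B^{(g)}$; - $\mathcal R_{1,X}^{(g)}=\mathcal O_X^{(g)}\mathcal O_X^{(g)}-\mathcal O_X^{(1)}\mathcal O_X^{(1)}$; - $\mathcal R_2^{(g_1,g_2,g_3)}=\mathcal O_B^{(g_1)}\mathcal O_A^{(g_2)}\mathcal O_B^{(g_3)}$, $\ \mathcal R_3^{(g_1,g_2,g_3)}=\mathcal O_A^{(g_1)}\mathcal O_B^{(g_2)}\mathcal O_A^{(g_3)}$; - $\mathcal R_{4,X}^{(g)}=\mathcal O_X^{(1)}\mathcal O_X^{(1)}\mathcal O_X^{(g)}+(Q^2-Q^{-2})^2\mathcal O_X^{(g)}$, $\ \mathcal R_{5,X}^{(g)}=\mathcal O_X^{(g)}\mathcal O_X^{(1)}\mathcal O_X^{(1)}+(Q^2-Q^{-2})^2\mathcal O_X^{(g)}$; - $\mathcal R_6^{(g)}=\mathcal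 O_A^{(1)}\mathcal O_A^{(1)}\mathcal O_B^{(g)}+(Q^2-Q^{-2})^2\mathcal O_B^{(g)}+\mathcal O_B^{(g)}\mathcal O_A^{(1)}\mathcal O_A^{(1)}$; - $\mathcal R_7^{(g)}=\mathcal O_B^{(1)}\mathcal O_B^{(1)}\mathcal O_A^{(g)}+(Q^2-Q^{-2})^2\mathcal O_A^{(g)}+\mathcal O_A^{(g)}\mathcal O_B^{(1)}\mathcal O_B^{(1)}$; - $\mathcal R_8^{(g_1,g_2)}=\mathcal O_A^{(g_2)}\mathcal O_A^{(g_1abag_2)}\mathcal O_B^{(ag_2)}+\mathcal O_B^{(ag_2)}\mathcal O_A^{(g_1abag_2)}\mathcal O_A^{(g_2)}-\mathcal O_B^{(g_2)}\mathcal O_B^{(\sigma(g_1)g_2)}\mathcal O_B^{(g_2)}$; - $\mathcal R_9^{(g_1,g_2)}=\mathcal O_B^{(g_2)}\mathcal O_B^{(g_1babg_2)}\mathcal O_A^{(bg_2)}+\mathcal O_A^{(bg_2)}\mathcal O_B^{(g_1babg_2)}\mathcal O_B^{(g_2)}-\mathcal O_A^{(g_2)}\mathcal O_A^{(\sigma(g_1)g_2)}\mathcal O_A^{(g_2)}$; - $\mathcal R_{10}^{(g_1,g_2)}=\mathcal O_A^{(g_2)}\mathcal O_A^{(g_1a^{-1}b^{-1}a^{-1}g_2)}\mathcal O_B^{(a^{-1}g_2)}+\mathcal O_B^{(a^{-1}g_2)}\mathcal O_A^{(g_1a^{-1}b^{-1}a^{-1}g_2)}\mathcal O_A^{(g_2)}-\mathcal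 O_B^{(g_2)}\mathcal O_B^{(\sigma(g_1)g_2)}\mathcal O_B^{(g_2)}$; - $\mathcal R_{11}^{(g_1,g_2)}=\mathcal O_B^{(g_2)}\mathcal O_B^{(g_1b^{-1}a^{-1}b^{-1}g_2)}\mathcal O_A^{(b^{-1}g_2)}+\mathcal O_A^{(b^{-1}g_2)}\mathcal O_B^{(g_1b^{-1}a^{-1}b^{-1}g_2)}\mathcal O_B^{(g_2)}-\mathcal O_A^{(g_2)}\mathcal O_A^{(\sigma(g_1)g_2)}\mathcal O_A^{(g_2)}$. Then $\mathcal A=\mathcal F/\mathcal I$. The group $PSL(2,\mathbb Z)=\langle \mathbf a,\mathbf s\mid \mathbf s^2=(\mathbf a\mathbf s)^3=1\rangle$ acts on $\mathcal A$ by the $\mathbf k$-algebra automorphisms $\mathbf s(\mathcal O_A^{(g)})=\mathcal O_B^{(\sigma(g))}$, $\mathbf s(\mathcal O_B^{(g)})=\mathcal O_A^{(\sigma(g))}$ and $$\mathbf a(\mathcal O_A^{(g)})=-\frac{\mathcal O_A^{(1)}\mathcal O_A^{(ga^{-1})}\mathcal O_A^{(1)}}{(Q^2-Q^{-2})^2},\qquad \mathbf a(\mathcal O_B^{(g)})=\frac{Q\,\mathcal O_A^{(1)}\mathcal O_B^{(ga^{-1})}-Q^{-1}\mathcal O_B^{(ga^{-1})}\mathcal O_A^{(1)}}{Q^2-Q^{-2}}.$$ **Ring $\mathbf R$.** Let $(Q,p,s)$ be coordinates on $(\mathbb C^\times)^3$. Consider holomorphic functions $f:U\to\mathbb C$ on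 open dense (not necessarily connected) subsets $U\subset(\mathbb C^\times)^3$; two are equivalent if they agree on some open dense subset of the intersection of their domains. $\mathbf R$ is the commutative ring of equivalence classes (pointwise operations on intersections of domains); it contains $\mathbf k=\mathbb C(Q)$. **Plethystic exponent.** For $z\in\mathbb C$ and $0<|p_j|<1$ put $(z;p_1,\dots,p_n)=\prod_{i_1,\dots,i_n\ge 0}(1-zp_1^{i_1}\cdots p_n^{i_n})$, extended to all $p_j\in\mathbb C$ with $|p_j|\ne0,1$ as a meromorphic function by $(z;p_1,\dots,p_j^{-1},\dots,p_n)=1/(p_jz;p_1,\dots,p_j,\dots,p_n)$. For a Laurent polynomial $\mu=\sum_m c_m Q^{m_1}p^{m_2}s^{m_3}$ with integer coefficients and no terms of degree $0$ in $Q$, and $(a_i,b_i)\in\mathbb Z^2\setminus\{(0,0)\}$, $1\le i\le n$, $n\ge1$, define $$\mathrm{pexp}\Big(\tfrac{\mu}{\prod_{i=1}^n(1-p^{a_i}s^{b_i})}\Big)=\prod_m\big(Q^{m_1}p^{m_2}s^{m_3};p^{a_1}s^{b_1},\dots,p^{a_n}s^{b_n}\big)^{c_m}\in\mathbf R^\times;$$ this depends only on the fraction as a rational function. A factor $1/(1+X)$ with $X=p^as^b\neq1$ is read as $(1-X)/(1-X^2)$. **Operators.** For $\begin{pmatrix}k&l\\ m&n\end{pmatrix}\in SL(2,\mathbb Z)$ let $\widehat\delta_{(p,s)\mapsto(p^ks^l,p^ms^n)}$ be the automorphism $f(Q,p,s)\mapsto f(Q,p^ks^l,p^ms^n)$ of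 $\mathbf R$, acting entrywise on $\mathbf R^3$. Put $D_A=\mathrm{diag}(1,-\mathrm iQ,-1)$ and $$D_B=\begin{pmatrix}\alpha&\frac{2Q}{1-Q^4}\beta&\frac{2Q^4}{(1-Q^4)^2}\alpha\\[2pt]-\frac{1-Q^4}{Q^3}\gamma&0&\frac{2Q}{1-Q^4}\gamma\\[2pt]\frac{(1-Q^4)^2}{2Q^4}\alpha&-\frac{1-Q^4}{Q^3}\beta&\alpha\end{pmatrix},$$ $$\alpha=\mathrm{pexp}\Big(\tfrac{-(Q^8-Q^{-8})ps^{-1}(s^2+2ps+p)}{(1-s^2)(1-p^2/s^2)}\Big),\ \beta=\mathrm{pexp}\Big(\tfrac{-(Q^8-Q^{-8})ps^{-1}(s+2ps+p)}{(1-s^2)(1-p^2/s^2)}\Big),\ \gamma=\mathrm{pexp}\Big(\tfrac{-(Q^8-Q^{-8})p(s+2p+1)}{(1-s^2)(1-p^2/s^2)}\Big),$$ and let $\widehat D_A=D_A\circ\widehat\delta_{(p,s)\mapsto(ps,s)}$, $\widehat D_B=D_B\circ\widehat\delta_{(p,s)\mapsto(p,s/p)}$, $\widehat S=\widehat D_A\widehat D_B\widehat D_A$, as operators on $\mathbf R^3$. Conjugating (multiplication by) a matrix in $\mathrm{Mat}_{3\times3}(\mathbf R)$ by any of these operators gives again a matrix in $\mathrm{Mat}_{3\times3}(\mathbf R)$. **Matrices $O_A^{(g)},O_B^{(g)}$.** Put $\kappa=Q^2-Q^{-2}$, $O_A^{(1)}=\mathrm{diag}(-\mathrm i\kappa,0,\mathrm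 i\kappa)$ and $$O_B^{(1)}=\begin{pmatrix}0&e&0\\-\frac{\kappa^2}{2}e^{-1}&0&e^{-1}\\0&-\frac{\kappa^2}{2}e&0\end{pmatrix},\qquad e=\mathrm{pexp}\Big(\tfrac{(Q^8-Q^{-8})ps(1-p)}{(1-s^2)(1-p^2)}\Big).$$ Let $\varphi:Free_2\to SL(2,\mathbb Z)$ be the homomorphism $\varphi(a)=\begin{pmatrix}1&-1\\0&1\end{pmatrix}$, $\varphi(b)=\begin{pmatrix}1&0\\1&1\end{pmatrix}$, and for $h,g\in Free_2$ put $$c_+^{(h,g)}=\mathrm{pexp}\Big(\tfrac{Q^8-Q^{-8}}{(1+s^{-\varphi(g)_{22}}p^{\varphi(g)_{21}})(1+s^{-\varphi(hg)_{12}}p^{\varphi(hg)_{11}})(1+s^{\varphi(hg)_{22}}p^{-\varphi(hg)_{21}})}\Big),$$ $$c_-^{(h,g)}=\mathrm{pexp}\Big(-\tfrac{Q^8-Q^{-8}}{(1+s^{-\varphi(g)_{22}}p^{\varphi(g)_{21}})(1+s^{\varphi(hg)_{12}}p^{-\varphi(hg)_{11}})(1+s^{\varphi(hg)_{22}}p^{-\varphi(hg)_{21}})}\Big).$$ The family $O_A^{(g)}\in\mathrm{Mat}_{3\times3}(\mathbf R)$, $g\in Free_2$, is the unique family with the given $O_A^{(1)}$ such that for all $k\in\mathbb Z$ and all $g\in Free_2$ whose reduced word is empty or begins with $b^{\pm1}$, $$O_A^{(b^{\pm1}a^kg)}=c\,O_A^{(g)}+\frac{c-c^{-1}}{\kappa^2}\,O_B^{(1)}O_B^{(1)}O_A^{(g)},\qquad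 c=c_\pm^{(b^{\pm1}a^k,g)}$$ (same sign throughout); this family exists and satisfies $O_A^{(a^kg)}=O_A^{(g)}$ for all $k\in\mathbb Z$, $g\in Free_2$. Finally $O_B^{(g)}:=\widehat S^{-1}O_A^{(\sigma(g))}\widehat S$ for all $g\in Free_2$ (consistent with the formula for $O_B^{(1)}$ above). *)

theory Defs
  imports "HOL-Analysis.Analysis" "HOL-Library.Poly_Mapping"
    "HOL-Computational_Algebra.Fraction_Field"
begin

section \<open>The free group on two generators\<close>

datatype letter = La | La_inv | Lb | Lb_inv

fun letter_inv :: "letter \<Rightarrow> letter" where
  "letter_inv La = La_inv" | "letter_inv La_inv = La"
| "letter_inv Lb = Lb_inv" | "letter_inv Lb_inv = Lb"

fun letter_swap :: "letter \<Rightarrow> letter" where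
  "letter_swap La = Lb" | "letter_swap La_inv = Lb_inv"
| "letter_swap Lb = La" | "letter_swap Lb_inv = La_inv"

fun reduced :: "letter list \<Rightarrow> bool" where
  "reduced [] = True"
| "reduced [x] = True"
| "reduced (x # y # w) = (y \<noteq> letter_inv x \<and> reduced (y # w))"

fun cons_red :: "letter \<Rightarrow> letter list \<Rightarrow> letter list" where
  "cons_red x [] = [x]"
| "cons_red x (y # w) = (if y = letter_inv x then w else x # y # w)"

definition reduce :: "letter list \<Rightarrow> letter list" where
  "reduce w = foldr cons_red w []"

lemma letter_inv_inv [simp]: "letter_inv (letter_inv x) = x"
  by (cases x) auto

lemma letter_swap_swap [simp]: "letter_swap (letter_swap x) = x"
  by (cases x) auto

lemma letter_swap_inv: "letter_swap (letter_inv x) = letter_inv (letter_swap x)"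
  by (cases x) auto

lemma letter_swap_eq_iff [simp]: "letter_swap x = letter_swap y \<longleftrightarrow> x = y"
  by (metis letter_swap_swap)

lemma reduced_ConsD: "reduced (x # w) \<Longrightarrow> reduced w"
  by (cases w) auto

lemma reduced_cons_red: "reduced w \<Longrightarrow> reduced (cons_red x w)"
  by (cases w) (auto dest: reduced_ConsD)

lemma reduced_foldr_cons_red: "reduced r \<Longrightarrow> reduced (foldr cons_red w r)"
  by (induction w) (auto intro: reduced_cons_red)

lemma reduced_reduce [simp]: "reduced (reduce w)"
  by (simp add: reduce_def reduced_foldr_cons_red)

lemma reduce_reduced: "reduced w \<Longrightarrow> reduce w = w"
proof (induction w)
  case (Cons x w)
  then show ?case by (cases w) (auto simp: reduce_def)
qed (simp add: reduce_def)

lemma cons_red_cancel: "reduced r \<Longrightarrow> cons_red x (cons_red (letter_inv x) r) = r"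
proof (cases r)
  case (Cons y w)
  assume "reduced r"
  with Cons show ?thesis by (cases w) auto
qed auto

lemma foldr_cons_red_cons_red:
  assumes "reduced r"
  shows "foldr cons_red (cons_red x w) r = cons_red x (foldr cons_red w r)"
proof (cases w)
  case (Cons y v)
  have "reduced (foldr cons_red v r)" using assms by (rule reduced_foldr_cons_red)
  from cons_red_cancel[OF this, of x] Cons show ?thesis by auto
qed auto

lemma foldr_cons_red_foldr:
  "reduced r \<Longrightarrow> foldr cons_red (foldr cons_red u v) r = foldr cons_red u (foldr cons_red v r)"
  by (induction u) (auto simp: foldr_cons_red_cons_red)

lemma reduce_append: "reduce (u @ v) = foldr cons_red u (reduce v)"
  by (simp add: reduce_def)

lemma reduce_append_left: "reduce (reduce u @ v) = reduce (u @ v)"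
  using foldr_cons_red_foldr[of "reduce v" u "[]"] by (simp add: reduce_append) (simp add: reduce_def)

lemma reduce_append_right: "reduce (u @ reduce v) = reduce (u @ v)"
  by (simp add: reduce_append reduce_reduced)

lemma cons_red_swap: "map letter_swap (cons_red x w) = cons_red (letter_swap x) (map letter_swap w)"
  by (cases w) (auto simp flip: letter_swap_inv)

lemma reduce_swap: "reduce (map letter_swap w) = map letter_swap (reduce w)"
  by (induction w) (auto simp: reduce_def cons_red_swap)

lemma reduced_swap: "reduced w \<Longrightarrow> reduced (map letter_swap w)"
  by (metis reduce_reduced reduce_swap reduced_reduce)

lemma reduce_inv_append: "reduce (rev (map letter_inv w) @ w) = []"
proof (induction w)
  case (Cons x w)
  have "reduce (rev (map letter_inv (x # w)) @ x # w)
      = foldr cons_red (rev (map letter_inv w)) (cons_red (letter_inv x) (cons_red x (reduce w)))"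
    by (simp add: reduce_append) (simp add: reduce_def)
  also have "\<dots> = foldr cons_red (rev (map letter_inv w)) (reduce w)"
    using cons_red_cancel[of "reduce w" "letter_inv x"] by simp
  also have "\<dots> = []" using Cons by (simp add: reduce_append)
  finally show ?case .
qed (simp add: reduce_def)

text \<open>Elements of the group are the reduced words.\<close>

typedef free2 = "{w. reduced w}" morphisms word_of Free2
  by (rule exI[of _ "[]"]) simp

setup_lifting type_definition_free2

instantiation free2 :: "{monoid_mult, inverse}"
begin

lift_definition one_free2 :: free2 is "[]" by simp

lift_definition times_free2 :: "free2 \<Rightarrow> free2 \<Rightarrow> free2" is "\<lambda>u v. reduce (u @ v)" by simp

lift_definition inverse_free2 :: "free2 \<Rightarrow> free2" is "\<lambda>u. reduce (rev (map letter_inv u))" by simp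

definition divide_free2 :: "free2 \<Rightarrow> free2 \<Rightarrow> free2" where
  "divide_free2 g h = g * inverse h"

instance
proof
  fix x y z :: free2
  show "x * y * z = x * (y * z)"
    by transfer (simp add: reduce_append_left reduce_append_right)
  show "1 * x = x" "x * 1 = x"
    by (transfer; simp add: reduce_reduced)+
qed

end

lemma free2_left_inverse [simp]: "inverse g * g = (1 :: free2)"
  by transfer (simp add: reduce_append_left reduce_inv_append)

lemma free2_right_inverse [simp]: "g * inverse g = (1 :: free2)"
  by (metis free2_left_inverse mult.assoc mult.left_neutral)

lift_definition fa :: free2 is "[La]" by simp
lift_definition fb :: free2 is "[Lb]" by simp

lift_definition sigma :: "free2 \<Rightarrow> free2" is "map letter_swap" by (rule reduced_swap)

lemma sigma_mult [simp]: "sigma (g * h) = sigma g * sigma h"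
  by transfer (simp flip: reduce_swap)

lemma sigma_one [simp]: "sigma 1 = 1" by transfer simp

lemma sigma_sigma [simp]: "sigma (sigma g) = g"
  by transfer (simp add: comp_def)

lemma sigma_gens [simp]: "sigma fa = fb" "sigma fb = fa"
  by (transfer; simp)+

lemma sigma_inverse [simp]: "sigma (inverse g) = inverse (sigma g)"
  by (metis free2_left_inverse free2_right_inverse mult.assoc mult.left_neutral mult.right_neutral sigma_mult sigma_one)


definition mat2 :: "int \<Rightarrow> int \<Rightarrow> int \<Rightarrow> int \<Rightarrow> int^2^2" where
  "mat2 k l m n = vector [vector [k, l], vector [m, n]]"

fun phi_letter :: "letter \<Rightarrow> int^2^2" where
  "phi_letter La = mat2 1 (- 1) 0 1"
| "phi_letter La_inv = mat2 1 1 0 1"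
| "phi_letter Lb = mat2 1 0 1 1"
| "phi_letter Lb_inv = mat2 1 0 (- 1) 1"

definition phi :: "free2 \<Rightarrow> int^2^2" where
  "phi g = foldr (\<lambda>x M. phi_letter x ** M) (word_of g) (mat 1)"

lemma phi_letter_inv: "phi_letter x ** phi_letter (letter_inv x) = mat 1"
  by (cases x) (simp_all add: mat2_def vec_eq_iff matrix_matrix_mult_def mat_def forall_2 sum_2)

lemma phi_gens: "phi 1 = mat 1" "phi fa = mat2 1 (- 1) 0 1" "phi fb = mat2 1 0 1 1"
  by (simp_all add: phi_def one_free2.rep_eq fa.rep_eq fb.rep_eq)

lemma phi_mult: "phi (g * h) = phi g ** phi h"
proof -
  let ?P = "\<lambda>w. foldr (\<lambda>x M. phi_letter x ** M) w (mat 1)"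
  have cons: "?P (cons_red x w) = phi_letter x ** ?P w" for x w
    using phi_letter_inv by (cases w) (auto simp: matrix_mul_assoc)
  have reduce: "?P (reduce w) = ?P w" for w
    by (induction w) (simp_all add: reduce_def cons)
  have "?P (u @ v) = ?P u ** ?P v" for u v
    by (induction u) (simp_all add: matrix_mul_assoc)
  with reduce show ?thesis by (simp add: phi_def times_free2.rep_eq)
qed

section \<open>The algebra\<close>

type_synonym kfield = "complex poly fract"

definition Qk :: kfield where "Qk = Fract [:0, 1:] 1"

definition const_k :: "complex \<Rightarrow> kfield" where "const_k c = Fract [:c:] 1"

definition kappa :: kfield where "kappa = Qk\<^sup>2 - inverse Qk ^ 2"

text \<open>Lists form the free monoid, written additively so that \<open>\<Rightarrow>\<^sub>0\<close> provides the
  monoid algebra with its convolution product.\<close>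

instantiation list :: (type) monoid_add
begin
definition zero_list :: "'a list" where "zero_list = []"
definition plus_list :: "'a list \<Rightarrow> 'a list \<Rightarrow> 'a list" where "plus_list u v = u @ v"
instance by standard (auto simp: zero_list_def plus_list_def)
end

datatype ogen = OA free2 | OB free2

type_synonym free_alg = "ogen list \<Rightarrow>\<^sub>0 kfield"

definition of_k :: "kfield \<Rightarrow> free_alg" where
  "of_k c = Poly_Mapping.single [] c"

definition gen :: "ogen \<Rightarrow> free_alg" where
  "gen x = Poly_Mapping.single [x] 1"

abbreviation gA :: "free2 \<Rightarrow> free_alg" where "gA g \<equiv> gen (OA g)"
abbreviation gB :: "free2 \<Rightarrow> free_alg" where "gB g \<equiv> gen (OB g)"

inductive_set relators :: "free_alg set" where
  R0A: "gA (fa * g) - gA g \<in> relators"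
| R0B: "gB (fb * g) - gB g \<in> relators"
| R1A: "gA g * gA g - gA 1 * gA 1 \<in> relators"
| R1B: "gB g * gB g - gB 1 * gB 1 \<in> relators"
| R2: "gB g1 * gA g2 * gB g3 \<in> relators"
| R3: "gA g1 * gB g2 * gA g3 \<in> relators"
| R4A: "gA 1 * gA 1 * gA g + of_k (kappa\<^sup>2) * gA g \<in> relators"
| R4B: "gB 1 * gB 1 * gB g + of_k (kappa\<^sup>2) * gB g \<in> relators"
| R5A: "gA g * gA 1 * gA 1 + of_k (kappa\<^sup>2) * gA g \<in> relators"
| R5B: "gB g * gB 1 * gB 1 + of_k (kappa\<^sup>2) * gB g \<in> relators"
| R6: "gA 1 * gA 1 * gB g + of_k (kappa\<^sup>2) * gB g + gB g * gA 1 * gA 1 \<in> relators"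
| R7: "gB 1 * gB 1 * gA g + of_k (kappa\<^sup>2) * gA g + gA g * gB 1 * gB 1 \<in> relators"
| R8: "gA g2 * gA (g1 * fa * fb * fa * g2) * gB (fa * g2)
     + gB (fa * g2) * gA (g1 * fa * fb * fa * g2) * gA g2
     - gB g2 * gB (sigma g1 * g2) * gB g2 \<in> relators"
| R9: "gB g2 * gB (g1 * fb * fa * fb * g2) * gA (fb * g2)
     + gA (fb * g2) * gB (g1 * fb * fa * fb * g2) * gB g2
     - gA g2 * gA (sigma g1 * g2) * gA g2 \<in> relators"
| R10: "gA g2 * gA (g1 * inverse fa * inverse fb * inverse fa * g2) * gB (inverse fa * g2)
     + gB (inverse fa * g2) * gA (g1 * inverse fa * inverse fb * inverse fa * g2) * gA g2
     - gB g2 * gB (sigma g1 * g2) * gB g2 \<in> relators"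
| R11: "gB g2 * gB (g1 * inverse fb * inverse fa * inverse fb * g2) * gA (inverse fb * g2)
     + gA (inverse fb * g2) * gB (g1 * inverse fb * inverse fa * inverse fb * g2) * gB g2
     - gA g2 * gA (sigma g1 * g2) * gA g2 \<in> relators"

inductive_set rel_ideal :: "free_alg set" where
  relator: "r \<in> relators \<Longrightarrow> r \<in> rel_ideal"
| zero: "0 \<in> rel_ideal"
| add: "x \<in> rel_ideal \<Longrightarrow> y \<in> rel_ideal \<Longrightarrow> x + y \<in> rel_ideal"
| lmult: "x \<in> rel_ideal \<Longrightarrow> z * x \<in> rel_ideal"
| rmult: "x \<in> rel_ideal \<Longrightarrow> x * z \<in> rel_ideal"

lemma rel_ideal_uminus: "x \<in> rel_ideal \<Longrightarrow> - x \<in> rel_ideal"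
  using rel_ideal.lmult[of x "-1"] by simp

lemma rel_ideal_diff: "x \<in> rel_ideal \<Longrightarrow> y \<in> rel_ideal \<Longrightarrow> x - y \<in> rel_ideal"
  using rel_ideal.add[of x "- y"] by (simp add: rel_ideal_uminus)

quotient_type algA = free_alg / "\<lambda>x y. x - y \<in> rel_ideal" morphisms rep_algA cls
proof (rule equivpI)
  show "reflp (\<lambda>x y :: free_alg. x - y \<in> rel_ideal)"
    by (auto simp: reflp_def intro: rel_ideal.zero)
  show "symp (\<lambda>x y :: free_alg. x - y \<in> rel_ideal)"
    by (rule sympI) (drule rel_ideal_uminus, simp)
  show "transp (\<lambda>x y :: free_alg. x - y \<in> rel_ideal)"
  proof (rule transpI)
    fix x y z :: free_alg
    assume "x - y \<in> rel_ideal" "y - z \<in> rel_ideal"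
    then have "(x - y) + (y - z) \<in> rel_ideal" by (rule rel_ideal.add)
    then show "x - z \<in> rel_ideal" by simp
  qed
qed

instantiation algA :: "{ring, monoid_mult}"
begin

lift_definition zero_algA :: algA is 0 .
lift_definition one_algA :: algA is 1 .
lift_definition plus_algA :: "algA \<Rightarrow> algA \<Rightarrow> algA" is "(+)"
  by (simp only: add_diff_add rel_ideal.add)
lift_definition uminus_algA :: "algA \<Rightarrow> algA" is "uminus"
  by (simp only: minus_diff_minus rel_ideal_uminus)
lift_definition minus_algA :: "algA \<Rightarrow> algA \<Rightarrow> algA" is "(-)"
proof -
  fix a b c d :: free_alg
  assume "a - b \<in> rel_ideal" "c - d \<in> rel_ideal"
  then have "(a - b) - (c - d) \<in> rel_ideal" by (rule rel_ideal_diff)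
  then show "(a - c) - (b - d) \<in> rel_ideal" by (simp add: algebra_simps)
qed
lift_definition times_algA :: "algA \<Rightarrow> algA \<Rightarrow> algA" is "(*)"
proof -
  fix a b c d :: free_alg
  assume "a - b \<in> rel_ideal" "c - d \<in> rel_ideal"
  then have "(a - b) * c + b * (c - d) \<in> rel_ideal"
    by (intro rel_ideal.add rel_ideal.lmult rel_ideal.rmult)
  then show "a * c - b * d \<in> rel_ideal" by (simp add: algebra_simps)
qed

instance
  by standard (transfer; simp add: algebra_simps rel_ideal.zero)+

end

definition kscale_free :: "kfield \<Rightarrow> free_alg \<Rightarrow> free_alg" where
  "kscale_free c x = of_k c * x"

lift_definition kscale :: "kfield \<Rightarrow> algA \<Rightarrow> algA" is kscale_free
  unfolding kscale_free_def by (simp only: right_diff_distrib[symmetric] rel_ideal.lmult)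


lemma cls_eq_iff: "cls x = cls y \<longleftrightarrow> x - y \<in> rel_ideal"
  by (rule algA.abs_eq_iff)

lemma cls_zero_iff: "cls x = 0 \<longleftrightarrow> x \<in> rel_ideal"
  unfolding zero_algA.abs_eq cls_eq_iff by simp

lemma cls_ops:
  "cls 0 = 0" "cls 1 = 1" "cls (x + y) = cls x + cls y" "cls (x - y) = cls x - cls y"
  "cls (- x) = - cls x" "cls (x * y) = cls x * cls y" "cls (kscale_free c x) = kscale c (cls x)"
  by (simp_all add: zero_algA.abs_eq one_algA.abs_eq plus_algA.abs_eq minus_algA.abs_eq
      uminus_algA.abs_eq times_algA.abs_eq kscale.abs_eq)


lemma kscale_free_lookup: "Poly_Mapping.lookup (kscale_free c x) w = c * Poly_Mapping.lookup x w"
  unfolding kscale_free_def of_k_def zero_list_def[symmetric] mult_map_scale_conv_mult[symmetric]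
  by (simp add: Poly_Mapping.map.rep_eq when_def)

lemma poly_mapping_additive_eqI:
  fixes F G :: "('a \<Rightarrow>\<^sub>0 'b::ab_group_add) \<Rightarrow> 'c::comm_monoid_add"
  assumes "\<And>x y. F (x + y) = F x + F y" "\<And>x y. G (x + y) = G x + G y" "F 0 = G 0"
    and "\<And>w c. F (Poly_Mapping.single w c) = G (Poly_Mapping.single w c)"
  shows "F x = G x"
proof (induction x rule: Poly_Mapping.update_induct)
  case const
  show ?case by (rule assms(3))
next
  case (update f a b)
  have "Poly_Mapping.update a b f = Poly_Mapping.single a b + f"
    using update(1) by (intro poly_mapping_eqI)
      (auto simp: lookup_add lookup_single Poly_Mapping.update.rep_eq when_def in_keys_iff)
  then show ?case using update(3) assms by simp
qed

lemma of_k_central: "x * of_k c = of_k c * x"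
  by (rule poly_mapping_additive_eqI[of "\<lambda>x. x * of_k c" "\<lambda>x. of_k c * x"])
    (simp_all add: algebra_simps of_k_def mult_single plus_list_def)

lemma kscale_free_simps:
  "kscale_free c (x + y) = kscale_free c x + kscale_free c y"
  "kscale_free c (x - y) = kscale_free c x - kscale_free c y"
  "kscale_free c (- x) = - kscale_free c x"
  "kscale_free (c + d) x = kscale_free c x + kscale_free d x"
  "kscale_free (- c) x = - kscale_free c x"
  "kscale_free c (kscale_free d x) = kscale_free (c * d) x"
  "kscale_free 1 x = x" "kscale_free c 0 = 0" "kscale_free 0 x = 0"
  by (rule poly_mapping_eqI; simp add: kscale_free_lookup lookup_add lookup_minus lookup_uminus algebra_simps)+

lemma kscale_free_mult:
  "kscale_free c x * y = kscale_free c (x * y)"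
  "x * kscale_free c y = kscale_free c (x * y)"
  unfolding kscale_free_def by (simp_all add: mult.assoc) (simp flip: mult.assoc add: of_k_central)

lemma kscale_simps:
  "kscale c (x + y) = kscale c x + kscale c y"
  "kscale c (x - y) = kscale c x - kscale c y"
  "kscale c (- x) = - kscale c x"
  "kscale (c + d) x = kscale c x + kscale d x"
  "kscale (- c) x = - kscale c x"
  "kscale c (kscale d x) = kscale (c * d) x"
  "kscale 1 x = x" "kscale c 0 = 0" "kscale 0 x = 0"
  "kscale c x * y = kscale c (x * y)"
  "x * kscale c y = kscale c (x * y)"
  by (transfer; simp add: kscale_free_simps kscale_free_mult rel_ideal.zero)+

text \<open>The homomorphism of \<open>k\<close>-algebras with prescribed values on the generators.\<close>

definition free_lift :: "(ogen \<Rightarrow> free_alg) \<Rightarrow> free_alg \<Rightarrow> free_alg" where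
  "free_lift v x = (\<Sum>w\<in>Poly_Mapping.keys x.
     kscale_free (Poly_Mapping.lookup x w) (prod_list (map v w)))"

lemma free_lift_single:
  "free_lift v (Poly_Mapping.single w c) = kscale_free c (prod_list (map v w))"
  by (simp add: free_lift_def kscale_free_simps)

lemma free_lift_gen [simp]: "free_lift v (gen x) = v x"
  by (simp add: gen_def free_lift_single kscale_free_simps)

lemma free_lift_zero [simp]: "free_lift v 0 = 0"
  by (simp add: free_lift_def)

lemma free_lift_one [simp]: "free_lift v 1 = 1"
proof -
  have "Poly_Mapping.single [] 1 = (1 :: free_alg)" by (simp flip: zero_list_def)
  with free_lift_single[of v "[]" 1] show ?thesis by (simp add: kscale_free_simps)
qed

lemma free_lift_of_k [simp]: "free_lift v (of_k c) = of_k c"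
  by (simp add: of_k_def free_lift_single) (simp add: kscale_free_def of_k_def)

lemma free_lift_add [simp]: "free_lift v (x + y) = free_lift v x + free_lift v y"
  unfolding free_lift_def by (rule setsum_keys_plus_distrib) (simp_all add: kscale_free_simps)

lemma free_lift_mult [simp]: "free_lift v (x * y) = free_lift v x * free_lift v y"
proof -
  have 1: "free_lift v (Poly_Mapping.single u c * y) = free_lift v (Poly_Mapping.single u c) * free_lift v y" for u c y
    by (rule poly_mapping_additive_eqI[of "\<lambda>y. free_lift v (Poly_Mapping.single u c * y)"
          "\<lambda>y. free_lift v (Poly_Mapping.single u c) * free_lift v y"])
      (simp_all add: distrib_left mult_single free_lift_single plus_list_def kscale_free_simps kscale_free_mult mult.commute)
  show ?thesis
    by (rule poly_mapping_additive_eqI[of "\<lambda>x. free_lift v (x * y)" "\<lambda>x. free_lift v x * free_lift v y"])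
      (simp_all add: distrib_right 1)
qed

lemma free_lift_uminus [simp]: "free_lift v (- x) = - free_lift v x"
  using free_lift_add[of v x "- x"] by (simp add: eq_neg_iff_add_eq_0 add.commute)

lemma free_lift_diff [simp]: "free_lift v (x - y) = free_lift v x - free_lift v y"
  using free_lift_add[of v x "- y"] by simp

lemma free_lift_kscale [simp]: "free_lift v (kscale_free c x) = kscale_free c (free_lift v x)"
  by (simp add: kscale_free_def)

lemma free_lift_respects:
  assumes "\<And>r. r \<in> relators \<Longrightarrow> cls (free_lift v r) = 0" and "x - y \<in> rel_ideal"
  shows "free_lift v x - free_lift v y \<in> rel_ideal"
proof -
  have "cls (free_lift v z) = 0" if "z \<in> rel_ideal" for z
    using that by induction (simp_all add: assms(1) cls_ops)
  from this[OF assms(2)] show ?thesis by (simp add: cls_zero_iff)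
qed

text \<open>The action of the generators \<open>s\<close> and \<open>a\<close> of the modular group: endomorphisms of the free
  algebra that preserve the ideal.\<close>

fun act_s_gen :: "ogen \<Rightarrow> free_alg" where
  "act_s_gen (OA g) = gB (sigma g)"
| "act_s_gen (OB g) = gA (sigma g)"

fun act_a_gen :: "ogen \<Rightarrow> free_alg" where
  "act_a_gen (OA g) = - kscale_free (1 / kappa\<^sup>2) (gA 1 * gA (g * inverse fa) * gA 1)"
| "act_a_gen (OB g) = kscale_free (1 / kappa)
     (kscale_free Qk (gA 1 * gB (g * inverse fa)) - kscale_free (inverse Qk) (gB (g * inverse fa) * gA 1))"

lemma act_s_relators:
  assumes "r \<in> relators"
  shows "cls (free_lift act_s_gen r) = 0"
  using assms
proof (cases rule: relators.cases)
  case (R8 g2 g1)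
  then show ?thesis using relators.R9[of "sigma g2" "sigma g1"]
    by (simp add: cls_zero_iff rel_ideal.relator)
next
  case (R9 g2 g1)
  then show ?thesis using relators.R8[of "sigma g2" "sigma g1"]
    by (simp add: cls_zero_iff rel_ideal.relator)
next
  case (R10 g2 g1)
  then show ?thesis using relators.R11[of "sigma g2" "sigma g1"]
    by (simp add: cls_zero_iff rel_ideal.relator)
next
  case (R11 g2 g1)
  then show ?thesis using relators.R10[of "sigma g2" "sigma g1"]
    by (simp add: cls_zero_iff rel_ideal.relator)
qed (simp add: cls_zero_iff rel_ideal.relator relators.intros)+

lift_definition act_s :: "algA \<Rightarrow> algA" is "free_lift act_s_gen"
  by (rule free_lift_respects[OF act_s_relators])


lemma Qk_nonzero [simp]: "Qk \<noteq> 0"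
  by (simp add: Qk_def Zero_fract_def eq_fract)

lemma kappa_nonzero [simp]: "kappa \<noteq> 0"
proof
  assume "kappa = 0"
  then have "Qk\<^sup>2 = inverse Qk ^ 2" by (simp add: kappa_def)
  then have "Qk ^ 4 = 1" by (simp add: field_simps power_inverse flip: power_add)
  moreover have "Qk ^ 4 = Fract ([:0, 1:] ^ 4) 1"
    by (simp add: Qk_def eval_nat_numeral)
  ultimately have "[:0, 1 :: complex:] ^ 4 = 1" by (simp add: One_fract_def eq_fract)
  then have "poly ([:0, 1 :: complex:] ^ 4) 0 = 1" by simp
  then show False by simp
qed

lemma cls_relators: "r \<in> relators \<Longrightarrow> cls r = 0"
  by (simp add: cls_zero_iff rel_ideal.relator)

lemma cls_of_k_mult: "cls (of_k c) * x = kscale c x"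
  by (induction x rule: algA.abs_induct) (simp add: kscale_free_def flip: cls_ops)

context
  fixes A B aA aB :: "free2 \<Rightarrow> algA" and c d q r :: kfield
  assumes cd: "c * d = 1" and c: "c = kappa" and qr: "q * r = 1"
  defines "A \<equiv> \<lambda>g. cls (gA g)" and "B \<equiv> \<lambda>g. cls (gB g)"
    and "aA \<equiv> \<lambda>g. - kscale (d * d) (A 1 * (A (g * inverse fa) * A 1))"
    and "aB \<equiv> \<lambda>g. kscale d (kscale q (A 1 * B (g * inverse fa)) - kscale r (B (g * inverse fa) * A 1))"
begin

private lemma rels:
  "A (fa * g) = A g" "B (fb * g) = B g"
  "A g * A g = A 1 * A 1" "B g * B g = B 1 * B 1"
  "B g1 * (A g2 * B g3) = 0" "A g1 * (B g2 * A g3) = 0"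
  "A 1 * (A 1 * A g) = - kscale (c * c) (A g)"
  "B 1 * (B 1 * B g) = - kscale (c * c) (B g)"
  "A g * (A 1 * A 1) = - kscale (c * c) (A g)"
  "B g * (B 1 * B 1) = - kscale (c * c) (B g)"
  "A 1 * (A 1 * B g) = - kscale (c * c) (B g) - B g * (A 1 * A 1)"
  "B 1 * (B 1 * A g) = - kscale (c * c) (A g) - A g * (B 1 * B 1)"
  using cls_relators[OF relators.R0A[of g]] cls_relators[OF relators.R0B[of g]]
    cls_relators[OF relators.R1A[of g]] cls_relators[OF relators.R1B[of g]]
    cls_relators[OF relators.R2[of g1 g2 g3]] cls_relators[OF relators.R3[of g1 g2 g3]]
    cls_relators[OF relators.R4A[of g]] cls_relators[OF relators.R4B[of g]]
    cls_relators[OF relators.R5A[of g]] cls_relators[OF relators.R5B[of g]]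
    cls_relators[OF relators.R6[of g]] cls_relators[OF relators.R7[of g]]
  by (simp_all add: cls_ops cls_of_k_mult c power2_eq_square A_def B_def mult.assoc algebra_simps eq_neg_iff_add_eq_0)

private lemma tails:
  "B g1 * (A g2 * (B g3 * z)) = 0" "A g1 * (B g2 * (A g3 * z)) = 0"
  "A 1 * (A 1 * (A g * z)) = - kscale (c * c) (A g * z)"
  "B 1 * (B 1 * (B g * z)) = - kscale (c * c) (B g * z)"
  "A g * (A 1 * (A 1 * z)) = - kscale (c * c) (A g * z)"
  "B g * (B 1 * (B 1 * z)) = - kscale (c * c) (B g * z)"
  "A 1 * (A 1 * (B g * z)) = - kscale (c * c) (B g * z) - B g * (A 1 * (A 1 * z))"
proof -
  have *: "u * (v * w) = t \<Longrightarrow> u * (v * (w * z)) = t * z" for u v w t z :: algA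
    by (metis mult.assoc)
  show "B g1 * (A g2 * (B g3 * z)) = 0" "A g1 * (B g2 * (A g3 * z)) = 0"
    "A 1 * (A 1 * (A g * z)) = - kscale (c * c) (A g * z)"
    "B 1 * (B 1 * (B g * z)) = - kscale (c * c) (B g * z)"
    "A g * (A 1 * (A 1 * z)) = - kscale (c * c) (A g * z)"
    "B g * (B 1 * (B 1 * z)) = - kscale (c * c) (B g * z)"
    "A 1 * (A 1 * (B g * z)) = - kscale (c * c) (B g * z) - B g * (A 1 * (A 1 * z))"
    using rels(5-)[THEN *]
    by (simp_all add: kscale_simps left_diff_distrib mult.assoc)
qed


private lemma aAB:
  "aA g = - kscale (d * d) (A 1 * (A (g * inverse fa) * A 1))"
  "aB g = kscale d (kscale q (A 1 * B (g * inverse fa)) - kscale r (B (g * inverse fa) * A 1))"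
  by (simp_all add: aA_def aB_def)

private lemma sqA: "A g * (A g * z) = A 1 * (A 1 * z)"
  using arg_cong[OF rels(3)[of g], of "\<lambda>x. x * z"] by (simp only: mult.assoc)
private lemma sqB: "B g * (B g * z) = B 1 * (B 1 * z)"
  using arg_cong[OF rels(4)[of g], of "\<lambda>x. x * z"] by (simp only: mult.assoc)

private lemma scal: "x * y = y * x" "x * (y * z) = y * (x * z)" "(x * y) * z = x * (y * z)"
  "c * d = 1" "d * c = 1" "c * (d * x) = x" "q * r = 1" "r * q = 1" "q * (r * x) = x" for x y z :: kfield
  using cd qr by (simp_all add: mult.commute)

private lemmas nf = rels(5-11) tails scal kscale_simps mult_minus_left mult_minus_right minus_minus
  diff_conv_add_uminus minus_add_distrib minus_zero add_0_left add_0_right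
  mult_zero_left mult_zero_right mult_1_left mult_1_right mult.assoc[where 'a = algA]
  distrib_left[where 'a = algA] distrib_right[where 'a = algA]
  add.assoc[where 'a = algA] add.commute[where 'a = algA] add.left_commute[where 'a = algA]
  left_minus right_minus add_minus_cancel minus_add_cancel

private lemma A_inv_fa: "A (inverse fa) = A 1"
  using rels(1)[of "inverse fa"] by simp

private lemma aA1: "aA 1 = A 1"
  by (simp only: aAB mult.left_neutral A_inv_fa nf)

private lemma aA_sq: "aA g * aA g = A 1 * A 1"
proof -
  have "aA g * aA g = - kscale (d * d) (A 1 * (A (g * inverse fa) * (A (g * inverse fa) * A 1)))"
    by (simp only: aAB nf)
  also have "\<dots> = A 1 * A 1"
    unfolding sqA[of "g * inverse fa"] by (simp only: nf)
  finally show ?thesis .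
qed

private lemma aB_sq: "aB g * aB g = kscale (d * d) (B 1 * (B 1 * (A 1 * A 1)) - A 1 * (B 1 * (B 1 * A 1))) + B 1 * B 1"
proof -
  have "aB g * aB g = kscale (d * d) 
    (kscale (c * c) (B (g * inverse fa) * B (g * inverse fa)) 
      + B (g * inverse fa) * (B (g * inverse fa) * (A 1 * A 1)) - A 1 * (B (g * inverse fa) * (B (g * inverse fa) * A 1)))"
    by (simp only: aAB nf)
  then show ?thesis
    unfolding sqB[of "g * inverse fa"] rels(4)[of "g * inverse fa"] by (simp only: nf)
qed

private lemma t5: "aB g1 * (aA g2 * aB g3) = 0" 
    by (simp only: aAB nf; simp)
private lemma t6: "aA g1 * (aB g2 * aA g3) = 0" 
    by (simp only: aAB nf; simp)
private lemma t7: "A 1 * (A 1 * aA g) = - kscale (c * c) (aA g)"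
    by (simp only: aAB nf; simp)
private lemma t9: "aA g * (A 1 * A 1) = - kscale (c * c) (aA g)"
    by (simp only: aAB nf; simp)
private lemma t11: "A 1 * (A 1 * aB g) = - kscale (c * c) (aB g) - aB g * (A 1 * A 1)"
    by (simp only: aAB nf; simp)
private lemma t10: "aB g * (aB 1 * aB 1) = - kscale (c * c) (aB g)"
  unfolding aB_sq by (simp only: aAB nf; simp)
private lemma t8: "aB 1 * (aB 1 * aB g) = - kscale (c * c) (aB g)"
proof -
  have "aB 1 * (aB 1 * aB g) = aB 1 * aB 1 * aB g"
    by (simp only: mult.assoc)
  then show ?thesis
  unfolding aB_sq
  by (simp only: aAB nf; simp)
qed
private lemma ABB: "A 1 * (B 1 * (B 1 * (A 1 * A 1))) = - kscale (c * c) (A 1 * (B 1 * B 1))"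
proof -
  have "A 1 * (A 1 * (B 1 * B 1)) = B 1 * (B 1 * (A 1 * A 1))" by (simp only: nf)
  with tails(3)[of 1 "B 1 * B 1"] show ?thesis by (simp only:)
qed

private lemma t12: "aB 1 * (aB 1 * aA g) = - kscale (c * c) (aA g) - aA g * (aB 1 * aB 1)"
proof -
  have "A 1 * (B 1 * (B 1 * A (g * inverse fa))) * A 1 = A 1 * (- kscale (c * c) (A (g * inverse fa)) - A (g * inverse fa) * (B 1 * B 1)) * A 1"
    by (simp only: rels(12))
  then have *: "A 1 * (B 1 * (B 1 * (A (g * inverse fa) * A 1))) = 
     - kscale (c * c) (A 1 * (A (g * inverse fa) * A 1)) - A 1 * (A (g * inverse fa) * (B 1 * (B 1 * A 1)))"
    by (simp only: nf)
  have "aB 1 * (aB 1 * aA g) = aB 1 * aB 1 * aA g"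
    by (simp only: mult.assoc)
  then show ?thesis
    unfolding aB_sq by (simp only: aAB nf * ABB; simp)
qed

private lemma t13:
  assumes "A x * (A y * B z) + B z * (A y * A x) = B x * (B w * B x)"
  assumes "x = x' * inverse fa" "y = y' * inverse fa" "z = z' * inverse fa" "w = w' * inverse fa"
  shows "aA x' * (aA y' * aB z') + aB z' * (aA y' * aA x') = aB x' * (aB w' * aB x')"
proof -
  have "A 1 * (A x * (A y * B z) + B z * (A y * A x)) = A 1 * (B x * (B w * B x))"
   "(A x * (A y * B z) + B z * (A y * A x)) * A 1 = (B x * (B w * B x)) * A 1"
    by (simp_all only: assms(1))
  then have *: "A 1 * (A x * (A y * B z)) = A 1 * (B x * (B w * B x))"
    "B z * (A y * (A x * A 1)) = B x * (B w * (B x * A 1))"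
    by (simp_all only: nf)
  have "A 1 * (B x * (B w * B x)) * (A 1 * A 1) = A 1 * (A x * (A y * B z)) * (A 1 * A 1)"
    by (simp only: *(1))
  then have **: "A 1 * (B x * (B w * (B x * (A 1 * A 1)))) = 0" by (simp only: nf)
  show ?thesis
  unfolding aAB assms(2-)[symmetric] 
  by (simp only: nf * **; simp)
qed

private lemma ABB': "A 1 * (B y * (B x * (A 1 * A 1))) = - kscale (c * c) (A 1 * (B y * B x))"
proof -
  have "A 1 * (A 1 * (B y * B x)) = B y * (B x * (A 1 * A 1))" by (simp only: nf)
  with tails(3)[of 1 "B y * B x"] show ?thesis by (simp only:)
qed

private lemma t14:
  assumes "B x * (B y * A z) + A z * (B y * B x) = A x * (A w * A x)"
  assumes "x = x' * inverse fa" "y = y' * inverse fa" "z = z' * inverse fa" "w = w' * inverse fa"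
  shows "aB x' * (aB y' * aA z') + aA z' * (aB y' * aB x') = aA x' * (aA w' * aA x')"
proof -
  have "A 1 * (A x * (A w * A x)) * A 1 = A 1 * (B x * (B y * A z) + A z * (B y * B x)) * A 1"
    by (simp_all only: assms(1))
  then have *: "A 1 * (A x * (A w * (A x * A 1))) = A 1 * (B x * (B y * (A z * A 1)))
     + A 1 * (A z * (B y * (B x * A 1)))"
    by (simp_all only: nf)
  show ?thesis
  unfolding aAB assms(2-)[symmetric]
  by (simp only: nf * ABB'; simp)
qed

private lemma t1: "aA (fa * g) = aA g"
  by (simp only: aAB mult.assoc rels(1))
private lemma t2: "aB (fb * g) = aB g"
  by (simp only: aAB mult.assoc rels(2))

private lemma B8: 
 "A g2 * (A (g1 * (fa * (fb * (fa * g2)))) * B (fa * g2))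
     + B (fa * g2) * (A (g1 * (fa * (fb * (fa * g2)))) * A g2)
     = B g2 * (B (sigma g1 * g2) * B g2)"
 "B g2 * (B (g1 * (fb * (fa * (fb * g2)))) * A (fb * g2))
     + A (fb * g2) * (B (g1 * (fb * (fa * (fb * g2)))) * B g2)
     = A g2 * (A (sigma g1 * g2) * A g2)"
 "A g2 * (A (g1 * (inverse fa * (inverse fb * (inverse fa * g2)))) * B (inverse fa * g2))
     + B (inverse fa * g2) * (A (g1 * (inverse fa * (inverse fb * (inverse fa * g2)))) * A g2)
     = B g2 * (B (sigma g1 * g2) * B g2)"
 "B g2 * (B (g1 * (inverse fb * (inverse fa * (inverse fb * g2)))) * A (inverse fb * g2))
     + A (inverse fb * g2) * (B (g1 * (inverse fb * (inverse fa * (inverse fb * g2)))) * B g2)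
     = A g2 * (A (sigma g1 * g2) * A g2)"
  using cls_relators[OF relators.R8[of g2 g1]] cls_relators[OF relators.R9[of g2 g1]]
    cls_relators[OF relators.R10[of g2 g1]] cls_relators[OF relators.R11[of g2 g1]]
  by (simp_all add: cls_ops A_def B_def mult.assoc)

lemma act_a_relators0:
  assumes "\<And>g. cls (act_a_gen (OA g)) = aA g" "\<And>g. cls (act_a_gen (OB g)) = aB g"
  assumes "rr \<in> relators"
  shows "cls (free_lift act_a_gen rr) = 0"
proof -
  note simps = cls_ops assms(1,2) mult.assoc cls_of_k_mult power2_eq_square c[symmetric]
  show ?thesis
  using assms(3)
proof (cases rule: relators.cases)
  case (R1B g)
  then show ?thesis by (simp add: simps aB_sq del: act_a_gen.simps)
next
  case (R8 g2 g1)
  then show ?thesis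
    using t13[OF B8(1)[of "g2 * inverse fa" "g1"]] by (simp add: simps del: act_a_gen.simps)
next
  case (R9 g2 g1)
  then show ?thesis
    using t14[OF B8(2)[of "g2 * inverse fa" "g1"]] by (simp add: simps del: act_a_gen.simps)
next
  case (R10 g2 g1)
  then show ?thesis
    using t13[OF B8(3)[of "g2 * inverse fa" "g1"]] by (simp add: simps del: act_a_gen.simps)
next
  case (R11 g2 g1)
  then show ?thesis
    using t14[OF B8(4)[of "g2 * inverse fa" "g1"]] by (simp add: simps del: act_a_gen.simps)
qed (simp_all add: simps t1 t2 t5 t6 t7 t8 t9 t10 t11 t12 aA1 aA_sq del: act_a_gen.simps)
qed

end

lemma act_a_relators:
  assumes "r \<in> relators"
  shows "cls (free_lift act_a_gen r) = 0"
proof (rule act_a_relators0[where c = kappa and d = "1 / kappa" and q = Qk and r = "inverse Qk" and rr = r])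
qed (simp_all add: assms cls_ops mult.assoc power2_eq_square)

lift_definition act_a :: "algA \<Rightarrow> algA" is "free_lift act_a_gen"
  by (rule free_lift_respects[OF act_a_relators])


lemma act_s_gens [simp]:
  "act_s (cls (gA g)) = cls (gB (sigma g))" "act_s (cls (gB g)) = cls (gA (sigma g))"
  by (simp_all add: act_s.abs_eq)

lemma act_a_gens:
  "act_a (cls (gA g)) = - kscale (1 / kappa\<^sup>2) (cls (gA 1) * cls (gA (g * inverse fa)) * cls (gA 1))"
  "act_a (cls (gB g)) = kscale (1 / kappa) (kscale Qk (cls (gA 1) * cls (gB (g * inverse fa)))
     - kscale (inverse Qk) (cls (gB (g * inverse fa)) * cls (gA 1)))"
  by (simp_all add: act_a.abs_eq cls_ops)

lemma act_hom:
  "act_s 1 = 1" "act_s (x + y) = act_s x + act_s y" "act_s (x * y) = act_s x * act_s y"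
  "act_s (kscale c x) = kscale c (act_s x)"
  "act_a 1 = 1" "act_a (x + y) = act_a x + act_a y" "act_a (x * y) = act_a x * act_a y"
  "act_a (kscale c x) = kscale c (act_a x)"
  by (transfer; simp add: rel_ideal.zero)+

section \<open>The ring of germs of holomorphic functions\<close>

type_synonym C3 = "complex \<times> complex \<times> complex"

definition Cx3 :: "C3 set" where
  "Cx3 = {(Q, p, s). Q \<noteq> 0 \<and> p \<noteq> 0 \<and> s \<noteq> 0}"

definition open_dense :: "C3 set \<Rightarrow> bool" where
  "open_dense U \<longleftrightarrow> open U \<and> U \<subseteq> Cx3 \<and> Cx3 \<subseteq> closure U"

text \<open>Holomorphic: complex differentiable, with complex linear differential.\<close>

definition holo3 :: "C3 set \<Rightarrow> (C3 \<Rightarrow> complex) \<Rightarrow> bool" where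
  "holo3 U f \<longleftrightarrow> (\<forall>z\<in>U. \<exists>d1 d2 d3.
     (f has_derivative (\<lambda>(h1, h2, h3). d1 * h1 + d2 * h2 + d3 * h3)) (at z))"

text \<open>A function on a subset is a pair of its domain and a total function whose values outside
  the domain are irrelevant.\<close>

definition germ_rel :: "C3 set \<times> (C3 \<Rightarrow> complex) \<Rightarrow> C3 set \<times> (C3 \<Rightarrow> complex) \<Rightarrow> bool" where
  "germ_rel = (\<lambda>(U, f) (V, g). open_dense U \<and> holo3 U f \<and> open_dense V \<and> holo3 V g \<and>
     (\<exists>W. open_dense W \<and> W \<subseteq> U \<inter> V \<and> (\<forall>z\<in>W. f z = g z)))"

lemma open_Cx3: "open Cx3"
proof -
  have *: "Cx3 = (- {0}) \<times> (- {0}) \<times> (- {0})" by (auto simp: Cx3_def)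
  show ?thesis unfolding * by (intro open_Times open_Compl closed_singleton)
qed

lemma open_dense_Cx3 [simp]: "open_dense Cx3"
  using closure_subset by (auto simp: open_dense_def open_Cx3)

lemma open_dense_Int: "open_dense U \<Longrightarrow> open_dense V \<Longrightarrow> open_dense (U \<inter> V)"
  unfolding open_dense_def
  by (metis closure_open_Int_superset le_infI1 open_Int subset_trans)

lemma open_dense_nonempty: "open_dense U \<Longrightarrow> U \<noteq> {}"
  unfolding open_dense_def Cx3_def by (auto dest: subsetD[of _ _ "(1, 1, 1)"])

lemma holo3_subset: "holo3 U f \<Longrightarrow> V \<subseteq> U \<Longrightarrow> holo3 V f"
  unfolding holo3_def by blast

lemma holo3_const: "holo3 U (\<lambda>z. c)"
  unfolding holo3_def
  by (intro ballI exI[of _ 0] has_derivative_eq_rhs[OF has_derivative_const]) auto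

lemma holo3_add:
  assumes "holo3 U f" "holo3 U g" shows "holo3 U (\<lambda>z. f z + g z)"
  unfolding holo3_def
proof
  fix z assume "z \<in> U"
  then obtain a b c a' b' c' where fg:
    "(f has_derivative (\<lambda>(h1, h2, h3). a * h1 + b * h2 + c * h3)) (at z)"
    "(g has_derivative (\<lambda>(h1, h2, h3). a' * h1 + b' * h2 + c' * h3)) (at z)"
    using assms unfolding holo3_def by blast
  have "((\<lambda>z. f z + g z) has_derivative
      (\<lambda>(h1, h2, h3). (a + a') * h1 + (b + b') * h2 + (c + c') * h3)) (at z)"
    by (rule has_derivative_eq_rhs[OF has_derivative_add[OF fg]]) (auto simp: algebra_simps)
  then show "\<exists>d1 d2 d3. ((\<lambda>z. f z + g z) has_derivative
      (\<lambda>(h1, h2, h3). d1 * h1 + d2 * h2 + d3 * h3)) (at z)" by blast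
qed

lemma holo3_mult:
  assumes "holo3 U f" "holo3 U g" shows "holo3 U (\<lambda>z. f z * g z)"
  unfolding holo3_def
proof
  fix z assume "z \<in> U"
  then obtain a b c a' b' c' where fg:
    "(f has_derivative (\<lambda>(h1, h2, h3). a * h1 + b * h2 + c * h3)) (at z)"
    "(g has_derivative (\<lambda>(h1, h2, h3). a' * h1 + b' * h2 + c' * h3)) (at z)"
    using assms unfolding holo3_def by blast
  have "((\<lambda>z. f z * g z) has_derivative
      (\<lambda>(h1, h2, h3). (f z * a' + a * g z) * h1 + (f z * b' + b * g z) * h2 + (f z * c' + c * g z) * h3)) (at z)"
    by (rule has_derivative_eq_rhs[OF has_derivative_mult[OF fg]]) (auto simp: algebra_simps)
  then show "\<exists>d1 d2 d3. ((\<lambda>z. f z * g z) has_derivative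
      (\<lambda>(h1, h2, h3). d1 * h1 + d2 * h2 + d3 * h3)) (at z)" by blast
qed

lemma holo3_uminus: "holo3 U f \<Longrightarrow> holo3 U (\<lambda>z. - f z)"
  using holo3_mult[OF holo3_const[of U "-1"]] by simp

lemma germ_rel_refl: "open_dense U \<Longrightarrow> holo3 U f \<Longrightarrow> germ_rel (U, f) (U, f)"
  unfolding germ_rel_def by auto

quotient_type germR = "C3 set \<times> (C3 \<Rightarrow> complex)" / partial: germ_rel morphisms rep_germR germ
proof (rule part_equivpI)
  show "\<exists>x. germ_rel x x"
    using germ_rel_refl[OF open_dense_Cx3 holo3_const[of _ 0]] by blast
  show "symp germ_rel"
    by (rule sympI) (auto simp: germ_rel_def Int_commute dest: sym)
  show "transp germ_rel"
  proof (rule transpI)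
    fix x y z assume "germ_rel x y" "germ_rel y z"
    then obtain W W' where "open_dense W" "W \<subseteq> fst x \<inter> fst y" "\<forall>z\<in>W. snd x z = snd y z"
      "open_dense W'" "W' \<subseteq> fst y \<inter> fst z" "\<forall>w\<in>W'. snd y w = snd z w"
      unfolding germ_rel_def by (auto simp: case_prod_beta)
    then have "open_dense (W \<inter> W')" "W \<inter> W' \<subseteq> fst x \<inter> fst z" "\<forall>w\<in>W \<inter> W'. snd x w = snd z w"
      by (auto intro: open_dense_Int)
    with \<open>germ_rel x y\<close> \<open>germ_rel y z\<close> show "germ_rel x z"
      unfolding germ_rel_def by (auto simp: case_prod_beta)
  qed
qed

lemma germ_rel_binop:
  assumes "germ_rel x y" "germ_rel x' y'"
    and "\<And>U f g. holo3 U f \<Longrightarrow> holo3 U g \<Longrightarrow> holo3 U (\<lambda>z. F (f z) (g z))"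
  shows "germ_rel ((\<lambda>(U, f) (V, g). (U \<inter> V, \<lambda>z. F (f z) (g z))) x x')
    ((\<lambda>(U, f) (V, g). (U \<inter> V, \<lambda>z. F (f z) (g z))) y y')"
proof -
  obtain W W' where W: "open_dense W" "W \<subseteq> fst x \<inter> fst y" "\<forall>z\<in>W. snd x z = snd y z"
    "open_dense W'" "W' \<subseteq> fst x' \<inter> fst y'" "\<forall>w\<in>W'. snd x' w = snd y' w"
    using assms(1,2) unfolding germ_rel_def by (auto simp: case_prod_beta)
  have "open_dense (W \<inter> W')" "W \<inter> W' \<subseteq> fst x \<inter> fst x' \<inter> (fst y \<inter> fst y')"
    "\<forall>w\<in>W \<inter> W'. F (snd x w) (snd x' w) = F (snd y w) (snd y' w)"
    using W by (auto intro: open_dense_Int)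
  moreover have "holo3 (fst x \<inter> fst x') (\<lambda>z. F (snd x z) (snd x' z))"
    "holo3 (fst y \<inter> fst y') (\<lambda>z. F (snd y z) (snd y' z))"
    using assms(1,2) by (auto intro!: assms(3) intro: holo3_subset simp: germ_rel_def)
  moreover have "open_dense (fst x \<inter> fst x')" "open_dense (fst y \<inter> fst y')"
    using assms(1,2) by (auto intro!: open_dense_Int simp: germ_rel_def)
  ultimately show ?thesis
    unfolding germ_rel_def case_prod_beta by auto
qed

instantiation germR :: comm_ring_1
begin

lift_definition zero_germR :: germR is "(Cx3, \<lambda>z. 0)"
  by (simp add: germ_rel_refl holo3_const)

lift_definition one_germR :: germR is "(Cx3, \<lambda>z. 1)"
  by (simp add: germ_rel_refl holo3_const)

lift_definition plus_germR :: "germR \<Rightarrow> germR \<Rightarrow> germR"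
  is "\<lambda>(U, f) (V, g). (U \<inter> V, \<lambda>z. f z + g z)"
  by (rule germ_rel_binop, assumption+) (rule holo3_add)

lift_definition times_germR :: "germR \<Rightarrow> germR \<Rightarrow> germR"
  is "\<lambda>(U, f) (V, g). (U \<inter> V, \<lambda>z. f z * g z)"
  by (rule germ_rel_binop, assumption+) (rule holo3_mult)

lift_definition uminus_germR :: "germR \<Rightarrow> germR" is "\<lambda>(U, f). (U, \<lambda>z. - f z)"
  unfolding germ_rel_def by (auto intro: holo3_uminus)

definition minus_germR :: "germR \<Rightarrow> germR \<Rightarrow> germR" where
  "minus_germR x y = x + - y"

lemma germ_relI:
  assumes "open_dense U" "holo3 U f" "open_dense V" "holo3 V g" "\<And>z. z \<in> U \<inter> V \<Longrightarrow> f z = g z"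
  shows "germ_rel (U, f) (V, g)"
  using assms open_dense_Int[of U V] unfolding germ_rel_def by auto

lemma germ_relD: "germ_rel (U, f) (U, f) \<Longrightarrow> open_dense U \<and> holo3 U f"
  by (simp add: germ_rel_def)

instance
proof
  fix x y z :: germR
  note intros = germ_relI open_dense_Int open_dense_Cx3 holo3_add holo3_mult holo3_uminus holo3_const
  note [intro] = holo3_subset
  show "x + y + z = x + (y + z)" "x * y * z = x * (y * z)" "(x + y) * z = x * z + y * z"
    by (transfer, clarsimp dest!: germ_relD, intro intros; (blast intro: holo3_subset | simp add: algebra_simps))+
  show "x + y = y + x" "x * y = y * x"
    by (transfer, clarsimp dest!: germ_relD, intro intros; (blast intro: holo3_subset | simp add: algebra_simps))+
  show "0 + x = x" "1 * x = x" "- x + x = 0"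
    by (transfer, clarsimp dest!: germ_relD, intro intros; (blast intro: holo3_subset | simp add: algebra_simps))+
  show "x - y = x + - y" by (rule minus_germR_def)
  show "(0 :: germR) \<noteq> 1"
  proof transfer
    show "\<not> germ_rel (Cx3, \<lambda>z. 0) (Cx3, \<lambda>z. 1)"
      using open_dense_nonempty by (fastforce simp: germ_rel_def)
  qed
qed

end


lemma mono_map_inverse:
  fixes p s :: complex and k l m n :: int
  assumes "k * n - l * m = 1" "p \<noteq> 0" "s \<noteq> 0"
  shows "(p powi k * s powi l) powi n * (p powi m * s powi n) powi (- l) = p"
    and "(p powi k * s powi l) powi (- m) * (p powi m * s powi n) powi k = s"
proof -
  have *: "(p powi k * s powi l) powi x * (p powi m * s powi n) powi y
      = p powi (k * x + m * y) * s powi (l * x + n * y)" for x y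
    using assms(2,3)
    by (simp add: power_int_mult_distrib power_int_add flip: power_int_mult)
  show "(p powi k * s powi l) powi n * (p powi m * s powi n) powi (- l) = p"
    "(p powi k * s powi l) powi (- m) * (p powi m * s powi n) powi k = s"
    unfolding * using assms(1) by (simp_all add: algebra_simps)
qed

text \<open>The monomial substitution \<open>(p, s) \<mapsto> (p\<^sup>k s\<^sup>l, p\<^sup>m s\<^sup>n)\<close>.\<close>

definition mono_map :: "int^2^2 \<Rightarrow> C3 \<Rightarrow> C3" where
  "mono_map M = (\<lambda>(Q, p, s).
     (Q, p powi (M$1$1) * s powi (M$1$2), p powi (M$2$1) * s powi (M$2$2)))"

definition adj2 :: "int^2^2 \<Rightarrow> int^2^2" where
  "adj2 M = vector [vector [M$2$2, - (M$1$2)], vector [- (M$2$1), M$1$1]]"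

lemma det_adj2: "det (adj2 M) = det M"
  by (simp add: adj2_def det_2)

lemma adj2_adj2: "adj2 (adj2 M) = M"
  by (simp add: adj2_def vec_eq_iff forall_2)

lemma mono_map_Cx3: "z \<in> Cx3 \<Longrightarrow> mono_map M z \<in> Cx3"
  by (auto simp: mono_map_def Cx3_def)

lemma mono_map_adj2:
  assumes "det M = 1" "z \<in> Cx3"
  shows "mono_map (adj2 M) (mono_map M z) = z"
  using assms mono_map_inverse[of "M$1$1" "M$2$2" "M$1$2" "M$2$1"]
  by (auto simp: mono_map_def adj2_def det_2 Cx3_def mult.commute)

lemma mono_map_adj2':
  assumes "det M = 1" "z \<in> Cx3"
  shows "mono_map M (mono_map (adj2 M) z) = z"
  using mono_map_adj2[of "adj2 M" z] assms by (simp add: det_adj2 adj2_adj2)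

lemma mono_map_has_derivative:
  assumes "z \<in> Cx3"
  shows "\<exists>a b c d. (mono_map M has_derivative (\<lambda>(h1, h2, h3). (h1, a * h2 + b * h3, c * h2 + d * h3))) (at z)"
proof -
  obtain Q p s where z: "z = (Q, p, s)" by (cases z)
  have nz: "p \<noteq> 0" "s \<noteq> 0" using assms by (auto simp: Cx3_def z)
  have *: "((\<lambda>z :: C3. fst (snd z) powi k * snd (snd z) powi l) has_derivative
    (\<lambda>(h1, h2, h3). (of_int k * p powi (k - 1) * s powi l) * h2 + (p powi k * (of_int l * s powi (l - 1))) * h3))
    (at z)" for k l
    by (rule has_derivative_eq_rhs, (rule derivative_intros)+)
      (use nz in \<open>auto simp: z fun_eq_iff algebra_simps intro!: derivative_eq_intros\<close>)
  then obtain a b c d where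
    1: "((\<lambda>z :: C3. fst (snd z) powi (M$1$1) * snd (snd z) powi (M$1$2)) has_derivative
      (\<lambda>(h1, h2, h3). a * h2 + b * h3)) (at z)" and
    2: "((\<lambda>z :: C3. fst (snd z) powi (M$2$1) * snd (snd z) powi (M$2$2)) has_derivative
      (\<lambda>(h1, h2, h3). c * h2 + d * h3)) (at z)"
    by meson
  have "(mono_map M has_derivative (\<lambda>(h1, h2, h3). (h1, a * h2 + b * h3, c * h2 + d * h3))) (at z)"
    unfolding mono_map_def case_prod_beta
    using has_derivative_Pair[OF has_derivative_fst[OF has_derivative_ident] has_derivative_Pair[OF 1 2]]
    by (simp add: case_prod_beta)
  then show ?thesis by blast
qed

lemma holo3_mono_map:
  assumes "holo3 U f" "V \<subseteq> Cx3" "\<And>z. z \<in> V \<Longrightarrow> mono_map M z \<in> U"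
  shows "holo3 V (\<lambda>z. f (mono_map M z))"
  unfolding holo3_def
proof
  fix z assume z: "z \<in> V"
  obtain d1 d2 d3 where f: "(f has_derivative (\<lambda>(h1, h2, h3). d1 * h1 + d2 * h2 + d3 * h3)) (at (mono_map M z))"
    using assms(1) assms(3)[OF z] unfolding holo3_def by blast
  obtain a b c d where m: "(mono_map M has_derivative (\<lambda>(h1, h2, h3). (h1, a * h2 + b * h3, c * h2 + d * h3))) (at z)"
    using mono_map_has_derivative z assms(2) by blast
  have "((\<lambda>z. f (mono_map M z)) has_derivative
    (\<lambda>(h1, h2, h3). d1 * h1 + (d2 * a + d3 * c) * h2 + (d2 * b + d3 * d) * h3)) (at z)"
    by (rule has_derivative_eq_rhs[OF has_derivative_compose[OF m f]]) (auto simp: fun_eq_iff algebra_simps)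
  then show "\<exists>d1 d2 d3. ((\<lambda>z. f (mono_map M z)) has_derivative (\<lambda>(h1, h2, h3). d1 * h1 + d2 * h2 + d3 * h3)) (at z)"
    by blast
qed

lemma continuous_on_mono_map: "continuous_on Cx3 (mono_map M)"
proof (rule continuous_at_imp_continuous_on, rule ballI)
  fix z assume "z \<in> Cx3"
  then show "isCont (mono_map M) z"
    using mono_map_has_derivative has_derivative_continuous by blast
qed

lemma open_dense_mono_map:
  assumes "det M = 1" "open_dense U"
  shows "open_dense {z \<in> Cx3. mono_map M z \<in> U}"
proof -
  have op: "open {z \<in> Cx3. mono_map N z \<in> W}" if "open W" for N W
  proof -
    have "open (Cx3 \<inter> mono_map N -` W)"
      using continuous_on_mono_map open_Cx3 that by (auto intro: continuous_open_preimage)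
    then show ?thesis by (simp add: Int_def vimage_def)
  qed
  have "z \<in> closure {z \<in> Cx3. mono_map M z \<in> U}" if "z \<in> Cx3" for z
  proof (subst closure_iff_nhds_not_empty, intro allI impI)
    fix B V assume V: "V \<subseteq> B" "open V" "z \<in> V"
    let ?V' = "{w \<in> Cx3. mono_map (adj2 M) w \<in> V}"
    have "open ?V'" by (rule op) fact
    moreover have "mono_map M z \<in> ?V'"
      using mono_map_adj2[OF assms(1) that] V that by (simp add: mono_map_Cx3)
    moreover have "mono_map M z \<in> closure U"
      using assms(2) mono_map_Cx3[OF that] by (auto simp: open_dense_def)
    ultimately have "U \<inter> ?V' \<noteq> {}"
      unfolding closure_iff_nhds_not_empty by blast
    then obtain w where w: "w \<in> U" "w \<in> Cx3" "mono_map (adj2 M) w \<in> V" by blast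
    then have "mono_map (adj2 M) w \<in> {z \<in> Cx3. mono_map M z \<in> U}"
      using mono_map_adj2'[OF assms(1) w(2)] by (simp add: mono_map_Cx3)
    with w V show "{z \<in> Cx3. mono_map M z \<in> U} \<inter> B \<noteq> {}" by blast
  qed
  then show ?thesis
    using assms(2) op[of U M] by (auto simp: open_dense_def)
qed

text \<open>Pullback along \<open>mono_map M\<close>; only meant for \<open>M\<close> in \<open>SL(2, \<int>)\<close>.\<close>

lift_definition delta :: "int^2^2 \<Rightarrow> germR \<Rightarrow> germR" is
  "\<lambda>M (U, f). if det M = 1 then ({z \<in> Cx3. mono_map M z \<in> U}, \<lambda>z. f (mono_map M z)) else (U, f)"
proof -
  fix M and x y :: "C3 set \<times> (C3 \<Rightarrow> complex)"
  assume *: "germ_rel x y"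
  then obtain U f V g W where xy: "x = (U, f)" "y = (V, g)"
    "open_dense U" "holo3 U f" "open_dense V" "holo3 V g"
    and W: "open_dense W" "W \<subseteq> U \<inter> V" "\<forall>z\<in>W. f z = g z"
    unfolding germ_rel_def by auto
  have "\<exists>W. open_dense W \<and> W \<subseteq> {z \<in> Cx3. mono_map M z \<in> U} \<inter> {z \<in> Cx3. mono_map M z \<in> V} \<and>
     (\<forall>z\<in>W. f (mono_map M z) = g (mono_map M z))" if "det M = 1"
    using W by (intro exI[of _ "{z \<in> Cx3. mono_map M z \<in> W}"]) (auto intro: open_dense_mono_map that)
  moreover have "holo3 {z \<in> Cx3. mono_map M z \<in> U} (\<lambda>z. f (mono_map M z))"
    "holo3 {z \<in> Cx3. mono_map M z \<in> V} (\<lambda>z. g (mono_map M z))"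
    using xy by (auto intro: holo3_mono_map)
  ultimately show "germ_rel
      (case x of (U, f) \<Rightarrow> if det M = 1 then ({z \<in> Cx3. mono_map M z \<in> U}, \<lambda>z. f (mono_map M z)) else (U, f))
      (case y of (U, f) \<Rightarrow> if det M = 1 then ({z \<in> Cx3. mono_map M z \<in> U}, \<lambda>z. f (mono_map M z)) else (U, f))"
    using xy * by (auto simp: germ_rel_def open_dense_mono_map)
qed

lemma open_dense_poly_nonzero:
  assumes "b \<noteq> (0 :: complex poly)"
  shows "open_dense {(Q, p, s) \<in> Cx3. poly b Q \<noteq> 0}"
proof -
  let ?R = "insert 0 {x. poly b x = 0}"
  have fin: "finite ?R" using poly_roots_finite[OF assms] by simp
  have eq: "{(Q, p, s) \<in> Cx3. poly b Q \<noteq> 0} = (- ?R) \<times> (- {0}) \<times> (- {0})"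
    by (auto simp: Cx3_def)
  have "open ((- ?R) \<times> (- {0 :: complex}) \<times> (- {0 :: complex}))"
    by (intro open_Times open_Compl finite_imp_closed fin closed_singleton)
  moreover have "closure ((- ?R) \<times> (- {0 :: complex}) \<times> (- {0 :: complex})) = UNIV"
    unfolding closure_Times closure_complement using fin by (simp add: empty_interior_finite)
  ultimately show ?thesis unfolding eq open_dense_def by (auto simp: Cx3_def)
qed

lemma holo3_poly_quotient:
  "holo3 {(Q, p, s) \<in> Cx3. poly b Q \<noteq> 0} (\<lambda>(Q, p, s). poly a Q / poly b Q)"
  unfolding holo3_def
proof
  fix z assume "z \<in> {(Q, p, s) \<in> Cx3. poly b Q \<noteq> 0}"
  then have nz: "poly b (fst z) \<noteq> 0" by auto
  have "((\<lambda>Q. poly a Q / poly b Q) has_field_derivative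
     ((poly (pderiv a) (fst z) * poly b (fst z) - poly a (fst z) * poly (pderiv b) (fst z)) /
       (poly b (fst z) * poly b (fst z)))) (at (fst z))" (is "(_ has_field_derivative ?d) _")
    by (intro DERIV_divide poly_DERIV nz)
  then have "((\<lambda>Q. poly a Q / poly b Q) has_derivative (*) ?d) (at (fst z))"
    by (simp add: has_field_derivative_def)
  from has_derivative_compose[OF has_derivative_fst[OF has_derivative_ident] this]
  have "((\<lambda>(Q, p, s). poly a Q / poly b Q) has_derivative (\<lambda>(h1, h2, h3). ?d * h1 + 0 * h2 + 0 * h3)) (at z)"
    by (simp add: case_prod_unfold)
  then show "\<exists>d1 d2 d3. ((\<lambda>(Q, p, s). poly a Q / poly b Q) has_derivative (\<lambda>(h1, h2, h3). d1 * h1 + d2 * h2 + d3 * h3)) (at z)"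
    by blast
qed

text \<open>The inclusion of \<open>k\<close>, the rational functions in the coordinate \<open>Q\<close>.\<close>

lift_definition emb :: "complex poly fract \<Rightarrow> germR" is
  "\<lambda>(a, b). ({(Q, p, s) \<in> Cx3. poly b Q \<noteq> 0}, \<lambda>(Q, p, s). poly a Q / poly b Q)"
proof -
  fix x y :: "complex poly \<times> complex poly"
  assume *: "fractrel x y"
  obtain a b c d where xy: "x = (a, b)" "y = (c, d)" by (cases x, cases y)
  with * have nz: "b \<noteq> 0" "d \<noteq> 0" and "a * d = c * b" by auto
  then have "poly a Q * poly d Q = poly c Q * poly b Q" for Q
    by (simp flip: poly_mult)
  then have "poly a Q / poly b Q = poly c Q / poly d Q" if "poly b Q \<noteq> 0" "poly d Q \<noteq> 0" for Q
    using that by (simp add: field_simps)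
  then have "germ_rel ({(Q, p, s) \<in> Cx3. poly b Q \<noteq> 0}, \<lambda>(Q, p, s). poly a Q / poly b Q)
    ({(Q, p, s) \<in> Cx3. poly d Q \<noteq> 0}, \<lambda>(Q, p, s). poly c Q / poly d Q)"
    by (intro germ_relI open_dense_poly_nonzero holo3_poly_quotient nz) auto
  then show "germ_rel
      (case x of (a, b) \<Rightarrow> ({(Q, p, s) \<in> Cx3. poly b Q \<noteq> 0}, \<lambda>(Q, p, s). poly a Q / poly b Q))
      (case y of (a, b) \<Rightarrow> ({(Q, p, s) \<in> Cx3. poly b Q \<noteq> 0}, \<lambda>(Q, p, s). poly a Q / poly b Q))"
    by (simp add: xy)
qed


subsection \<open>The plethystic exponent\<close>

text \<open>Laurent polynomials in \<open>Q, p, s\<close> with integer coefficients; the key \<open>(i, j, k)\<close>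
  stands for \<open>Q\<^sup>i p\<^sup>j s\<^sup>k\<close>.\<close>

type_synonym laurent = "(int \<times> int \<times> int) \<Rightarrow>\<^sub>0 int"

definition lmon :: "int \<Rightarrow> int \<Rightarrow> int \<Rightarrow> laurent" where
  "lmon i j k = Poly_Mapping.single (i, j, k) 1"

text \<open>\<open>(z; p\<^sub>1, \<dots>, p\<^sub>n)\<close> for \<open>0 < |p\<^sub>j| < 1\<close>, as an unordered product over all \<open>n\<close>-tuples of
  exponents.\<close>

definition qpoch :: "complex \<Rightarrow> complex list \<Rightarrow> complex" where
  "qpoch z ps = Lim (finite_subsets_at_top {ns :: nat list. length ns = length ps})
     (\<lambda>F. \<Prod>ns\<in>F. 1 - z * prod_list (map2 (^) ps ns))"

text \<open>The extension to \<open>|p\<^sub>j| \<noteq> 0, 1\<close>: the rule of \<open>qpoch_ext_inverse\<close> below is applied once for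
  every base of modulus greater than 1. With \<open>inverse 0 = 0\<close>, the value is 0 exactly at the
  zeros and poles.\<close>

definition qpoch_ext :: "complex \<Rightarrow> complex list \<Rightarrow> complex" where
  "qpoch_ext z ps =
     (let J = filter (\<lambda>q. cmod q > 1) ps;
          w = qpoch (z / prod_list J) (map (\<lambda>q. if cmod q > 1 then inverse q else q) ps)
      in if even (length J) then w else inverse w)"

lemma qpoch_ext_inside: "(\<And>q. q \<in> set ps \<Longrightarrow> cmod q < 1) \<Longrightarrow> qpoch_ext z ps = qpoch z ps"
proof -
  assume *: "\<And>q. q \<in> set ps \<Longrightarrow> cmod q < 1"
  then have "filter (\<lambda>q. cmod q > 1) ps = []" by (force simp: filter_empty_conv)
  moreover have "map (\<lambda>q. if cmod q > 1 then inverse q else q) ps = ps"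
    using * by (force intro: map_idI)
  ultimately show ?thesis by (simp add: qpoch_ext_def)
qed

lemma qpoch_ext_inverse:
  assumes "p \<noteq> 0" "cmod p \<noteq> 1"
  shows "qpoch_ext z (us @ inverse p # vs) = 1 / qpoch_ext (p * z) (us @ p # vs)"
proof (cases "cmod p > 1")
  case True
  then have "\<not> cmod (inverse p) > 1" by (simp add: norm_inverse inverse_le_1_iff not_less)
  with True assms(1) show ?thesis by (simp add: qpoch_ext_def Let_def field_simps)
next
  case False
  with assms have "cmod p < 1" "cmod p > 0" by auto
  then have "cmod (inverse p) > 1" by (simp add: norm_inverse one_less_inverse_iff)
  with False assms(1) show ?thesis by (simp add: qpoch_ext_def Let_def field_simps)
qed

text \<open>The denominator \<open>\<Prod>(1 - p\<^sup>a s\<^sup>b)\<close> is given by the list of its exponents \<open>(a, b)\<close>.\<close>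

definition pexp_factor :: "(int \<times> int) list \<Rightarrow> int \<times> int \<times> int \<Rightarrow> C3 \<Rightarrow> complex" where
  "pexp_factor ds = (\<lambda>(i, j, k) (Q, p, s).
     qpoch_ext (Q powi i * p powi j * s powi k) (map (\<lambda>(a, b). p powi a * s powi b) ds))"

definition pexp_dom :: "laurent \<Rightarrow> (int \<times> int) list \<Rightarrow> C3 set" where
  "pexp_dom \<mu> ds = {(Q, p, s) \<in> Cx3. (\<forall>(a, b)\<in>set ds. cmod (p powi a * s powi b) \<noteq> 1) \<and>
     (\<forall>m\<in>Poly_Mapping.keys \<mu>. pexp_factor ds m (Q, p, s) \<noteq> 0)}"

definition pexp :: "laurent \<Rightarrow> (int \<times> int) list \<Rightarrow> germR" where
  "pexp \<mu> ds = germ (pexp_dom \<mu> ds,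
     \<lambda>z. \<Prod>m\<in>Poly_Mapping.keys \<mu>. pexp_factor ds m z powi Poly_Mapping.lookup \<mu> m)"

text \<open>\<open>pexp (\<mu> / \<Prod>(1 + p\<^sup>a s\<^sup>b))\<close>, each factor being read as \<open>(1 - X) / (1 - X\<^sup>2)\<close>.\<close>

definition pexp_plus :: "laurent \<Rightarrow> (int \<times> int) list \<Rightarrow> germR" where
  "pexp_plus \<mu> ds = pexp (\<mu> * (\<Prod>(a, b)\<leftarrow>ds. 1 - lmon 0 a b)) (map (\<lambda>(a, b). (2 * a, 2 * b)) ds)"

definition Q8 :: laurent where "Q8 = lmon 8 0 0 - lmon (- 8) 0 0"

definition unit_inv :: "germR \<Rightarrow> germR" where
  "unit_inv x = (THE y. x * y = 1)"

subsection \<open>The operators\<close>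

definition delta_hat :: "int^2^2 \<Rightarrow> germR^3 \<Rightarrow> germR^3" where
  "delta_hat M v = (\<chi> i. delta M (v $ i))"

definition D_A :: "germR^3^3" where
  "D_A = vector [vector [1, 0, 0], vector [0, emb (- const_k \<i> * Qk), 0], vector [0, 0, - 1]]"

definition alpha :: germR where
  "alpha = pexp (- Q8 * lmon 0 1 (- 1) * (lmon 0 0 2 + 2 * lmon 0 1 1 + lmon 0 1 0)) [(0, 2), (2, - 2)]"

definition beta :: germR where
  "beta = pexp (- Q8 * lmon 0 1 (- 1) * (lmon 0 0 1 + 2 * lmon 0 1 1 + lmon 0 1 0)) [(0, 2), (2, - 2)]"

definition gamma :: germR where
  "gamma = pexp (- Q8 * lmon 0 1 0 * (lmon 0 0 1 + 2 * lmon 0 1 0 + 1)) [(0, 2), (2, - 2)]"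

definition D_B :: "germR^3^3" where
  "D_B = vector
    [vector [alpha, emb (2 * Qk / (1 - Qk ^ 4)) * beta, emb (2 * Qk ^ 4 / (1 - Qk ^ 4)\<^sup>2) * alpha],
     vector [emb (- (1 - Qk ^ 4) / Qk ^ 3) * gamma, 0, emb (2 * Qk / (1 - Qk ^ 4)) * gamma],
     vector [emb ((1 - Qk ^ 4)\<^sup>2 / (2 * Qk ^ 4)) * alpha, emb (- (1 - Qk ^ 4) / Qk ^ 3) * beta, alpha]]"

definition D_A_hat :: "germR^3 \<Rightarrow> germR^3" where
  "D_A_hat = (*v) D_A \<circ> delta_hat (mat2 1 1 0 1)"

definition D_B_hat :: "germR^3 \<Rightarrow> germR^3" where
  "D_B_hat = (*v) D_B \<circ> delta_hat (mat2 1 0 (- 1) 1)"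

definition S_hat :: "germR^3 \<Rightarrow> germR^3" where
  "S_hat = D_A_hat \<circ> D_B_hat \<circ> D_A_hat"

subsection \<open>The matrices\<close>

definition mscale :: "germR \<Rightarrow> germR^3^3 \<Rightarrow> germR^3^3" where
  "mscale c M = (\<chi> i j. c * M $ i $ j)"

definition Omat_A1 :: "germR^3^3" where
  "Omat_A1 = vector [vector [emb (- const_k \<i> * kappa), 0, 0], vector [0, 0, 0],
     vector [0, 0, emb (const_k \<i> * kappa)]]"

definition e_germ :: germR where
  "e_germ = pexp (Q8 * lmon 0 1 1 * (1 - lmon 0 1 0)) [(0, 2), (2, 0)]"

definition Omat_B1 :: "germR^3^3" where
  "Omat_B1 = vector [vector [0, e_germ, 0],
     vector [emb (- (kappa\<^sup>2 / 2)) * unit_inv e_germ, 0, unit_inv e_germ],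
     vector [0, emb (- (kappa\<^sup>2 / 2)) * e_germ, 0]]"

definition c_plus :: "free2 \<Rightarrow> free2 \<Rightarrow> germR" where
  "c_plus h g = (let G = phi g; H = phi (h * g) in
     pexp_plus Q8 [(G$2$1, - (G$2$2)), (H$1$1, - (H$1$2)), (- (H$2$1), H$2$2)])"

definition c_minus :: "free2 \<Rightarrow> free2 \<Rightarrow> germR" where
  "c_minus h g = (let G = phi g; H = phi (h * g) in
     pexp_plus (- Q8) [(G$2$1, - (G$2$2)), (- (H$1$1), H$1$2), (- (H$2$1), H$2$2)])"

definition one_or_b_initial :: "free2 \<Rightarrow> bool" where
  "one_or_b_initial g \<longleftrightarrow> word_of g = [] \<or> hd (word_of g) \<in> {Lb, Lb_inv}"

definition step_A :: "germR \<Rightarrow> germR^3^3 \<Rightarrow> germR^3^3" where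
  "step_A c M = mscale c M + mscale (emb (1 / kappa\<^sup>2) * (c - unit_inv c)) (Omat_B1 ** Omat_B1 ** M)"

definition Omat_A_family :: "(free2 \<Rightarrow> germR^3^3) \<Rightarrow> bool" where
  "Omat_A_family F \<longleftrightarrow> F 1 = Omat_A1 \<and> (\<forall>k g. one_or_b_initial g \<longrightarrow>
     F (fb * fa powi k * g) = step_A (c_plus (fb * fa powi k) g) (F g) \<and>
     F (inverse fb * fa powi k * g) = step_A (c_minus (inverse fb * fa powi k) g) (F g))"

definition Omat_A :: "free2 \<Rightarrow> germR^3^3" where
  "Omat_A = (THE F. Omat_A_family F)"

text \<open>The unique matrix \<open>N\<close> such that multiplication by \<open>N\<close> is the operator \<open>T\<^sup>-\<^sup>1 M T\<close>.\<close>

definition conj_mat :: "(germR^3 \<Rightarrow> germR^3) \<Rightarrow> germR^3^3 \<Rightarrow> germR^3^3" where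
  "conj_mat T M = (THE N. (*v) N = inv T \<circ> (*v) M \<circ> T)"

definition Omat_B :: "free2 \<Rightarrow> germR^3^3" where
  "Omat_B g = conj_mat S_hat (Omat_A (sigma g))"

subsection \<open>The representation\<close>

fun gen_mat :: "ogen \<Rightarrow> germR^3^3" where
  "gen_mat (OA g) = Omat_A g"
| "gen_mat (OB g) = Omat_B g"

definition Psi_free :: "free_alg \<Rightarrow> germR^3^3" where
  "Psi_free x = (\<Sum>w\<in>Poly_Mapping.keys x.
     mscale (emb (Poly_Mapping.lookup x w)) (foldr (**) (map gen_mat w) (mat 1)))"

definition k_alg_hom ::
    "(kfield \<Rightarrow> 'a \<Rightarrow> 'a) \<Rightarrow> ('a :: {ring, monoid_mult} \<Rightarrow> germR^3^3) \<Rightarrow> bool" where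
  "k_alg_hom sc f \<longleftrightarrow> f 1 = mat 1 \<and> (\<forall>x y. f (x + y) = f x + f y) \<and>
     (\<forall>x y. f (x * y) = f x ** f y) \<and> (\<forall>c x. f (sc c x) = mscale (emb c) (f x))"

end

theory Submission
  imports Defs "HOL-Complex_Analysis.Cauchy_Integral_Formula"
begin

text \<open>
  In the basis \<open>v\<^sub>+ = (1, 0, \<kappa>\<^sup>2/2)\<close>, \<open>v\<^sub>- = (1, 0, - \<kappa>\<^sup>2/2)\<close>, \<open>w = (0, 1, 0)\<close> all matrices in sight are
  monomial. The matrix of \<open>A\<^sup>(\<^sup>g\<^sup>)\<close> exchanges \<open>v\<^sub>+\<close> and \<open>v\<^sub>-\<close> with coefficients \<open>C\<^sub>g\<^sup>\<plusminus>\<^sup>1\<close>, and that of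
  \<open>B\<^sup>(\<^sup>g\<^sup>)\<close> exchanges \<open>v\<^sub>-\<close> and \<open>w\<close> with coefficients \<open>E\<^sub>g\<^sup>\<plusminus>\<^sup>1\<close>, so that every relation becomes a
  multiplicative identity between the units \<open>C\<^sub>g\<close> and \<open>E\<^sub>g\<close>. The unit \<open>C\<^sub>g\<close> is a cocycle on the free group
  with \<open>C\<^sub>a = 1\<close> and \<open>C\<^sub>b\<close> attached to the Farey triangle spanned by the rows of a matrix, and \<open>E\<^sub>g\<close> is
  \<open>C\<close> of \<open>\<sigma> g\<close> transported by the rotation of order four and inverted, up to a factor independent
  of \<open>g\<close>. The braid-like relations then express that \<open>aba\<close> acts as this rotation and that the unit of a
  triangle depends only on the set of its three edge directions. Such identities reduce to
  identities of rational functions in \<open>p\<close> and \<open>s\<close>.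
\<close>

section \<open>Complex analysis: uniform limits of holomorphic functions and convergence of
  unordered products\<close>

section \<open>Holomorphic functions of three variables\<close>

text \<open>A pair of a domain and a function names an element of \<open>germR\<close> only if the
  domain is open dense and the function is holomorphic on it, so no identity about
  \<open>pexp\<close> is available before convergence, holomorphy and density are settled.
  Afterwards a single functional equation, which adds or removes one base of the product, reduces
  every identity to cross-multiplication of Laurent polynomials. The adapted basis comes from the
  squares of the generators: the square of \<open>Omat_A1\<close> is -\<kappa>^2 times the
  projection to the span of v+ and v-, and that of \<open>Omat_B1\<close> the same for v- and w.
  Hence the recursion defining the family multiplies the v+ part by c and the v- part by 1/c, which
  makes C multiplicative. The recursion is also imposed when k = 0 and the new letter cancels the
  first letter of g. It is therefore consistent only because C respects free cancellation, and it is
  these cancelling instances that determine the values at words beginning with a power of a.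
  Conjugation is verified as an intertwining identity between monomial matrices, so no semilinear
  operator is inverted.\<close>

lemma norm_C3_scale:
  fixes t h1 h2 h3 :: complex
  shows "norm (t * h1, t * h2, t * h3) = cmod t * norm (h1, h2, h3)"
proof -
  have "(cmod t * cmod h1)\<^sup>2 + ((cmod t * cmod h2)\<^sup>2 + (cmod t * cmod h3)\<^sup>2)
      = (cmod t)\<^sup>2 * ((cmod h1)\<^sup>2 + ((cmod h2)\<^sup>2 + (cmod h3)\<^sup>2))"
    by (simp add: algebra_simps)
  then show ?thesis
    by (simp add: norm_Pair norm_mult real_sqrt_mult)
qed

text \<open>Cauchy's inequality in one variable, applied to the restriction of \<open>f\<close> to
  the complex line through \<open>z\<close> in the direction (h1, h2, h3). The disc of radius r /
  |h| in the parameter stays within distance r of \<open>z\<close>, hence inside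
  \<open>U\<close>.\<close>

lemma holo3_derivative_bound:
  assumes "holo3 U f" "ball z (2 * r) \<subseteq> U" "r > 0" "\<And>w. w \<in> U \<Longrightarrow> cmod (f w) \<le> B"
    and "(f has_derivative (\<lambda>(h1, h2, h3). a * h1 + b * h2 + c * h3)) (at z)"
  shows "cmod (a * h1 + b * h2 + c * h3) \<le> B / r * norm (h1, h2, h3)"
proof (cases "norm (h1, h2, h3) = 0")
  case True
  then have "h1 = 0" "h2 = 0" "h3 = 0" by (simp_all add: prod_eq_iff)
  then show ?thesis by simp
next
  case False
  define \<rho> where "\<rho> = r / norm (h1, h2, h3)"
  have \<rho>: "\<rho> > 0" using False assms(3) by (simp add: \<rho>_def)
  define \<gamma> where "\<gamma> t = z + (t * h1, t * h2, t * h3)" for t :: complex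
  have \<gamma>_deriv: "(\<gamma> has_derivative (\<lambda>t. (t * h1, t * h2, t * h3))) (at t)" for t
    unfolding \<gamma>_def by (auto intro!: derivative_eq_intros)
  have inU: "\<gamma> t \<in> U" if "t \<in> cball 0 \<rho>" for t
  proof -
    have "cmod t * norm (h1, h2, h3) \<le> r"
      using that False assms(3) by (simp add: \<rho>_def pos_le_divide_eq)
    then have "norm (\<gamma> t - z) < 2 * r"
      using assms(3) unfolding \<gamma>_def add_diff_cancel_left' norm_C3_scale by simp
    then show ?thesis using assms(2) by (metis dist_commute dist_norm mem_ball subsetD)
  qed
  have der: "\<exists>d. ((\<lambda>t. f (\<gamma> t)) has_field_derivative d) (at t)" if t: "t \<in> cball 0 \<rho>" for t
  proof -
    obtain a b c where "(f has_derivative (\<lambda>(h1, h2, h3). a * h1 + b * h2 + c * h3)) (at (\<gamma> t))"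
      using assms(1) inU[OF t] unfolding holo3_def by blast
    from has_derivative_compose[OF \<gamma>_deriv this]
    have "((\<lambda>t. f (\<gamma> t)) has_derivative (*) (a * h1 + b * h2 + c * h3)) (at t)"
      by (rule has_derivative_eq_rhs) (auto simp: algebra_simps)
    then show ?thesis by (auto simp: has_field_derivative_def)
  qed
  have "\<gamma> 0 = z" by (simp add: \<gamma>_def zero_prod_def[symmetric])
  then have "(f has_derivative (\<lambda>(h1, h2, h3). a * h1 + b * h2 + c * h3)) (at (\<gamma> 0))"
    using assms(5) by (simp only:)
  from has_derivative_compose[OF \<gamma>_deriv this]
  have "((\<lambda>t. f (\<gamma> t)) has_derivative (*) (a * h1 + b * h2 + c * h3)) (at 0)"
    by (rule has_derivative_eq_rhs) (auto simp: algebra_simps)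
  then have deriv0: "deriv (\<lambda>t. f (\<gamma> t)) 0 = a * h1 + b * h2 + c * h3"
    by (simp add: has_field_derivative_def DERIV_imp_deriv)
  have "cmod ((deriv ^^ 1) (\<lambda>t. f (\<gamma> t)) 0) \<le> fact 1 * B / \<rho> ^ 1"
  proof (rule Cauchy_inequality[OF _ _ \<rho>])
    show "(\<lambda>t. f (\<gamma> t)) holomorphic_on ball 0 \<rho>"
    proof (rule holomorphic_onI)
      fix t :: complex assume "t \<in> ball 0 \<rho>"
      with der[of t] have "(\<lambda>t. f (\<gamma> t)) field_differentiable at t"
        by (simp add: field_differentiable_def)
      then show "(\<lambda>t. f (\<gamma> t)) field_differentiable at t within ball 0 \<rho>"
        by (rule field_differentiable_at_within)
    qed
    show "continuous_on (cball 0 \<rho>) (\<lambda>t. f (\<gamma> t))"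
    proof (intro continuous_at_imp_continuous_on ballI)
      fix t :: complex assume "t \<in> cball 0 \<rho>"
      from der[OF this] show "isCont (\<lambda>t. f (\<gamma> t)) t"
        using DERIV_isCont by blast
    qed
    show "cmod (f (\<gamma> t)) \<le> B" if "cmod (0 - t) = \<rho>" for t
      using assms(4) inU[of t] that by auto
  qed
  then show ?thesis by (simp add: deriv0 \<rho>_def)
qed

text \<open>Weierstrass' theorem. The derivative bound applied to the differences of two members
  makes the differentials uniformly Cauchy near each point, and differentiation then passes to the
  limit. Complex linearity survives because the limit differential is given by the limits of the
  three coefficients.\<close>

lemma holo3_uniform_limit:
  fixes f :: "nat \<Rightarrow> C3 \<Rightarrow> complex"
  assumes U: "open U" and f: "\<And>n. holo3 U (f n)" and lim: "uniform_limit U f g sequentially"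
  shows "holo3 U g"
  unfolding holo3_def
proof
  fix z0 assume "z0 \<in> U"
  then obtain r0 where "r0 > 0" "ball z0 r0 \<subseteq> U"
    using U by (auto simp: open_contains_ball)
  \<comment> \<open>Points within r of z0 must still have a ball of radius 2 r inside U, as the
    derivative bound requires; hence 3 r.\<close>
  then obtain r where r: "r > 0" "ball z0 (3 * r) \<subseteq> U"
    by (intro that[of "r0 / 3"]) auto
  define S where "S = ball z0 r"
  have z0: "z0 \<in> S" using r by (simp add: S_def)
  have sub: "ball z (2 * r) \<subseteq> U" if "z \<in> S" for z
  proof
    fix w assume "w \<in> ball z (2 * r)"
    then have "dist z0 w < 3 * r"
      using that dist_triangle[of z0 w z] by (simp add: S_def)
    then show "w \<in> U" using r by auto
  qed
  have SU: "S \<subseteq> U"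
  proof
    fix z assume "z \<in> S"
    with sub[OF this] r(1) show "z \<in> U" by auto
  qed
  define D where "D n z = (SOME d. (f n has_derivative
      (\<lambda>(h1, h2, h3). fst d * h1 + fst (snd d) * h2 + snd (snd d) * h3)) (at z))" for n z
  have D: "(f n has_derivative (\<lambda>(h1, h2, h3). fst (D n z) * h1 + fst (snd (D n z)) * h2 + snd (snd (D n z)) * h3)) (at z)"
    if z: "z \<in> U" for n z
  proof -
    obtain d1 d2 d3 where "(f n has_derivative (\<lambda>(h1, h2, h3). d1 * h1 + d2 * h2 + d3 * h3)) (at z)"
      using f z unfolding holo3_def by blast
    then have "\<exists>d. (f n has_derivative (\<lambda>(h1, h2, h3). fst d * h1 + fst (snd d) * h2 + snd (snd d) * h3)) (at z)"
      by (intro exI[of _ "(d1, d2, d3)"]) (simp only: fst_conv snd_conv)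
    from someI_ex[OF this] show ?thesis unfolding D_def .
  qed
  define L :: "C3 \<Rightarrow> C3 \<Rightarrow> complex" where "L d h = fst d * fst h + fst (snd d) * fst (snd h) + snd (snd d) * snd (snd h)" for d h
  have L: "(f n has_derivative L (D n z)) (at z)" if "z \<in> U" for n z
    by (rule has_derivative_eq_rhs[OF D[OF that]]) (auto simp: L_def fun_eq_iff)
  have est: "\<exists>N. \<forall>m\<ge>N. \<forall>n\<ge>N. \<forall>z\<in>S. \<forall>h. cmod (L (D n z) h - L (D m z) h) \<le> e * norm h"
    if "e > 0" for e
  proof -
    have "e * r / 2 > 0" using that r by simp
    with uniform_limitD[OF lim, of "e * r / 2"] obtain N where N: "\<And>n w. n \<ge> N \<Longrightarrow> w \<in> U \<Longrightarrow> dist (f n w) (g w) < e * r / 2"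
      unfolding eventually_sequentially by blast
    have "cmod (L (D n z) h - L (D m z) h) \<le> e * norm h" if "m \<ge> N" "n \<ge> N" "z \<in> S" for m n z h
    proof -
      have z: "z \<in> U" using SU that by auto
      have bound: "cmod (f n w + - f m w) \<le> e * r" if w: "w \<in> U" for w
      proof -
        have "dist (f n w) (f m w) \<le> dist (f n w) (g w) + dist (f m w) (g w)"
          by (rule dist_triangle2)
        also have "\<dots> \<le> e * r" using N[OF \<open>m \<ge> N\<close> w] N[OF \<open>n \<ge> N\<close> w] by simp
        finally show ?thesis by (simp add: dist_norm)
      qed
      obtain h1 h2 h3 where h: "h = (h1, h2, h3)" by (cases h)
      have "cmod ((fst (D n z) - fst (D m z)) * h1 + (fst (snd (D n z)) - fst (snd (D m z))) * h2
          + (snd (snd (D n z)) - snd (snd (D m z))) * h3) \<le> e * r / r * norm (h1, h2, h3)"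
        by (rule holo3_derivative_bound[OF holo3_add[OF f[of n] holo3_uminus[OF f[of m]]] sub[OF \<open>z \<in> S\<close>] r(1) bound])
          (assumption, rule has_derivative_eq_rhs[OF has_derivative_add[OF D[OF z] has_derivative_minus[OF D[OF z]]]],
            auto simp: algebra_simps)
      moreover have "e * r / r = e" using r by simp
      ultimately show ?thesis by (simp add: h L_def algebra_simps)
    qed
    then show ?thesis by blast
  qed
  have conv: "convergent (\<lambda>n. L (D n z) h)" if z: "z \<in> S" for z h
  proof (rule Cauchy_convergent, rule CauchyI')
    fix e :: real assume "e > 0"
    then have "e / (norm h + 1) > 0" by (simp add: add_nonneg_pos)
    from est[OF this] obtain N where N: "\<And>m n. m \<ge> N \<Longrightarrow> n \<ge> N \<Longrightarrow>
        cmod (L (D n z) h - L (D m z) h) \<le> e / (norm h + 1) * norm h" using z by blast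
    have "norm h + 1 > 0" by (simp add: add_nonneg_pos)
    then have small: "e / (norm h + 1) * norm h < e"
      using \<open>e > 0\<close> by (simp add: pos_divide_less_eq)
    have "dist (L (D m z) h) (L (D n z) h) < e" if "m \<ge> N" "n \<ge> N" for m n
      using N[OF that(2,1)] small by (simp add: dist_norm)
    then show "\<exists>M. \<forall>m\<ge>M. \<forall>n>m. dist (L (D m z) h) (L (D n z) h) < e"
      by (meson less_imp_le order_trans)
  qed
  define E :: "C3 \<Rightarrow> C3" where "E z = (lim (\<lambda>n. L (D n z) (1, 0, 0)), lim (\<lambda>n. L (D n z) (0, 1, 0)), lim (\<lambda>n. L (D n z) (0, 0, 1)))" for z
  have limE: "(\<lambda>n. L (D n z) h) \<longlonglongrightarrow> L (E z) h" if z: "z \<in> S" for z h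
  proof -
    have *: "L (E z) h = lim (\<lambda>n. L (D n z) (1, 0, 0)) * fst h
        + lim (\<lambda>n. L (D n z) (0, 1, 0)) * fst (snd h) + lim (\<lambda>n. L (D n z) (0, 0, 1)) * snd (snd h)"
      by (subst L_def) (simp only: E_def fst_conv snd_conv)
    have "(\<lambda>n. L (D n z) (1, 0, 0) * fst h + L (D n z) (0, 1, 0) * fst (snd h) + L (D n z) (0, 0, 1) * snd (snd h)) \<longlonglongrightarrow> L (E z) h"
      unfolding *
      by (intro tendsto_add tendsto_mult tendsto_const convergent_LIMSEQ_iff[THEN iffD1] conv z)
    then show ?thesis by (simp add: L_def)
  qed
  have "\<exists>g2. \<forall>x\<in>S. (\<lambda>n. f n x) \<longlonglongrightarrow> g2 x \<and> (g2 has_derivative L (E x)) (at x within S)"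
  proof (rule has_derivative_sequence[where f = f and f' = "\<lambda>n x. L (D n x)"])
    show "convex S" by (simp add: S_def)
    show "(f n has_derivative L (D n x)) (at x within S)" if "x \<in> S" for n x
      using that SU by (intro has_derivative_at_withinI[OF L]) blast
    show "z0 \<in> S" by fact
    show "(\<lambda>n. f n z0) \<longlonglongrightarrow> g z0"
      using tendsto_uniform_limitI[OF lim] subsetD[OF SU z0] .
    fix e :: real assume "e > 0"
    from est[OF this] obtain N where N: "\<forall>m\<ge>N. \<forall>n\<ge>N. \<forall>z\<in>S. \<forall>h. cmod (L (D n z) h - L (D m z) h) \<le> e * norm h"
      by blast
    have "cmod (L (D n z) h - L (E z) h) \<le> e * norm h" if "n \<ge> N" "z \<in> S" for n z h
    proof (rule LIMSEQ_le_const2)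
      show "(\<lambda>m. cmod (L (D n z) h - L (D m z) h)) \<longlonglongrightarrow> cmod (L (D n z) h - L (E z) h)"
        by (intro tendsto_intros limE that)
    qed (use N that in blast)
    then show "\<forall>\<^sub>F n in sequentially. \<forall>x\<in>S. \<forall>h. cmod (L (D n x) h - L (E x) h) \<le> e * norm h"
      unfolding eventually_sequentially by blast
  qed
  then obtain g2 where "\<forall>x\<in>S. (\<lambda>n. f n x) \<longlonglongrightarrow> g2 x \<and> (g2 has_derivative L (E x)) (at x within S)" ..
  then have g2: "\<And>x. x \<in> S \<Longrightarrow> (\<lambda>n. f n x) \<longlonglongrightarrow> g2 x"
    "(g2 has_derivative L (E z0)) (at z0 within S)" using z0 by simp_all
  have "g2 x = g x" if "x \<in> S" for x
    using LIMSEQ_unique[OF g2(1)[OF that] tendsto_uniform_limitI[OF lim subsetD[OF SU that]]] .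
  moreover have "(g2 has_derivative L (E z0)) (at z0)"
    using g2(2) z0 by (simp add: S_def at_within_open[of z0 "ball z0 r"])
  ultimately have "(g has_derivative L (E z0)) (at z0)"
    using has_derivative_transform_within_open[of g2 "L (E z0)" z0 UNIV S g] z0
    by (simp add: S_def)
  moreover have "L (E z0) = (\<lambda>(h1, h2, h3). fst (E z0) * h1 + fst (snd (E z0)) * h2 + snd (snd (E z0)) * h3)"
    by (auto simp: L_def fun_eq_iff)
  ultimately show "\<exists>d1 d2 d3. (g has_derivative (\<lambda>(h1, h2, h3). d1 * h1 + d2 * h2 + d3 * h3)) (at z0)"
    by metis
qed

text \<open>The infinite products converge along the filter of finite index sets, not along a
  sequence. Choosing for every n one index that is uniformly closer than 1/(n+1) to the limit
  reduces the general case to sequences.\<close>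

lemma holo3_uniform_limit_filter:
  assumes "open U" "\<forall>\<^sub>F i in F. holo3 U (f i)" "uniform_limit U f g F" "F \<noteq> bot"
  shows "holo3 U g"
proof -
  have "\<exists>i. holo3 U (f i) \<and> (\<forall>z\<in>U. dist (f i z) (g z) < inverse (Suc n))" for n
  proof -
    have "\<forall>\<^sub>F i in F. holo3 U (f i) \<and> (\<forall>z\<in>U. dist (f i z) (g z) < inverse (Suc n))"
      by (rule eventually_conj[OF assms(2) uniform_limitD[OF assms(3)]]) simp
    from eventually_happens'[OF assms(4) this] show ?thesis .
  qed
  then obtain i where i: "\<And>n. holo3 U (f (i n))" "\<And>n z. z \<in> U \<Longrightarrow> dist (f (i n) z) (g z) < inverse (Suc n)"
    by metis
  have "uniform_limit U (\<lambda>n. f (i n)) g sequentially"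
  proof (rule uniform_limitI)
    fix e :: real assume "e > 0"
    then obtain N where "inverse (real (Suc N)) < e" using reals_Archimedean by blast
    moreover have "inverse (real (Suc n)) \<le> inverse (real (Suc N))" if "n \<ge> N" for n
      using that by (intro le_imp_inverse_le) auto
    ultimately have "inverse (real (Suc n)) < e" if "n \<ge> N" for n
      using that by (meson le_less_trans)
    then show "\<forall>\<^sub>F n in sequentially. \<forall>z\<in>U. dist (f (i n) z) (g z) < e"
      unfolding eventually_sequentially using i(2) by (meson less_trans)
  qed
  from holo3_uniform_limit[OF assms(1) i(1) this] show ?thesis .
qed

lemma holo3_cong:
  assumes "holo3 U f" "open U" "\<And>z. z \<in> U \<Longrightarrow> f z = g z"
  shows "holo3 U g"
  unfolding holo3_def
proof
  fix z assume z: "z \<in> U"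
  then obtain d1 d2 d3 where "(f has_derivative (\<lambda>(h1, h2, h3). d1 * h1 + d2 * h2 + d3 * h3)) (at z)"
    using assms(1) unfolding holo3_def by blast
  from has_derivative_transform_within_open[OF this assms(2) z assms(3)]
  show "\<exists>d1 d2 d3. (g has_derivative (\<lambda>(h1, h2, h3). d1 * h1 + d2 * h2 + d3 * h3)) (at z)"
    by blast
qed

lemma holo3_compose:
  assumes "holo3 U f" "\<And>z. z \<in> U \<Longrightarrow> \<exists>d. (\<phi> has_field_derivative d) (at (f z))"
  shows "holo3 U (\<lambda>z. \<phi> (f z))"
  unfolding holo3_def
proof
  fix z assume z: "z \<in> U"
  then obtain a b c where f: "(f has_derivative (\<lambda>(h1, h2, h3). a * h1 + b * h2 + c * h3)) (at z)"
    using assms(1) unfolding holo3_def by blast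
  obtain d where "(\<phi> has_derivative (*) d) (at (f z))"
    using assms(2)[OF z] by (auto simp: has_field_derivative_def)
  from has_derivative_compose[OF f this]
  have "((\<lambda>z. \<phi> (f z)) has_derivative (\<lambda>(h1, h2, h3). (d * a) * h1 + (d * b) * h2 + (d * c) * h3)) (at z)"
    by (rule has_derivative_eq_rhs) (auto simp: algebra_simps)
  then show "\<exists>d1 d2 d3. ((\<lambda>z. \<phi> (f z)) has_derivative (\<lambda>(h1, h2, h3). d1 * h1 + d2 * h2 + d3 * h3)) (at z)"
    by blast
qed

lemma holo3_exp: "holo3 U f \<Longrightarrow> holo3 U (\<lambda>z. exp (f z))"
  by (erule holo3_compose) (blast intro: DERIV_exp)

lemma holo3_Ln: "holo3 U f \<Longrightarrow> (\<And>z. z \<in> U \<Longrightarrow> f z \<notin> \<real>\<^sub>\<le>\<^sub>0) \<Longrightarrow> holo3 U (\<lambda>z. Ln (f z))"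
  by (erule holo3_compose) (blast intro: has_field_derivative_Ln)

lemma holo3_inverse: "holo3 U f \<Longrightarrow> (\<And>z. z \<in> U \<Longrightarrow> f z \<noteq> 0) \<Longrightarrow> holo3 U (\<lambda>z. inverse (f z))"
  by (erule holo3_compose) (blast intro: DERIV_inverse)

lemma holo3_power_int:
  assumes "holo3 U f" "\<And>z. z \<in> U \<Longrightarrow> f z \<noteq> 0"
  shows "holo3 U (\<lambda>z. f z powi n)"
  using assms(1)
proof (rule holo3_compose)
  fix z assume "z \<in> U"
  with assms(2) have "f z \<noteq> 0" by blast
  then show "\<exists>d. ((\<lambda>w. w powi n) has_field_derivative d) (at (f z))"
    using DERIV_power_int[OF DERIV_ident, of n "f z" UNIV] by blast
qed

lemma holo3_diff: "holo3 U f \<Longrightarrow> holo3 U g \<Longrightarrow> holo3 U (\<lambda>z. f z - g z)"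
  using holo3_add[of U f "\<lambda>z. - g z"] holo3_uminus[of U g] by simp

lemma holo3_sum: "(\<And>i. i \<in> I \<Longrightarrow> holo3 U (f i)) \<Longrightarrow> holo3 U (\<lambda>z. \<Sum>i\<in>I. f i z)"
  by (induction I rule: infinite_finite_induct) (auto intro: holo3_const holo3_add)

lemma holo3_prod: "(\<And>i. i \<in> I \<Longrightarrow> holo3 U (f i)) \<Longrightarrow> holo3 U (\<lambda>z. \<Prod>i\<in>I. f i z)"
  by (induction I rule: infinite_finite_induct) (auto intro: holo3_const holo3_mult)

lemma holo3_proj: "holo3 U (\<lambda>z. fst z)" "holo3 U (\<lambda>z. fst (snd z))" "holo3 U (\<lambda>z. snd (snd z))"
proof -
  have *: "holo3 U f" if "\<And>z. (f has_derivative f) (at z)" "f = (\<lambda>(h1, h2, h3). a * h1 + b * h2 + c * h3)" for f a b c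
    using that unfolding holo3_def by metis
  show "holo3 U (\<lambda>z. fst z)"
    by (rule *[of _ 1 0 0]) (auto intro!: derivative_intros)
  show "holo3 U (\<lambda>z. fst (snd z))"
    by (rule *[of _ 0 1 0]) (auto intro!: derivative_intros)
  show "holo3 U (\<lambda>z. snd (snd z))"
    by (rule *[of _ 0 0 1]) (auto intro!: derivative_intros)
qed

lemma holo3_imp_continuous_on: "holo3 U f \<Longrightarrow> continuous_on U f"
  unfolding holo3_def
  by (intro continuous_at_imp_continuous_on) (blast intro: has_derivative_continuous)

lemma holo3_local:
  assumes "\<And>z. z \<in> U \<Longrightarrow> \<exists>V. open V \<and> z \<in> V \<and> holo3 V f"
  shows "holo3 U f"
  using assms unfolding holo3_def by blast

section \<open>Unordered infinite products\<close>

lemma finite_large_terms: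
  fixes b :: "'i \<Rightarrow> real"
  assumes "b summable_on I" "\<And>i. i \<in> I \<Longrightarrow> b i \<ge> 0" "\<epsilon> > 0"
  shows "finite {i\<in>I. b i \<ge> \<epsilon>}"
proof (rule ccontr)
  assume inf: "infinite {i\<in>I. b i \<ge> \<epsilon>}"
  obtain n :: nat where n: "real n * \<epsilon> > infsum b I"
    using ex_less_of_nat_mult[OF assms(3)] by blast
  obtain F where F: "F \<subseteq> {i\<in>I. b i \<ge> \<epsilon>}" "finite F" "card F = n"
    using infinite_arbitrarily_large[OF inf] by blast
  have "real n * \<epsilon> = (\<Sum>i\<in>F. \<epsilon>)" using F by simp
  also have "\<dots> \<le> sum b F" using F by (intro sum_mono) auto
  also have "\<dots> \<le> infsum b I" using F assms by (intro finite_sum_le_infsum) auto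
  finally show False using n by simp
qed

lemma tendsto_unordered_prod_Un:
  fixes f :: "'i \<Rightarrow> 'a::{comm_monoid_mult, topological_semigroup_mult}"
  assumes "((\<lambda>F. \<Prod>i\<in>F. f i) \<longlongrightarrow> x) (finite_subsets_at_top A)"
    and "((\<lambda>F. \<Prod>i\<in>F. f i) \<longlongrightarrow> y) (finite_subsets_at_top B)" and "A \<inter> B = {}"
  shows "((\<lambda>F. \<Prod>i\<in>F. f i) \<longlongrightarrow> x * y) (finite_subsets_at_top (A \<union> B))"
proof -
  have restrict: "((\<lambda>F. \<Prod>i\<in>F \<inter> C. f i) \<longlongrightarrow> l) (finite_subsets_at_top (A \<union> B))"
    if "((\<lambda>F. \<Prod>i\<in>F. f i) \<longlongrightarrow> l) (finite_subsets_at_top C)" "C \<subseteq> A \<union> B" for C l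
  proof (rule filterlim_compose[OF that(1)])
    show "LIM F finite_subsets_at_top (A \<union> B). F \<inter> C :> finite_subsets_at_top C"
      unfolding filterlim_def le_filter_def eventually_filtermap eventually_finite_subsets_at_top
    proof (intro allI impI, elim exE conjE)
      fix P X assume X: "finite X" "X \<subseteq> C" "\<forall>Y. finite Y \<and> X \<subseteq> Y \<and> Y \<subseteq> C \<longrightarrow> P Y"
      show "\<exists>X. finite X \<and> X \<subseteq> A \<union> B \<and> (\<forall>Y. finite Y \<and> X \<subseteq> Y \<and> Y \<subseteq> A \<union> B \<longrightarrow> P (Y \<inter> C))"
        using X that(2) by (intro exI[of _ X] conjI allI impI) auto
    qed
  qed
  from tendsto_mult[OF restrict[OF assms(1) Un_upper1] restrict[OF assms(2) Un_upper2]] show ?thesis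
  proof (rule Lim_transform_eventually)
    have "(\<Prod>i\<in>F \<inter> A. f i) * (\<Prod>i\<in>F \<inter> B. f i) = (\<Prod>i\<in>F. f i)" if "finite F" "F \<subseteq> A \<union> B" for F
    proof -
      have "F = (F \<inter> A) \<union> (F \<inter> B)" using that by auto
      then show ?thesis
        using that assms(3) prod.union_disjoint[of "F \<inter> A" "F \<inter> B" f] by fastforce
    qed
    then show "\<forall>\<^sub>F F in finite_subsets_at_top (A \<union> B). (\<Prod>i\<in>F \<inter> A. f i) * (\<Prod>i\<in>F \<inter> B. f i) = (\<Prod>i\<in>F. f i)"
      by (rule eventually_finite_subsets_at_top_weakI)
  qed
qed

lemma tendsto_unordered_prod_reindex:
  fixes f :: "'i \<Rightarrow> 'a::{comm_monoid_mult, topological_space}"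
  assumes "inj_on h A" "((\<lambda>F. \<Prod>i\<in>F. f (h i)) \<longlongrightarrow> x) (finite_subsets_at_top A)"
  shows "((\<lambda>F. \<Prod>i\<in>F. f i) \<longlongrightarrow> x) (finite_subsets_at_top (h ` A))"
proof -
  have "((\<lambda>F. \<Prod>i\<in>h ` F. f i) \<longlongrightarrow> x) (finite_subsets_at_top A)"
    using assms(2)
  proof (rule Lim_transform_eventually)
    show "\<forall>\<^sub>F F in finite_subsets_at_top A. (\<Prod>i\<in>F. f (h i)) = (\<Prod>i\<in>h ` F. f i)"
      using assms(1) by (intro eventually_finite_subsets_at_top_weakI) (simp add: prod.reindex inj_on_subset)
  qed
  then show ?thesis
    using assms(1) by (simp add: filterlim_filtermap flip: filtermap_image_finite_subsets_at_top)
qed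

text \<open>Outside F0 the terms have modulus below 1/2, where the principal logarithm satisfies |Ln
  (1 - u i)| \<le> 2 |u i|. The tail is thus the exponential of an absolutely convergent sum, and no
  branch of the logarithm is needed for the finitely many large terms.\<close>

lemma tendsto_unordered_prod:
  fixes u :: "'i \<Rightarrow> complex"
  assumes "(\<lambda>i. cmod (u i)) summable_on I" "finite F0" "F0 \<subseteq> I"
    and "\<And>i. i \<in> I - F0 \<Longrightarrow> cmod (u i) < 1 / 2"
  shows "((\<lambda>F. \<Prod>i\<in>F. 1 - u i) \<longlongrightarrow> (\<Prod>i\<in>F0. 1 - u i) * exp (\<Sum>\<^sub>\<infinity>i\<in>I - F0. Ln (1 - u i)))
    (finite_subsets_at_top I)"
proof -
  have le: "cmod (Ln (1 - u i)) \<le> 2 * cmod (u i)" if "i \<in> I - F0" for i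
    using norm_Ln_le[of "- u i"] assms(4)[OF that] by simp
  have "(\<lambda>i. 2 * cmod (u i)) summable_on I - F0"
    using assms(1) by (intro summable_on_cmult_right) (auto intro: summable_on_subset_banach)
  then have "(\<lambda>i. cmod (Ln (1 - u i))) summable_on I - F0"
    by (rule summable_on_comparison_test) (use le in auto)
  then have "(\<lambda>i. Ln (1 - u i)) summable_on I - F0" by (rule abs_summable_summable)
  then have "((\<lambda>F. \<Sum>i\<in>F. Ln (1 - u i)) \<longlongrightarrow> (\<Sum>\<^sub>\<infinity>i\<in>I - F0. Ln (1 - u i))) (finite_subsets_at_top (I - F0))"
    using has_sum_infsum unfolding has_sum_def by blast
  from tendsto_exp[OF this]
  have 1: "((\<lambda>F. \<Prod>i\<in>F. 1 - u i) \<longlongrightarrow> exp (\<Sum>\<^sub>\<infinity>i\<in>I - F0. Ln (1 - u i))) (finite_subsets_at_top (I - F0))"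
  proof (rule Lim_transform_eventually)
    have "exp (\<Sum>i\<in>F. Ln (1 - u i)) = (\<Prod>i\<in>F. 1 - u i)" if "finite F" "F \<subseteq> I - F0" for F
    proof -
      have "1 - u i \<noteq> 0" if "i \<in> F" for i
        using assms(4)[of i] that \<open>F \<subseteq> I - F0\<close> by auto
      then show ?thesis using that by (simp add: exp_sum)
    qed
    then show "\<forall>\<^sub>F F in finite_subsets_at_top (I - F0). exp (\<Sum>i\<in>F. Ln (1 - u i)) = (\<Prod>i\<in>F. 1 - u i)"
      by (rule eventually_finite_subsets_at_top_weakI)
  qed
  have 2: "((\<lambda>F. \<Prod>i\<in>F. 1 - u i) \<longlongrightarrow> (\<Prod>i\<in>F0. 1 - u i)) (finite_subsets_at_top F0)"
    using assms(2) by (simp add: finite_subsets_at_top_finite tendsto_principal_singleton)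
  have "F0 \<union> (I - F0) = I" using assms(3) by auto
  with tendsto_unordered_prod_Un[OF 2 1] show ?thesis by auto
qed

text \<open>The exponential factor never vanishes, so a zero of the product can only come from one
  of the finitely many factors that were split off.\<close>

lemma Lim_unordered_prod:
  fixes u :: "'i \<Rightarrow> complex"
  assumes "(\<lambda>i. cmod (u i)) summable_on I"
  shows "((\<lambda>F. \<Prod>i\<in>F. 1 - u i) \<longlongrightarrow> Lim (finite_subsets_at_top I) (\<lambda>F. \<Prod>i\<in>F. 1 - u i)) (finite_subsets_at_top I)"
    and "Lim (finite_subsets_at_top I) (\<lambda>F. \<Prod>i\<in>F. 1 - u i) = 0 \<longleftrightarrow> (\<exists>i\<in>I. u i = 1)"
proof -
  define F0 where "F0 = {i\<in>I. cmod (u i) \<ge> 1 / 2}"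
  have F0: "finite F0" "F0 \<subseteq> I"
    using finite_large_terms[OF assms, of "1 / 2"] by (auto simp: F0_def)
  have "((\<lambda>F. \<Prod>i\<in>F. 1 - u i) \<longlongrightarrow> (\<Prod>i\<in>F0. 1 - u i) * exp (\<Sum>\<^sub>\<infinity>i\<in>I - F0. Ln (1 - u i)))
    (finite_subsets_at_top I)"
    by (rule tendsto_unordered_prod[OF assms F0]) (auto simp: F0_def)
  moreover from this have "Lim (finite_subsets_at_top I) (\<lambda>F. \<Prod>i\<in>F. 1 - u i)
      = (\<Prod>i\<in>F0. 1 - u i) * exp (\<Sum>\<^sub>\<infinity>i\<in>I - F0. Ln (1 - u i))"
    by (intro tendsto_Lim) auto
  ultimately show "((\<lambda>F. \<Prod>i\<in>F. 1 - u i) \<longlongrightarrow> Lim (finite_subsets_at_top I) (\<lambda>F. \<Prod>i\<in>F. 1 - u i)) (finite_subsets_at_top I)"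
    "Lim (finite_subsets_at_top I) (\<lambda>F. \<Prod>i\<in>F. 1 - u i) = 0 \<longleftrightarrow> (\<exists>i\<in>I. u i = 1)"
    using F0 by (auto simp: F0_def)
qed

text \<open>The large factors are selected by the majorant b, so the same finite set F0 serves all
  points of V. The Weierstrass test along finite sets then makes the sum of logarithms a uniform
  limit of holomorphic functions.\<close>

lemma holo3_Lim_unordered_prod:
  fixes u :: "'i \<Rightarrow> C3 \<Rightarrow> complex"
  assumes V: "open V" and bound: "\<And>i z. i \<in> I \<Longrightarrow> z \<in> V \<Longrightarrow> cmod (u i z) \<le> b i"
    and b: "b summable_on I" "\<And>i. i \<in> I \<Longrightarrow> b i \<ge> 0" and u: "\<And>i. i \<in> I \<Longrightarrow> holo3 V (u i)"
  shows "holo3 V (\<lambda>z. Lim (finite_subsets_at_top I) (\<lambda>F. \<Prod>i\<in>F. 1 - u i z))"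
proof -
  define F0 where "F0 = {i\<in>I. b i \<ge> 1 / 2}"
  have F0: "finite F0" "F0 \<subseteq> I"
    using finite_large_terms[OF b, of "1 / 2"] by (auto simp: F0_def)
  have small: "cmod (u i z) < 1 / 2" if "i \<in> I - F0" "z \<in> V" for i z
    using bound[of i z] that by (auto simp: F0_def)
  have Ln_holo: "holo3 V (\<lambda>z. Ln (1 - u i z))" if i: "i \<in> I - F0" for i
  proof (rule holo3_Ln[OF holo3_diff[OF holo3_const]])
    show "holo3 V (u i)" using u i by simp
    fix z assume z: "z \<in> V"
    have "Re (1 - u i z) > 0" using small[OF i z] complex_Re_le_cmod[of "u i z"] by simp
    then show "1 - u i z \<notin> \<real>\<^sub>\<le>\<^sub>0" by (auto simp: complex_nonpos_Reals_iff)
  qed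
  have le: "cmod (Ln (1 - u i z)) \<le> 2 * b i" if "i \<in> I - F0" "z \<in> V" for i z
    using norm_Ln_le[of "- u i z"] small[OF that] bound[of i z] that by simp
  have "(\<lambda>i. 2 * b i) summable_on I - F0"
    using b(1) by (intro summable_on_cmult_right) (auto intro: summable_on_subset_banach)
  with le have "uniform_limit V (\<lambda>F z. \<Sum>i\<in>F. Ln (1 - u i z)) (\<lambda>z. \<Sum>\<^sub>\<infinity>i\<in>I - F0. Ln (1 - u i z))
      (finite_subsets_at_top (I - F0))"
    by (rule Weierstrass_m_test_general)
  moreover have "\<forall>\<^sub>F F in finite_subsets_at_top (I - F0). holo3 V (\<lambda>z. \<Sum>i\<in>F. Ln (1 - u i z))"
    using Ln_holo by (intro eventually_finite_subsets_at_top_weakI holo3_sum) auto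
  ultimately have "holo3 V (\<lambda>z. \<Sum>\<^sub>\<infinity>i\<in>I - F0. Ln (1 - u i z))"
    using holo3_uniform_limit_filter[OF V, of "\<lambda>F z. \<Sum>i\<in>F. Ln (1 - u i z)"] by simp
  then have "holo3 V (\<lambda>z. (\<Prod>i\<in>F0. 1 - u i z) * exp (\<Sum>\<^sub>\<infinity>i\<in>I - F0. Ln (1 - u i z)))"
    using u F0 by (intro holo3_mult holo3_exp holo3_prod holo3_diff holo3_const) auto
  then show ?thesis
  proof (rule holo3_cong[OF _ V])
    fix z assume z: "z \<in> V"
    have "(\<lambda>i. cmod (u i z)) summable_on I"
      using b(1) by (rule summable_on_comparison_test) (use bound z in auto)
    then have "((\<lambda>F. \<Prod>i\<in>F. 1 - u i z) \<longlongrightarrow> (\<Prod>i\<in>F0. 1 - u i z) * exp (\<Sum>\<^sub>\<infinity>i\<in>I - F0. Ln (1 - u i z)))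
        (finite_subsets_at_top I)"
      using F0 by (rule tendsto_unordered_prod) (use small z in auto)
    then show "(\<Prod>i\<in>F0. 1 - u i z) * exp (\<Sum>\<^sub>\<infinity>i\<in>I - F0. Ln (1 - u i z))
        = Lim (finite_subsets_at_top I) (\<lambda>F. \<Prod>i\<in>F. 1 - u i z)"
      by (intro tendsto_Lim[symmetric]) auto
  qed
qed

section \<open>The functions behind the plethystic exponent and the density of their domains\<close>

section \<open>The multiple q-Pochhammer symbol\<close>

lemma lists_length_Suc: "{ns. length ns = Suc k} = (\<lambda>(n, ns). n # ns) ` (UNIV \<times> {ns. length ns = k})"
  by (auto simp: image_iff length_Suc_conv)

lemma summable_monomials:
  fixes rs :: "real list"
  assumes "\<And>r. r \<in> set rs \<Longrightarrow> 0 \<le> r \<and> r < 1"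
  shows "(\<lambda>ns. prod_list (map2 power rs ns)) summable_on {ns. length ns = length rs}"
  using assms
proof (induction rs)
  case Nil
  then show ?case by (auto intro: summable_on_finite)
next
  case (Cons r rs)
  let ?f = "\<lambda>ns. prod_list (map2 power rs ns)" and ?A = "{ns. length ns = length rs}"
  have nonneg: "prod_list (map2 power rs' ns) \<ge> 0" if "\<And>r. r \<in> set rs' \<Longrightarrow> 0 \<le> r" for rs' :: "real list" and ns
    using that by (induction rs' arbitrary: ns; case_tac ns) (auto intro!: mult_nonneg_nonneg)
  have IH: "(?f has_sum infsum ?f ?A) ?A"
    using Cons by (intro has_sum_infsum) auto
  have "(\<lambda>(n, ns). r ^ n * ?f ns) summable_on (UNIV \<times> ?A)"
  proof (rule summable_on_SigmaI)
    show "((\<lambda>ns. case (n, ns) of (n, ns) \<Rightarrow> r ^ n * ?f ns) has_sum r ^ n * infsum ?f ?A) ?A" for n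
      using IH by (auto intro: has_sum_cmult_right)
    have "(\<lambda>n. r ^ n) summable_on UNIV"
      using Cons.prems by (intro norm_summable_imp_summable_on) (auto simp: norm_power intro: summable_geometric)
    then show "(\<lambda>n. r ^ n * infsum ?f ?A) summable_on UNIV"
      by (rule summable_on_cmult_left)
    show "(case (n, ns) of (n, ns) \<Rightarrow> r ^ n * ?f ns) \<ge> 0" if "ns \<in> ?A" for n ns
      using Cons.prems nonneg[of rs ns] by auto
  qed
  then have "((\<lambda>ns. prod_list (map2 power (r # rs) ns)) \<circ> (\<lambda>(n, ns). n # ns)) summable_on (UNIV \<times> ?A)"
    by (simp add: comp_def case_prod_unfold)
  then show ?case
    unfolding list.size(4) One_nat_def add_0_right add_Suc_right lists_length_Suc
    by (subst summable_on_reindex) (auto intro: inj_onI)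
qed

lemma cmod_monomial: "cmod (prod_list (map2 power ps ns)) = prod_list (map2 power (map cmod ps) ns)"
  by (induction ps arbitrary: ns; case_tac ns) (auto simp: norm_mult norm_power)

lemma qpoch_summable:
  assumes "\<forall>q\<in>set ps. cmod q < 1"
  shows "(\<lambda>ns. cmod (z * prod_list (map2 power ps ns))) summable_on {ns. length ns = length ps}"
  unfolding norm_mult cmod_monomial
proof (rule summable_on_cmult_right)
  show "(\<lambda>ns. prod_list (map2 power (map cmod ps) ns)) summable_on {ns. length ns = length ps}"
    using assms summable_monomials[of "map cmod ps"] by fastforce
qed

lemma tendsto_qpoch:
  assumes "\<forall>q\<in>set ps. cmod q < 1"
  shows "((\<lambda>F. \<Prod>ns\<in>F. 1 - z * prod_list (map2 power ps ns)) \<longlongrightarrow> qpoch z ps)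
    (finite_subsets_at_top {ns. length ns = length ps})"
  unfolding qpoch_def by (rule Lim_unordered_prod(1)[OF qpoch_summable[OF assms]])

lemma qpoch_eq_0_iff:
  assumes "\<forall>q\<in>set ps. cmod q < 1"
  shows "qpoch z ps = 0 \<longleftrightarrow> (\<exists>ns. length ns = length ps \<and> z * prod_list (map2 power ps ns) = 1)"
  unfolding qpoch_def by (subst Lim_unordered_prod(2)[OF qpoch_summable[OF assms]]) auto

text \<open>Exponent tuples are sorted by whether the exponent of p is zero or positive. Those of
  the first kind are tuples for the remaining bases; those of the second kind arise by raising the
  exponent of p by one, which amounts to replacing z by z p. All later identities of
  \<open>pexp\<close> rest on this functional equation.\<close>

lemma qpoch_insert:
  assumes "\<forall>q\<in>set (us @ p # vs). cmod q < 1"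
  shows "qpoch z (us @ p # vs) = qpoch z (us @ vs) * qpoch (z * p) (us @ p # vs)"
proof -
  let ?k = "length us"
  let ?t = "\<lambda>ns. 1 - z * prod_list (map2 power (us @ p # vs) ns)"
  let ?I = "{ns :: nat list. length ns = length (us @ p # vs)}"
  let ?J = "{ns :: nat list. length ns = length (us @ vs)}"
  define ins where "ins n ns = take ?k ns @ n # drop ?k ns" for n :: nat and ns
  define up where "up ns = ns[?k := Suc (ns ! ?k)]" for ns :: "nat list"
  have split: "\<exists>as n bs. ns = as @ n # bs \<and> length as = ?k \<and> length bs = length vs" if "ns \<in> ?I" for ns
    using that by (intro exI[of _ "take ?k ns"] exI[of _ "ns ! ?k"] exI[of _ "drop (Suc ?k) ns"])
      (auto simp: id_take_nth_drop)
  have J_split: "\<exists>as bs. ns = as @ bs \<and> length as = ?k \<and> length bs = length vs" if "ns \<in> ?J" for ns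
    using that by (intro exI[of _ "take ?k ns"] exI[of _ "drop ?k ns"]) auto
  have I1: "ins 0 ` ?J = {ns\<in>?I. ns ! ?k = 0}"
  proof (intro equalityI subsetI)
    fix ns assume *: "ns \<in> {ns\<in>?I. ns ! ?k = 0}"
    then obtain as n bs where "ns = as @ n # bs" "length as = ?k" "length bs = length vs" using split by blast
    with * have "ns = ins 0 (as @ bs)" "as @ bs \<in> ?J" by (auto simp: ins_def nth_append)
    then show "ns \<in> ins 0 ` ?J" by blast
  qed (auto simp: ins_def nth_append)
  have I2: "up ` ?I = {ns\<in>?I. ns ! ?k \<noteq> 0}"
  proof (intro equalityI subsetI)
    fix ns assume *: "ns \<in> {ns\<in>?I. ns ! ?k \<noteq> 0}"
    then have "ns = up (ns[?k := ns ! ?k - 1])" by (auto simp: up_def)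
    with * show "ns \<in> up ` ?I" by (intro image_eqI[of _ up]) auto
  qed (auto simp: up_def)
  have "((\<lambda>F. \<Prod>ns\<in>F. ?t (ins 0 ns)) \<longlongrightarrow> qpoch z (us @ vs)) (finite_subsets_at_top ?J)"
  proof (rule Lim_transform_eventually[OF tendsto_qpoch])
    have "1 - z * prod_list (map2 power (us @ vs) ns) = ?t (ins 0 ns)" if "ns \<in> ?J" for ns
      using J_split[OF that] by (auto simp: ins_def)
    then show "\<forall>\<^sub>F F in finite_subsets_at_top ?J. (\<Prod>ns\<in>F. 1 - z * prod_list (map2 power (us @ vs) ns)) = (\<Prod>ns\<in>F. ?t (ins 0 ns))"
      by (intro eventually_finite_subsets_at_top_weakI prod.cong refl) blast
  qed (use assms in auto)
  moreover have "inj_on (ins 0) ?J"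
    by (rule inj_onI, simp add: ins_def, metis append_take_drop_id)
  ultimately have 1: "((\<lambda>F. \<Prod>ns\<in>F. ?t ns) \<longlongrightarrow> qpoch z (us @ vs)) (finite_subsets_at_top {ns\<in>?I. ns ! ?k = 0})"
    unfolding I1[symmetric] by (intro tendsto_unordered_prod_reindex)
  have "((\<lambda>F. \<Prod>ns\<in>F. ?t (up ns)) \<longlongrightarrow> qpoch (z * p) (us @ p # vs)) (finite_subsets_at_top ?I)"
  proof (rule Lim_transform_eventually[OF tendsto_qpoch])
    have "1 - z * p * prod_list (map2 power (us @ p # vs) ns) = ?t (up ns)" if "ns \<in> ?I" for ns
      using split[OF that] by (auto simp: up_def list_update_append nth_append)
    then show "\<forall>\<^sub>F F in finite_subsets_at_top ?I. (\<Prod>ns\<in>F. 1 - z * p * prod_list (map2 power (us @ p # vs) ns)) = (\<Prod>ns\<in>F. ?t (up ns))"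
      by (intro eventually_finite_subsets_at_top_weakI prod.cong refl) blast
  qed (use assms in auto)
  moreover have "inj_on up ?I"
  proof (rule inj_onI)
    fix ns ms assume "ns \<in> ?I" "ms \<in> ?I" "up ns = up ms"
    with split[of ns] split[of ms] show "ns = ms" by (auto simp: up_def list_update_append nth_append)
  qed
  ultimately have 2: "((\<lambda>F. \<Prod>ns\<in>F. ?t ns) \<longlongrightarrow> qpoch (z * p) (us @ p # vs)) (finite_subsets_at_top {ns\<in>?I. ns ! ?k \<noteq> 0})"
    unfolding I2[symmetric] by (intro tendsto_unordered_prod_reindex)
  have "((\<lambda>F. \<Prod>ns\<in>F. ?t ns) \<longlongrightarrow> qpoch z (us @ vs) * qpoch (z * p) (us @ p # vs))
      (finite_subsets_at_top ({ns\<in>?I. ns ! ?k = 0} \<union> {ns\<in>?I. ns ! ?k \<noteq> 0}))"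
    by (rule tendsto_unordered_prod_Un[OF 1 2]) auto
  moreover have "{ns\<in>?I. ns ! ?k = 0} \<union> {ns\<in>?I. ns ! ?k \<noteq> 0} = ?I" by auto
  ultimately show ?thesis
    using tendsto_unique[OF _ tendsto_qpoch[OF assms]] by simp
qed

text \<open>On V the term with exponents ns is dominated by W r^(sum of ns), a convergent multiple
  geometric series.\<close>

lemma holo3_qpoch:
  assumes V: "open V" and w: "holo3 V w" "\<And>z. z \<in> V \<Longrightarrow> cmod (w z) \<le> W"
    and gs: "\<And>g. g \<in> set gs \<Longrightarrow> holo3 V g" "\<And>g z. g \<in> set gs \<Longrightarrow> z \<in> V \<Longrightarrow> cmod (g z) \<le> r"
    and r: "0 \<le> r" "r < 1" "0 \<le> W"
  shows "holo3 V (\<lambda>z. qpoch (w z) (map (\<lambda>g. g z) gs))"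
proof -
  let ?b = "\<lambda>ns :: nat list. W * prod_list (map2 power (map (\<lambda>_. r) gs) ns)"
  have nonneg: "prod_list (map2 power (map (\<lambda>_. r) gs) ns) \<ge> 0" for gs :: "(C3 \<Rightarrow> complex) list" and ns
    using r by (induction gs arbitrary: ns; case_tac ns) auto
  have le: "cmod (prod_list (map2 power (map (\<lambda>g. g z) gs) ns)) \<le> prod_list (map2 power (map (\<lambda>_. r) gs) ns)"
    if "\<And>g. g \<in> set gs \<Longrightarrow> cmod (g z) \<le> r" for z ns and gs :: "(C3 \<Rightarrow> complex) list"
    using that
  proof (induction gs arbitrary: ns)
    case (Cons g gs)
    show ?case
    proof (cases ns)
      case (Cons n ms)
      then show ?thesis using Cons.IH[of ms] Cons.prems r nonneg[of gs ms]
        by (auto simp: norm_mult norm_power intro!: mult_mono power_mono)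
    qed simp
  qed simp
  have mon: "holo3 V (\<lambda>z. prod_list (map2 power (map (\<lambda>g. g z) gs) ns))" if "\<And>g. g \<in> set gs \<Longrightarrow> holo3 V g" for ns gs
    using that
  proof (induction gs arbitrary: ns)
    case (Cons g gs)
    show ?case
    proof (cases ns)
      case (Cons n ms)
      have "holo3 V (\<lambda>z. \<Prod>i<n. g z)" using Cons.prems by (intro holo3_prod) auto
      then show ?thesis using Cons Cons.IH[of ms] Cons.prems by (auto intro!: holo3_mult)
    qed (simp add: holo3_const)
  qed (simp add: holo3_const)
  have "holo3 V (\<lambda>z. Lim (finite_subsets_at_top {ns :: nat list. length ns = length gs})
      (\<lambda>F. \<Prod>ns\<in>F. 1 - w z * prod_list (map2 power (map (\<lambda>g. g z) gs) ns)))"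
  proof (rule holo3_Lim_unordered_prod[OF V])
    show "cmod (w z * prod_list (map2 power (map (\<lambda>g. g z) gs) ns)) \<le> ?b ns" if "z \<in> V" for z ns
      unfolding norm_mult using that r by (intro mult_mono w(2) le gs(2)) auto
    show "?b summable_on {ns. length ns = length gs}"
      using summable_monomials[of "map (\<lambda>_. r) gs"] r by (intro summable_on_cmult_right) auto
    show "?b ns \<ge> 0" for ns using nonneg r by simp
    show "holo3 V (\<lambda>z. w z * prod_list (map2 power (map (\<lambda>g. g z) gs) ns))" for ns
      by (intro holo3_mult w mon gs)
  qed
  then show ?thesis by (simp add: qpoch_def)
qed

section \<open>The domain of the plethystic exponent\<close>

definition mono2 :: "int \<times> int \<Rightarrow> C3 \<Rightarrow> complex" where
  "mono2 d z = fst (snd z) powi fst d * snd (snd z) powi snd d"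

definition mono3 :: "int \<times> int \<times> int \<Rightarrow> C3 \<Rightarrow> complex" where
  "mono3 m z = fst z powi fst m * mono2 (snd m) z"

text \<open>The complement of the real hypersurfaces on which some base has modulus 1. The product
  expansion of the extended symbol changes from one side of such a hypersurface to the
  other.\<close>

definition generic :: "(int \<times> int) list \<Rightarrow> C3 set" where
  "generic ds = {z \<in> Cx3. \<forall>d\<in>set ds. cmod (mono2 d z) \<noteq> 1}"

lemma pexp_factor_eq: "pexp_factor ds m z = qpoch_ext (mono3 m z) (map (\<lambda>d. mono2 d z) ds)"
  by (cases m; cases z) (simp add: pexp_factor_def mono3_def mono2_def case_prod_unfold mult.assoc)

lemma pexp_dom_eq: "pexp_dom \<mu> ds = {z \<in> generic ds. \<forall>m\<in>Poly_Mapping.keys \<mu>. pexp_factor ds m z \<noteq> 0}"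
  by (auto simp: pexp_dom_def generic_def mono2_def case_prod_beta')

lemma Cx3_nonzero: "z \<in> Cx3 \<Longrightarrow> fst z \<noteq> 0" "z \<in> Cx3 \<Longrightarrow> fst (snd z) \<noteq> 0" "z \<in> Cx3 \<Longrightarrow> snd (snd z) \<noteq> 0"
  by (auto simp: Cx3_def)

lemma mono2_add: "z \<in> Cx3 \<Longrightarrow> mono2 (d + e) z = mono2 d z * mono2 e z"
  by (simp add: mono2_def power_int_add Cx3_nonzero)

lemma mono2_uminus: "mono2 (- d) z = inverse (mono2 d z)"
  by (simp add: mono2_def power_int_minus)

lemma mono2_nonzero: "z \<in> Cx3 \<Longrightarrow> mono2 d z \<noteq> 0"
  by (simp add: mono2_def Cx3_nonzero)

lemma mono2_sum_list: "z \<in> Cx3 \<Longrightarrow> mono2 (sum_list ds) z = prod_list (map (\<lambda>d. mono2 d z) ds)"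
  by (induction ds) (simp_all add: mono2_add, simp add: mono2_def)

lemma holo3_mono2: "V \<subseteq> Cx3 \<Longrightarrow> holo3 V (mono2 d)"
  unfolding mono2_def by (intro holo3_mult holo3_power_int holo3_proj) (auto simp: Cx3_def)

lemma holo3_mono3: "V \<subseteq> Cx3 \<Longrightarrow> holo3 V (mono3 m)"
  unfolding mono3_def by (intro holo3_mult holo3_power_int holo3_proj holo3_mono2) (auto simp: Cx3_def)

lemma open_cmod_less:
  assumes "holo3 V f" "open V"
  shows "open {z \<in> V. cmod (f z) < r}"
proof -
  have "open (V \<inter> (\<lambda>z. cmod (f z)) -` {..<r})"
    using assms by (intro continuous_open_preimage continuous_on_norm holo3_imp_continuous_on) auto
  then show ?thesis by (simp add: Int_def vimage_def)
qed

lemma small_monomials_nbhd: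
  assumes "z0 \<in> Cx3" "\<forall>d\<in>set ds. cmod (mono2 d z0) < 1"
  shows "\<exists>V r. open V \<and> z0 \<in> V \<and> V \<subseteq> Cx3 \<and> 0 \<le> r \<and> r < 1 \<and> (\<forall>z\<in>V. \<forall>d\<in>set ds. cmod (mono2 d z) \<le> r)"
  using assms(2)
proof (induction ds)
  case Nil
  then show ?case using assms(1) open_Cx3 by (intro exI[of _ Cx3] exI[of _ 0]) auto
next
  case (Cons d ds)
  then obtain V r where V: "open V" "z0 \<in> V" "V \<subseteq> Cx3" "0 \<le> r" "r < 1" "\<forall>z\<in>V. \<forall>d\<in>set ds. cmod (mono2 d z) \<le> r"
    by auto
  define r' where "r' = (1 + cmod (mono2 d z0)) / 2"
  have r': "r' < 1" "cmod (mono2 d z0) < r'" using Cons.prems by (auto simp: r'_def)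
  have "open {z \<in> V. cmod (mono2 d z) < r'}"
    using V by (intro open_cmod_less holo3_mono2) auto
  moreover have "cmod (mono2 e z) \<le> max r r'" if "z \<in> {z \<in> V. cmod (mono2 d z) < r'}" "e \<in> set (d # ds)" for z e
    using that V(6) by (auto simp: le_max_iff_disj)
  ultimately show ?case using V r'
    by (intro exI[of _ "{z \<in> V. cmod (mono2 d z) < r'}"] exI[of _ "max r r'"]) auto
qed

text \<open>Near a generic point no base crosses the unit circle, so the set P of inverted bases is
  locally constant. The factor is there one infinite product or its reciprocal, decided by the
  parity of the number of inverted bases; \<open>\<epsilon>\<close> records this parity.\<close>

lemma pexp_factor_local:
  assumes "z0 \<in> generic ds"
  shows "\<exists>V w \<epsilon>. open V \<and> z0 \<in> V \<and> V \<subseteq> generic ds \<and> holo3 V w \<and>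
    (\<forall>z\<in>V. pexp_factor ds m z = (if \<epsilon> then w z else inverse (w z)))"
proof -
  have z0: "z0 \<in> Cx3" using assms by (simp add: generic_def)
  define P where "P d \<longleftrightarrow> cmod (mono2 d z0) > 1" for d
  define \<sigma> where "\<sigma> d = (if P d then - d else d)" for d
  have "\<forall>d\<in>set (map \<sigma> ds). cmod (mono2 d z0) < 1"
  proof
    fix e assume "e \<in> set (map \<sigma> ds)"
    then obtain d where d: "d \<in> set ds" "e = \<sigma> d" by auto
    then have "cmod (mono2 d z0) \<noteq> 1" using assms by (simp add: generic_def)
    then show "cmod (mono2 e z0) < 1"
      unfolding d(2) \<sigma>_def P_def by (simp add: mono2_uminus norm_inverse inverse_less_1_iff)
  qed
  from small_monomials_nbhd[OF z0 this] obtain V r where V: "open V" "z0 \<in> V" "V \<subseteq> Cx3" "0 \<le> r" "r < 1"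
    "\<And>z d. z \<in> V \<Longrightarrow> d \<in> set ds \<Longrightarrow> cmod (mono2 (\<sigma> d) z) \<le> r" by auto
  define h where "h z = mono3 m z * mono2 (- sum_list (filter P ds)) z" for z
  have h: "holo3 V h" unfolding h_def using V by (intro holo3_mult holo3_mono3 holo3_mono2)
  define V' where "V' = {z \<in> V. cmod (h z) < cmod (h z0) + 1}"
  have V': "open V'" "z0 \<in> V'" "V' \<subseteq> V"
    using V h open_cmod_less unfolding V'_def by auto
  define w where "w z = qpoch (h z) (map (\<lambda>g. g z) (map (\<lambda>d. mono2 (\<sigma> d)) ds))" for z
  have "holo3 V' w"
    unfolding w_def
  proof (rule holo3_qpoch[where W = "cmod (h z0) + 1" and r = r])
    show "holo3 V' h" using h V' holo3_subset by blast
    show "cmod (h z) \<le> cmod (h z0) + 1" if "z \<in> V'" for z using that by (simp add: V'_def)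
    show "holo3 V' g" if "g \<in> set (map (\<lambda>d. mono2 (\<sigma> d)) ds)" for g
      using that holo3_mono2[OF order.trans[OF V'(3) V(3)]] unfolding set_map by blast
    show "cmod (g z) \<le> r" if "g \<in> set (map (\<lambda>d. mono2 (\<sigma> d)) ds)" "z \<in> V'" for g z
      using that V(6)[of z] V'(3) unfolding set_map by blast
  qed (use V V' in auto)
  moreover have big: "(cmod (mono2 d z) > 1 \<longleftrightarrow> P d) \<and> cmod (mono2 d z) \<noteq> 1" if "z \<in> V'" "d \<in> set ds" for z d
  proof -
    have zV: "z \<in> V" using V'(3) that(1) ..
    from V(6)[OF zV that(2)] V(5) have "cmod (mono2 (\<sigma> d) z) < 1" by simp
    moreover have "cmod (mono2 d z) > 0" using mono2_nonzero[OF subsetD[OF V(3) zV]] by simp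
    ultimately show ?thesis
      by (auto simp: \<sigma>_def mono2_uminus norm_inverse inverse_less_1_iff split: if_splits)
  qed
  moreover have "pexp_factor ds m z = (if even (length (filter P ds)) then w z else inverse (w z))" if z: "z \<in> V'" for z
  proof -
    have zC: "z \<in> Cx3" using z V V' by auto
    have 1: "filter (\<lambda>q. cmod q > 1) (map (\<lambda>d. mono2 d z) ds) = map (\<lambda>d. mono2 d z) (filter P ds)"
      unfolding filter_map comp_def using big[OF z] by (metis (mono_tags, lifting) filter_cong)
    have 2: "map (\<lambda>q. if cmod q > 1 then inverse q else q) (map (\<lambda>d. mono2 d z) ds) = map (\<lambda>d. mono2 (\<sigma> d) z) ds"
      using big[OF z] by (auto simp: \<sigma>_def mono2_uminus)
    have 3: "mono3 m z / prod_list (map (\<lambda>d. mono2 d z) (filter P ds)) = h z"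
      using zC by (simp add: h_def mono2_uminus mono2_sum_list divide_inverse)
    show ?thesis
      unfolding pexp_factor_eq qpoch_ext_def Let_def 1 2 3 w_def by (simp add: comp_def)
  qed
  moreover have "V' \<subseteq> generic ds"
    using big V V' by (auto simp: generic_def)
  ultimately show ?thesis using V' by blast
qed

lemma open_generic: "open (generic ds)"
  \<comment> \<open>The monomial (0, 0, 0) is a dummy; only the neighbourhood inside
    \<open>generic ds\<close> matters.\<close>
  unfolding open_subopen[of "generic ds"] using pexp_factor_local[of _ ds "(0, 0, 0)"] by blast

lemma open_pexp_factor_nonzero: "open {z \<in> generic ds. pexp_factor ds m z \<noteq> 0}"
  unfolding open_subopen[of "{z \<in> generic ds. pexp_factor ds m z \<noteq> 0}"]
proof
  fix z0 assume "z0 \<in> {z \<in> generic ds. pexp_factor ds m z \<noteq> 0}"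
  then obtain V w \<epsilon> where V: "open V" "z0 \<in> V" "V \<subseteq> generic ds" "holo3 V w"
    "\<And>z. z \<in> V \<Longrightarrow> pexp_factor ds m z = (if \<epsilon> then w z else inverse (w z))" and z0: "pexp_factor ds m z0 \<noteq> 0"
    using pexp_factor_local[of z0 ds m] by auto
  have "open (V \<inter> w -` (- {0}))"
    using V by (intro continuous_open_preimage holo3_imp_continuous_on) auto
  then show "\<exists>T. open T \<and> z0 \<in> T \<and> T \<subseteq> {z \<in> generic ds. pexp_factor ds m z \<noteq> 0}"
    using V z0 by (intro exI[of _ "V \<inter> w -` (- {0})"]) (auto split: if_splits)
qed

lemma open_pexp_dom: "open (pexp_dom \<mu> ds)"
proof -
  have "pexp_dom \<mu> ds = generic ds \<inter> (\<Inter>m\<in>Poly_Mapping.keys \<mu>. {z \<in> generic ds. pexp_factor ds m z \<noteq> 0})"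
    by (auto simp: pexp_dom_eq)
  then show ?thesis
    using open_generic open_pexp_factor_nonzero by (auto intro!: open_Int open_INT)
qed

text \<open>Because \<open>inverse 0 = 0\<close>, the value is 0 at poles as well as at zeros. Where
  it is nonzero, the local product w is nonzero too, and so its reciprocal is holomorphic.\<close>

lemma holo3_pexp_factor: "holo3 {z \<in> generic ds. pexp_factor ds m z \<noteq> 0} (pexp_factor ds m)"
proof (rule holo3_local)
  fix z0 assume "z0 \<in> {z \<in> generic ds. pexp_factor ds m z \<noteq> 0}"
  then obtain V w \<epsilon> where V: "open V" "z0 \<in> V" "V \<subseteq> generic ds" "holo3 V w"
    "\<And>z. z \<in> V \<Longrightarrow> pexp_factor ds m z = (if \<epsilon> then w z else inverse (w z))" and z0: "pexp_factor ds m z0 \<noteq> 0"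
    using pexp_factor_local[of z0 ds m] by auto
  let ?V = "V \<inter> {z \<in> generic ds. pexp_factor ds m z \<noteq> 0}"
  have op: "open ?V" by (intro open_Int V open_pexp_factor_nonzero)
  have "holo3 ?V (\<lambda>z. if \<epsilon> then w z else inverse (w z))"
  proof (cases \<epsilon>)
    case False
    have "holo3 ?V (\<lambda>z. inverse (w z))"
    proof (rule holo3_inverse)
      show "holo3 ?V w" using V(4) by (rule holo3_subset) simp
      show "w z \<noteq> 0" if "z \<in> ?V" for z using that V(5)[of z] False by simp
    qed
    with False show ?thesis by simp
  qed (use holo3_subset[OF V(4), of ?V] in simp)
  then have "holo3 ?V (pexp_factor ds m)"
    using op by (rule holo3_cong) (use V(5) in auto)
  with op show "\<exists>V. open V \<and> z0 \<in> V \<and> holo3 V (pexp_factor ds m)"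
    using V z0 by blast
qed

lemma holo3_pexp:
  "holo3 (pexp_dom \<mu> ds) (\<lambda>z. \<Prod>m\<in>Poly_Mapping.keys \<mu>. pexp_factor ds m z powi Poly_Mapping.lookup \<mu> m)"
proof (intro holo3_prod holo3_power_int)
  fix m assume m: "m \<in> Poly_Mapping.keys \<mu>"
  show "holo3 (pexp_dom \<mu> ds) (pexp_factor ds m)"
    using holo3_pexp_factor by (rule holo3_subset) (use m in \<open>auto simp: pexp_dom_eq\<close>)
  show "pexp_factor ds m z \<noteq> 0" if "z \<in> pexp_dom \<mu> ds" for z
    using that m by (simp add: pexp_dom_eq)
qed

text \<open>Scaling p, or s when a = 0, by a real number slightly above 1 multiplies |p^a s^b| by a
  nontrivial power of that number, which moves a base of modulus 1 off the unit circle.\<close>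

lemma generic_dense:
  assumes "\<forall>d\<in>set ds. d \<noteq> 0"
  shows "open_dense (generic ds)"
  using assms
proof (induction ds)
  case Nil
  then show ?case by (simp add: generic_def)
next
  case (Cons d ds)
  obtain a b where d: "d = (a, b)" by (cases d)
  have "z \<in> closure (generic [d])" if z: "z \<in> Cx3" for z
  proof (cases "cmod (mono2 d z) = 1")
    case False
    then have "z \<in> generic [d]" using z by (simp add: generic_def)
    then show ?thesis using closure_subset by blast
  next
    case True
    obtain Q p s where zz: "z = (Q, p, s)" by (cases z)
    define t where "t n = 1 + inverse (real (Suc n))" for n
    have t: "t n > 1" for n by (simp add: t_def)
    have tlim: "(\<lambda>n. complex_of_real (t n)) \<longlonglongrightarrow> 1"
      unfolding t_def using tendsto_of_real[OF tendsto_add[OF tendsto_const[of 1] LIMSEQ_inverse_real_of_nat]]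
      by (simp only: add_0_right of_real_1)
    have t_powi: "t n powi k \<noteq> 1" if "k \<noteq> 0" for n k
      using t[of n] that power_int_strict_increasing[of 0 k "t n"] power_int_strict_increasing[of k 0 "t n"]
      by (cases "k > 0") auto
    have "\<exists>x :: nat \<Rightarrow> C3. (\<forall>n. x n \<in> generic [d]) \<and> x \<longlonglongrightarrow> z"
    proof (cases "a = 0")
      case False
      define x where "x n = (Q, p * complex_of_real (t n), s)" for n
      have "mono2 d (x n) = mono2 d z * of_real (t n) powi a" for n
        by (simp add: mono2_def x_def zz d power_int_mult_distrib)
      then have "cmod (mono2 d (x n)) = t n powi a" for n
        using True t[of n] by (simp add: norm_mult norm_power_int)
      moreover have "x n \<in> Cx3" for n using z t[of n] by (auto simp: x_def Cx3_def zz)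
      moreover have "x \<longlonglongrightarrow> z"
        unfolding x_def zz using tendsto_mult[OF tendsto_const tlim, of p] by (intro tendsto_Pair tendsto_const) simp
      ultimately show ?thesis using t_powi[OF False] by (intro exI[of _ x]) (auto simp: generic_def)
    next
      case a: True
      then have b: "b \<noteq> 0" using Cons.prems by (auto simp: d zero_prod_def)
      define x where "x n = (Q, p, s * complex_of_real (t n))" for n
      have "mono2 d (x n) = mono2 d z * of_real (t n) powi b" for n
        by (simp add: mono2_def x_def zz d power_int_mult_distrib)
      then have "cmod (mono2 d (x n)) = t n powi b" for n
        using True t[of n] by (simp add: norm_mult norm_power_int)
      moreover have "x n \<in> Cx3" for n using z t[of n] by (auto simp: x_def Cx3_def zz)
      moreover have "x \<longlonglongrightarrow> z"
        unfolding x_def zz using tendsto_mult[OF tendsto_const tlim, of s] by (intro tendsto_Pair tendsto_const) simp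
      ultimately show ?thesis using t_powi[OF b] by (intro exI[of _ x]) (auto simp: generic_def)
    qed
    then show ?thesis by (auto simp: closure_sequential)
  qed
  then have "open_dense (generic [d])"
    using open_generic[of "[d]"] unfolding open_dense_def by (auto simp: generic_def)
  moreover have "generic (d # ds) = generic [d] \<inter> generic ds"
    by (auto simp: generic_def)
  ultimately show ?case using Cons by (auto intro: open_dense_Int)
qed

lemma finite_powi_roots:
  assumes "i \<noteq> 0"
  shows "finite {Q :: complex. Q powi i * c = 1}"
proof (rule finite_subset)
  let ?n = "nat \<bar>i\<bar>"
  show "{Q. Q powi i * c = 1} \<subseteq> {Q. Q ^ ?n = c} \<union> {Q. Q ^ ?n = inverse c}"
  proof
    fix Q assume "Q \<in> {Q. Q powi i * c = 1}"
    then have *: "Q powi i = inverse c" by (simp add: inverse_unique mult.commute)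
    show "Q \<in> {Q. Q ^ ?n = c} \<union> {Q. Q ^ ?n = inverse c}"
      using * by (cases "i \<ge> 0") (auto simp: power_int_def power_inverse)
  qed
  show "finite ({Q. Q ^ ?n = c} \<union> {Q. Q ^ ?n = inverse c})"
    using assms by (auto intro: finite_nth_roots)
qed

text \<open>A vanishing value forces the underlying product to vanish, even where the extension has
  a pole, since a reciprocal is 0 only as \<open>inverse 0\<close>.\<close>

lemma qpoch_ext_eq_0D:
  assumes "qpoch_ext z ps = 0" "\<forall>q\<in>set ps. cmod q \<noteq> 1 \<and> q \<noteq> 0"
  shows "\<exists>ns. z * (prod_list (map2 power (map (\<lambda>q. if cmod q > 1 then inverse q else q) ps) ns)
    / prod_list (filter (\<lambda>q. cmod q > 1) ps)) = 1"
proof -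
  let ?ps = "map (\<lambda>q. if cmod q > 1 then inverse q else q) ps"
  have "\<forall>q\<in>set ?ps. cmod q < 1"
    using assms(2) by (auto simp: norm_inverse inverse_less_1_iff)
  moreover have "qpoch (z / prod_list (filter (\<lambda>q. cmod q > 1) ps)) ?ps = 0"
    using assms(1) by (auto simp: qpoch_ext_def Let_def split: if_splits)
  ultimately show ?thesis by (auto simp: qpoch_eq_0_iff)
qed

lemma pexp_factor_zeros_countable:
  assumes "fst m \<noteq> 0" "(Q0, p, s) \<in> generic ds"
  shows "countable {Q. pexp_factor ds m (Q, p, s) = 0}"
proof -
  let ?ps = "map (\<lambda>d. mono2 d (Q0, p, s)) ds"
  define c where "c ns = mono2 (snd m) (Q0, p, s) * (prod_list (map2 power (map (\<lambda>q. if cmod q > 1 then inverse q else q) ?ps) ns)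
    / prod_list (filter (\<lambda>q. cmod q > 1) ?ps))" for ns :: "nat list"
  have *: "mono2 d (Q, p, s) = mono2 d (Q0, p, s)" for d Q by (simp add: mono2_def)
  have "{Q. pexp_factor ds m (Q, p, s) = 0} \<subseteq> (\<Union>ns. {Q. Q powi fst m * c ns = 1})"
  proof
    fix Q assume "Q \<in> {Q. pexp_factor ds m (Q, p, s) = 0}"
    then have "qpoch_ext (mono3 m (Q, p, s)) ?ps = 0"
      by (simp add: pexp_factor_eq *[of _ Q])
    moreover have "\<forall>q\<in>set ?ps. cmod q \<noteq> 1 \<and> q \<noteq> 0"
      using assms(2) mono2_nonzero by (auto simp: generic_def)
    ultimately show "Q \<in> (\<Union>ns. {Q. Q powi fst m * c ns = 1})"
      using qpoch_ext_eq_0D[of "mono3 m (Q, p, s)" ?ps] by (simp add: mono3_def c_def *[of _ Q] mult.assoc)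
  qed
  moreover have "countable (\<Union>ns. {Q. Q powi fst m * c ns = 1})"
    using finite_powi_roots[OF assms(1)] by (intro countable_UN) (auto intro: countable_finite)
  ultimately show ?thesis by (rule countable_subset)
qed

definition no_Q0 :: "laurent \<Rightarrow> bool" where
  "no_Q0 \<mu> \<longleftrightarrow> (\<forall>m\<in>Poly_Mapping.keys \<mu>. fst m \<noteq> 0)"

text \<open>The domain is dense because, for fixed generic \<open>p\<close> and \<open>s\<close>, a factor whose argument has nonzero
  degree in \<open>Q\<close> vanishes for countably many \<open>Q\<close> only.\<close>

lemma open_dense_pexp_dom:
  assumes "\<forall>d\<in>set ds. d \<noteq> 0" "no_Q0 \<mu>"
  shows "open_dense (pexp_dom \<mu> ds)"
proof -
  have "z \<in> closure (pexp_dom \<mu> ds)" if z: "z \<in> Cx3" for z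
    unfolding closure_iff_nhds_not_empty
  proof (intro allI impI)
    fix B V assume V: "V \<subseteq> B" "open V" "z \<in> V"
    have "z \<in> closure (generic ds)" using generic_dense[OF assms(1)] z by (auto simp: open_dense_def)
    then have "generic ds \<inter> V \<noteq> {}"
      using V unfolding closure_iff_nhds_not_empty by blast
    then obtain Q p s where z': "(Q, p, s) \<in> V \<inter> generic ds" by auto
    then have "open (V \<inter> generic ds)" using V open_generic by auto
    then obtain A A' where AB: "open A" "Q \<in> A" "(p, s) \<in> A'" "A \<times> A' \<subseteq> V \<inter> generic ds"
      using z' by (rule open_prod_elim) auto
    obtain r where r: "r > 0" "ball Q r \<subseteq> A" using AB by (auto simp: open_contains_ball)
    have "countable (\<Union>m\<in>Poly_Mapping.keys \<mu>. {Q. pexp_factor ds m (Q, p, s) = 0})"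
    proof (rule countable_UN)
      show "countable {Q. pexp_factor ds m (Q, p, s) = 0}" if "m \<in> Poly_Mapping.keys \<mu>" for m
        using that assms(2) z' by (intro pexp_factor_zeros_countable) (auto simp: no_Q0_def)
    qed (simp add: countable_finite)
    then have "\<not> ball Q r \<subseteq> (\<Union>m\<in>Poly_Mapping.keys \<mu>. {Q. pexp_factor ds m (Q, p, s) = 0})"
      using uncountable_ball[OF r(1), of Q] countable_subset by blast
    then obtain Q' where "Q' \<in> ball Q r" "\<forall>m\<in>Poly_Mapping.keys \<mu>. pexp_factor ds m (Q', p, s) \<noteq> 0" by blast
    then have "(Q', p, s) \<in> pexp_dom \<mu> ds \<inter> V"
      using r AB by (auto simp: pexp_dom_eq)
    then show "pexp_dom \<mu> ds \<inter> B \<noteq> {}" using V by auto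
  qed
  then show ?thesis
    using open_pexp_dom by (auto simp: open_dense_def pexp_dom_eq generic_def)
qed

section \<open>Algebra of germs, and the plethystic exponent as a function of fractions\<close>

section \<open>Germs\<close>

lemma germ_eqI:
  assumes "open_dense U" "holo3 U f" "open_dense V" "holo3 V g"
    and "open_dense W" "\<And>z. z \<in> U \<Longrightarrow> z \<in> V \<Longrightarrow> z \<in> W \<Longrightarrow> f z = g z"
  shows "germ (U, f) = germ (V, g)"
proof (rule Quotient_rel_abs[OF Quotient_germR])
  show "germ_rel (U, f) (V, g)"
    using assms open_dense_Int[OF open_dense_Int[OF assms(1,3)] assms(5)]
    unfolding germ_rel_def by (auto intro!: exI[of _ "U \<inter> V \<inter> W"])
qed

lemma germ_exhaust:
  obtains U f where "x = germ (U, f)" "open_dense U" "holo3 U f"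
proof -
  have "germ_rel (rep_germR x) (rep_germR x)" "germ (rep_germR x) = x"
    using Quotient_germR by (simp_all add: Quotient_rep_reflp Quotient_abs_rep)
  then show thesis using that germ_relD by (metis prod.collapse)
qed

lemma mult_germ:
  "open_dense U \<Longrightarrow> holo3 U f \<Longrightarrow> open_dense V \<Longrightarrow> holo3 V g \<Longrightarrow>
    germ (U, f) * germ (V, g) = germ (U \<inter> V, \<lambda>z. f z * g z)"
  by (simp add: times_germR.abs_eq germ_rel_refl)

lemma add_germ:
  "open_dense U \<Longrightarrow> holo3 U f \<Longrightarrow> open_dense V \<Longrightarrow> holo3 V g \<Longrightarrow>
    germ (U, f) + germ (V, g) = germ (U \<inter> V, \<lambda>z. f z + g z)"
  by (simp add: plus_germR.abs_eq germ_rel_refl)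

lemma one_germ: "open_dense U \<Longrightarrow> germ (U, \<lambda>z. 1) = 1"
  unfolding one_germR_def by (rule germ_eqI[OF _ holo3_const open_dense_Cx3 holo3_const open_dense_Cx3]) auto

lemma delta_germ:
  assumes "det M = 1" "open_dense U" "holo3 U f"
  shows "delta M (germ (U, f)) = germ ({z \<in> Cx3. mono_map M z \<in> U}, \<lambda>z. f (mono_map M z))"
    and "open_dense {z \<in> Cx3. mono_map M z \<in> U}" "holo3 {z \<in> Cx3. mono_map M z \<in> U} (\<lambda>z. f (mono_map M z))"
  using assms by (auto simp: delta.abs_eq germ_rel_refl open_dense_mono_map intro: holo3_mono_map)

lemma delta_mult: "det M = 1 \<Longrightarrow> delta M (x * y) = delta M x * delta M y"
  by (cases x rule: germ_exhaust; cases y rule: germ_exhaust)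
    (auto simp: mult_germ delta_germ open_dense_Int holo3_mult holo3_subset intro!: arg_cong[of _ _ germ])

lemma delta_add: "det M = 1 \<Longrightarrow> delta M (x + y) = delta M x + delta M y"
  by (cases x rule: germ_exhaust; cases y rule: germ_exhaust)
    (auto simp: add_germ delta_germ open_dense_Int holo3_add holo3_subset intro!: arg_cong[of _ _ germ])

lemma delta_one: "det M = 1 \<Longrightarrow> delta M 1 = 1"
  by (simp add: one_germR_def delta_germ holo3_const mono_map_Cx3 cong: conj_cong)

lemma delta_zero: "det M = 1 \<Longrightarrow> delta M 0 = 0"
  using delta_add[of M 0 0] by simp

lemma mono_map_mult: "z \<in> Cx3 \<Longrightarrow> mono_map N (mono_map M z) = mono_map (N ** M) z"
  by (auto simp: mono_map_def matrix_matrix_mult_def sum_2 Cx3_def power_int_mult_distrib power_int_add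
      mult_ac simp flip: power_int_mult)

text \<open>Pullback is contravariant, hence the reversed order of the matrices.\<close>

lemma delta_delta:
  assumes "det M = 1" "det N = 1"
  shows "delta M (delta N x) = delta (N ** M) x"
proof (cases x rule: germ_exhaust)
  case (1 U f)
  have "det (N ** M) = 1" using assms by (simp add: det_mul)
  note d = delta_germ[OF assms(2) 1(2,3)] delta_germ[OF assms(1) delta_germ(2,3)[OF assms(2) 1(2,3)]] delta_germ[OF this 1(2,3)]
  show ?thesis
    unfolding 1(1) d(1,4,7)
    by (rule germ_eqI[OF d(5,6,8,9) open_dense_Cx3]) (simp add: mono_map_mult)
qed

lemma mono_map_one: "z \<in> Cx3 \<Longrightarrow> mono_map (mat 1) z = z"
  by (auto simp: mono_map_def mat_def)

lemma delta_mat_1: "delta (mat 1) x = x"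
proof (cases x rule: germ_exhaust)
  case (1 U f)
  have "det (mat 1 :: int^2^2) = 1" by simp
  note d = delta_germ[OF this 1(2,3)]
  show ?thesis
    unfolding 1(1) d(1)
    by (rule germ_eqI[OF d(2,3) 1(2,3) open_dense_Cx3]) (simp add: mono_map_one)
qed

lemma emb_Fract:
  assumes "b \<noteq> 0"
  shows "emb (Fract a b) = germ ({(Q, p, s) \<in> Cx3. poly b Q \<noteq> 0}, \<lambda>(Q, p, s). poly a Q / poly b Q)"
  using assms by (simp add: Fract_def emb.abs_eq)

lemmas emb_germ = open_dense_poly_nonzero holo3_poly_quotient

lemma emb_mult: "emb (x * y) = emb x * emb y"
  by (cases x; cases y)
    (auto simp: emb_Fract emb_germ mult_germ open_dense_Int intro!: arg_cong[of _ _ germ])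

lemma emb_add: "emb (x + y) = emb x + emb y"
proof (cases x; cases y)
  fix a b c d :: "complex poly"
  assume x: "x = Fract a b" "b \<noteq> 0" and y: "y = Fract c d" "d \<noteq> 0"
  note 1 = open_dense_poly_nonzero[OF x(2)] holo3_poly_quotient[of b a]
  note 2 = open_dense_poly_nonzero[OF y(2)] holo3_poly_quotient[of d c]
  have bd: "b * d \<noteq> 0" using x y by simp
  note 3 = open_dense_poly_nonzero[OF bd] holo3_poly_quotient[of "b * d" "a * d + c * b"]
  have "emb (x + y) = emb (Fract (a * d + c * b) (b * d))" using x y by simp
  also have "\<dots> = emb x + emb y"
    unfolding x(1) y(1) emb_Fract[OF x(2)] emb_Fract[OF y(2)] emb_Fract[OF bd] add_germ[OF 1 2]
  proof (rule germ_eqI[OF 3 _ _ open_dense_Cx3])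
    show "open_dense ({(Q, p, s). (Q, p, s) \<in> Cx3 \<and> poly b Q \<noteq> 0} \<inter> {(Q, p, s). (Q, p, s) \<in> Cx3 \<and> poly d Q \<noteq> 0})"
      by (intro open_dense_Int 1 2)
    show "holo3 ({(Q, p, s). (Q, p, s) \<in> Cx3 \<and> poly b Q \<noteq> 0} \<inter> {(Q, p, s). (Q, p, s) \<in> Cx3 \<and> poly d Q \<noteq> 0})
       (\<lambda>z. (case z of (Q, p, s) \<Rightarrow> poly a Q / poly b Q) + (case z of (Q, p, s) \<Rightarrow> poly c Q / poly d Q))"
      by (intro holo3_add holo3_subset[OF 1(2)] holo3_subset[OF 2(2)]) auto
  qed (auto simp: field_simps)
  finally show ?thesis .
qed

lemma emb_one: "emb 1 = 1"
  by (simp add: One_fract_def emb_Fract one_germR_def case_prod_unfold)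

lemma emb_zero: "emb 0 = 0"
  using emb_add[of 0 0] by simp

lemma emb_uminus: "emb (- x) = - emb x"
  using emb_add[of x "- x"] by (simp add: emb_zero eq_neg_iff_add_eq_0 add.commute)

lemma delta_emb: "det M = 1 \<Longrightarrow> delta M (emb x) = emb x"
proof (cases x)
  fix a b :: "complex poly" assume M: "det M = 1" and x: "x = Fract a b" "b \<noteq> 0"
  note 1 = open_dense_poly_nonzero[OF x(2)] holo3_poly_quotient[of b a]
  note d = delta_germ[OF M 1]
  show ?thesis unfolding x(1) emb_Fract[OF x(2)] d(1)
    by (rule germ_eqI[OF d(2,3) 1 open_dense_Cx3]) (auto simp: mono_map_def)
qed

lemma unit_inv_eqI: "x * y = 1 \<Longrightarrow> unit_inv x = y"
  unfolding unit_inv_def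
  by (rule the_equality) (auto, metis mult.assoc mult.commute mult.left_neutral)

section \<open>Calculus of the plethystic exponent\<close>

abbreviation valid :: "(int \<times> int) list \<Rightarrow> bool" where
  "valid ds \<equiv> \<forall>d\<in>set ds. d \<noteq> 0"

abbreviation pexp_fun :: "laurent \<Rightarrow> (int \<times> int) list \<Rightarrow> C3 \<Rightarrow> complex" where
  "pexp_fun \<mu> ds z \<equiv> \<Prod>m\<in>Poly_Mapping.keys \<mu>. pexp_factor ds m z powi Poly_Mapping.lookup \<mu> m"

lemma pexp_germ:
  assumes "valid ds" "no_Q0 \<mu>"
  shows "open_dense (pexp_dom \<mu> ds)" "holo3 (pexp_dom \<mu> ds) (pexp_fun \<mu> ds)"
  by (rule open_dense_pexp_dom[OF assms] holo3_pexp)+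

lemma no_Q0_add: "no_Q0 \<mu> \<Longrightarrow> no_Q0 \<nu> \<Longrightarrow> no_Q0 (\<mu> + \<nu>)"
  unfolding no_Q0_def using Poly_Mapping.keys_add by fastforce

lemma no_Q0_uminus [simp]: "no_Q0 (- \<mu>) \<longleftrightarrow> no_Q0 \<mu>"
  by (simp add: no_Q0_def)

lemma no_Q0_zero [simp]: "no_Q0 0"
  by (simp add: no_Q0_def)

lemma no_Q0_single: "fst m \<noteq> 0 \<Longrightarrow> no_Q0 (Poly_Mapping.single m c)"
  by (simp add: no_Q0_def)

text \<open>An induction over monomials that never leaves the polynomials without terms of degree 0
  in Q, so that every \<open>pexp\<close> met on the way has a dense domain.\<close>

lemma no_Q0_induct [consumes 1, case_names zero single add]:
  assumes "no_Q0 \<mu>" "P 0" "\<And>m c. fst m \<noteq> 0 \<Longrightarrow> P (Poly_Mapping.single m c)"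
    and "\<And>\<mu> \<nu>. no_Q0 \<mu> \<Longrightarrow> no_Q0 \<nu> \<Longrightarrow> P \<mu> \<Longrightarrow> P \<nu> \<Longrightarrow> P (\<mu> + \<nu>)"
  shows "P \<mu>"
  using assms(1)
proof (induction \<mu> rule: Poly_Mapping.update_induct)
  case const
  show ?case by (rule assms(2))
next
  case (update f a b)
  have eq: "Poly_Mapping.update a b f = Poly_Mapping.single a b + f"
    using update(1) by (intro poly_mapping_eqI)
      (auto simp: lookup_add lookup_single Poly_Mapping.lookup_update when_def in_keys_iff)
  have "fst a \<noteq> 0" "no_Q0 f"
    using update(2,4) by (auto simp: no_Q0_def Poly_Mapping.keys_update)
  then show ?case unfolding eq using update(3) by (intro assms(3,4) no_Q0_single)
qed

lemma pexp_0: "valid ds \<Longrightarrow> pexp 0 ds = 1"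
  using open_dense_pexp_dom[of ds 0] by (simp add: pexp_def one_germ)

lemma pexp_add:
  assumes "valid ds" "no_Q0 \<mu>" "no_Q0 \<nu>"
  shows "pexp (\<mu> + \<nu>) ds = pexp \<mu> ds * pexp \<nu> ds"
proof -
  note 1 = pexp_germ[OF assms(1,2)] and 2 = pexp_germ[OF assms(1,3)] and 3 = pexp_germ[OF assms(1) no_Q0_add[OF assms(2,3)]]
  show ?thesis
    unfolding pexp_def mult_germ[OF 1 2]
  proof (rule germ_eqI[OF 3 _ _ open_dense_Cx3])
    show "open_dense (pexp_dom \<mu> ds \<inter> pexp_dom \<nu> ds)" by (rule open_dense_Int[OF 1(1) 2(1)])
    show "holo3 (pexp_dom \<mu> ds \<inter> pexp_dom \<nu> ds) (\<lambda>z. pexp_fun \<mu> ds z * pexp_fun \<nu> ds z)"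
      by (rule holo3_mult[OF holo3_subset[OF 1(2)] holo3_subset[OF 2(2)]]) auto
    fix z assume z: "z \<in> pexp_dom \<mu> ds \<inter> pexp_dom \<nu> ds"
    let ?K = "Poly_Mapping.keys \<mu> \<union> Poly_Mapping.keys \<nu>"
    have ext: "pexp_fun \<rho> ds z = (\<Prod>m\<in>?K. pexp_factor ds m z powi Poly_Mapping.lookup \<rho> m)"
      if "Poly_Mapping.keys \<rho> \<subseteq> ?K" for \<rho>
      using that by (intro prod.mono_neutral_left) (auto simp: in_keys_iff)
    have "pexp_fun (\<mu> + \<nu>) ds z = (\<Prod>m\<in>?K. pexp_factor ds m z powi Poly_Mapping.lookup (\<mu> + \<nu>) m)"
      by (rule ext[OF Poly_Mapping.keys_add])
    also have "\<dots> = (\<Prod>m\<in>?K. pexp_factor ds m z powi Poly_Mapping.lookup \<mu> m * pexp_factor ds m z powi Poly_Mapping.lookup \<nu> m)"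
      using z by (intro prod.cong refl) (auto simp: lookup_add power_int_add pexp_dom_eq)
    also have "\<dots> = pexp_fun \<mu> ds z * pexp_fun \<nu> ds z"
      using ext[of \<mu>] ext[of \<nu>] by (simp add: prod.distrib)
    finally show "pexp_fun (\<mu> + \<nu>) ds z = pexp_fun \<mu> ds z * pexp_fun \<nu> ds z" .
  qed
qed

lemma pexp_uminus: "valid ds \<Longrightarrow> no_Q0 \<mu> \<Longrightarrow> pexp \<mu> ds * pexp (- \<mu>) ds = 1"
  using pexp_add[of ds \<mu> "- \<mu>"] by (simp add: pexp_0)

text \<open>For |p| < 1 this is \<open>qpoch_insert\<close>. For |p| > 1 the same equation with base
  1/p is read backwards: it must be divided by the symbol without p, which is why that value is
  required to be nonzero.\<close>

lemma qpoch_ext_insert: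
  assumes "\<forall>q\<in>set (us @ p # vs). cmod q \<noteq> 1 \<and> q \<noteq> 0" "qpoch_ext z (us @ vs) \<noteq> 0"
  shows "qpoch_ext z (us @ p # vs) = qpoch_ext z (us @ vs) * qpoch_ext (z * p) (us @ p # vs)"
proof -
  define J where "J ps = filter (\<lambda>q. cmod q > 1) ps" for ps :: "complex list"
  define N where "N ps = map (\<lambda>q. if cmod q > 1 then inverse q else q) ps" for ps :: "complex list"
  have ext: "qpoch_ext z ps = (if even (length (J ps)) then qpoch (z / prod_list (J ps)) (N ps)
      else inverse (qpoch (z / prod_list (J ps)) (N ps)))" for z ps
    by (simp add: qpoch_ext_def Let_def J_def N_def)
  have N: "N (ps @ qs) = N ps @ N qs" "N (q # qs) = (if cmod q > 1 then inverse q else q) # N qs" for q ps qs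
    by (simp_all add: N_def)
  have J: "J (ps @ qs) = J ps @ J qs" "J (q # qs) = (if cmod q > 1 then q # J qs else J qs)" for q ps qs
    by (simp_all add: J_def)
  have small: "\<forall>q\<in>set (N (us @ p # vs)). cmod q < 1"
  proof
    fix x assume "x \<in> set (N (us @ p # vs))"
    then obtain q where q: "q \<in> set (us @ p # vs)" "x = (if cmod q > 1 then inverse q else q)"
      unfolding N_def set_map by blast
    then have "cmod q \<noteq> 1" using assms(1) by blast
    then show "cmod x < 1" unfolding q(2) by (simp add: norm_inverse inverse_less_1_iff)
  qed
  have p: "p \<noteq> 0" using assms(1) by simp
  show ?thesis
  proof (cases "cmod p > 1")
    case False
    have "qpoch w (N us @ p # N vs) = qpoch w (N us @ N vs) * qpoch (w * p) (N us @ p # N vs)" for w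
      using small False by (intro qpoch_insert) (simp add: N)
    from this[of "z / prod_list (J (us @ vs))"] show ?thesis
      unfolding ext N J using False by simp
  next
    case True
    have "qpoch w (N us @ inverse p # N vs) = qpoch w (N us @ N vs) * qpoch (w * inverse p) (N us @ inverse p # N vs)" for w
      using small True by (intro qpoch_insert) (simp add: N)
    from this[of "z / prod_list (J (us @ vs))"]
    have *: "qpoch (z / prod_list (J (us @ vs))) (N us @ inverse p # N vs) = qpoch (z / prod_list (J (us @ vs))) (N us @ N vs)
        * qpoch (z / (prod_list (J us) * (p * prod_list (J vs)))) (N us @ inverse p # N vs)"
      by (simp add: J divide_inverse mult_ac)
    have **: "z * p / (prod_list (J us) * (p * prod_list (J vs))) = z / prod_list (J (us @ vs))"
      using p by (simp add: J)
    have "qpoch (z / prod_list (J (us @ vs))) (N us @ N vs) \<noteq> 0"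
      using assms(2) unfolding ext N J by (auto split: if_splits)
    then show ?thesis
      unfolding ext N J using True * ** by (simp add: J field_simps)
  qed
qed

lemma pexp_single:
  assumes "c \<noteq> 0"
  shows "pexp (Poly_Mapping.single m c) ds = germ ({z \<in> generic ds. pexp_factor ds m z \<noteq> 0}, \<lambda>z. pexp_factor ds m z powi c)"
    and "pexp_dom (Poly_Mapping.single m c) ds = {z \<in> generic ds. pexp_factor ds m z \<noteq> 0}"
  using assms by (simp_all add: pexp_def pexp_dom_eq)

lemma pexp_factor_insert:
  assumes "z \<in> generic (us @ d # vs)" "pexp_factor (us @ vs) m z \<noteq> 0"
  shows "pexp_factor (us @ d # vs) m z = pexp_factor (us @ vs) m z * pexp_factor (us @ d # vs) (m + (0, d)) z"
proof -
  have zC: "z \<in> Cx3" using assms(1) by (simp add: generic_def)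
  have *: "mono3 (m + (0, d)) z = mono3 m z * mono2 d z"
    using mono2_add[OF zC, of "snd m" d] by (simp add: mono3_def)
  have **: "\<forall>q\<in>set (map (\<lambda>d. mono2 d z) us @ mono2 d z # map (\<lambda>d. mono2 d z) vs). cmod q \<noteq> 1 \<and> q \<noteq> 0"
    using assms(1) mono2_nonzero[OF zC] by (auto simp: generic_def)
  show ?thesis
    using qpoch_ext_insert[OF **, of "mono3 m z"] assms(2)
    by (simp add: pexp_factor_eq *)
qed

lemma pexp_single_insert:
  assumes "valid (us @ d # vs)" "fst m \<noteq> 0"
  shows "pexp (Poly_Mapping.single m c) (us @ d # vs)
    = pexp (Poly_Mapping.single m c) (us @ vs) * pexp (Poly_Mapping.single (m + (0, d)) c) (us @ d # vs)"
proof (cases "c = 0")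
  case True
  then show ?thesis using assms by (simp add: pexp_0)
next
  case False
  note s = pexp_single[OF False]
  have f: "fst (m + (0, d)) \<noteq> 0" using assms(2) by simp
  have v: "valid (us @ vs)" using assms(1) by auto
  note 1 = pexp_germ[OF assms(1) no_Q0_single[OF assms(2)], of c]
  note 2 = pexp_germ[OF v no_Q0_single[OF assms(2)], of c]
  note 3 = pexp_germ[OF assms(1) no_Q0_single[OF f], of c]
  show ?thesis
    unfolding pexp_def mult_germ[OF 2 3]
  proof (rule germ_eqI[OF 1 _ _ open_dense_Cx3])
    let ?D = "pexp_dom (Poly_Mapping.single m c) (us @ vs) \<inter> pexp_dom (Poly_Mapping.single (m + (0, d)) c) (us @ d # vs)"
    show "open_dense ?D" by (rule open_dense_Int[OF 2(1) 3(1)])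
    show "holo3 ?D (\<lambda>z. pexp_fun (Poly_Mapping.single m c) (us @ vs) z * pexp_fun (Poly_Mapping.single (m + (0, d)) c) (us @ d # vs) z)"
      by (rule holo3_mult[OF holo3_subset[OF 2(2)] holo3_subset[OF 3(2)]]) auto
    fix z assume "z \<in> pexp_dom (Poly_Mapping.single m c) (us @ d # vs)" "z \<in> ?D"
    then show "pexp_fun (Poly_Mapping.single m c) (us @ d # vs) z
        = pexp_fun (Poly_Mapping.single m c) (us @ vs) z * pexp_fun (Poly_Mapping.single (m + (0, d)) c) (us @ d # vs) z"
      using pexp_factor_insert[of z us d vs m] False by (simp add: s(2) power_int_mult_distrib)
  qed
qed

text \<open>Multiplication by such polynomials, in particular by denominators, preserves
  \<open>no_Q0\<close>.\<close>

definition Q_degree_0 :: "laurent \<Rightarrow> bool" where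
  "Q_degree_0 \<mu> \<longleftrightarrow> (\<forall>m\<in>Poly_Mapping.keys \<mu>. fst m = 0)"

lemma no_Q0_mult: "no_Q0 \<mu> \<Longrightarrow> Q_degree_0 \<nu> \<Longrightarrow> no_Q0 (\<mu> * \<nu>)"
  unfolding no_Q0_def Q_degree_0_def using Poly_Mapping.keys_mult[of \<mu> \<nu>] by fastforce

lemma Q_degree_0_intros:
  "Q_degree_0 (lmon 0 a b)" "Q_degree_0 1" "Q_degree_0 0"
  "Q_degree_0 \<mu> \<Longrightarrow> Q_degree_0 \<nu> \<Longrightarrow> Q_degree_0 (\<mu> + \<nu>)"
  "Q_degree_0 \<mu> \<Longrightarrow> Q_degree_0 \<nu> \<Longrightarrow> Q_degree_0 (\<mu> - \<nu>)"
  "Q_degree_0 \<mu> \<Longrightarrow> Q_degree_0 (- \<mu>)"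
  "Q_degree_0 \<mu> \<Longrightarrow> Q_degree_0 \<nu> \<Longrightarrow> Q_degree_0 (\<mu> * \<nu>)"
proof -
  show "Q_degree_0 (lmon 0 a b)" "Q_degree_0 1" "Q_degree_0 0" "Q_degree_0 \<mu> \<Longrightarrow> Q_degree_0 (- \<mu>)"
    by (simp_all add: Q_degree_0_def lmon_def zero_prod_def)
  show add: "Q_degree_0 \<mu> \<Longrightarrow> Q_degree_0 \<nu> \<Longrightarrow> Q_degree_0 (\<mu> + \<nu>)" for \<mu> \<nu>
    unfolding Q_degree_0_def using Poly_Mapping.keys_add by fastforce
  show "Q_degree_0 \<mu> \<Longrightarrow> Q_degree_0 \<nu> \<Longrightarrow> Q_degree_0 (\<mu> - \<nu>)"
    using add[of \<mu> "- \<nu>"] by (simp add: Q_degree_0_def)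
  show "Q_degree_0 \<mu> \<Longrightarrow> Q_degree_0 \<nu> \<Longrightarrow> Q_degree_0 (\<mu> * \<nu>)"
    unfolding Q_degree_0_def using Poly_Mapping.keys_mult[of \<mu> \<nu>] by fastforce
qed

definition den :: "(int \<times> int) list \<Rightarrow> laurent" where
  "den ds = (\<Prod>(a, b)\<leftarrow>ds. 1 - lmon 0 a b)"

lemma den_simps [simp]:
  "den [] = 1" "den ((a, b) # ds) = (1 - lmon 0 a b) * den ds" "den (ds @ es) = den ds * den es"
  by (simp_all add: den_def)

lemma Q_degree_0_den: "Q_degree_0 (den ds)"
  by (induction ds) (auto intro!: Q_degree_0_intros)

text \<open>Cancellation of one factor of the denominator. For a monomial m the functional equation
  leaves an extra factor at m + (0, a, b), and this is exactly what the term -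
  \<open>lmon 0 a b\<close> removes.\<close>

lemma pexp_insert:
  assumes "no_Q0 \<mu>" "valid (us @ (a, b) # vs)"
  shows "pexp (\<mu> * (1 - lmon 0 a b)) (us @ (a, b) # vs) = pexp \<mu> (us @ vs)"
  using assms(1)
proof (induction \<mu> rule: no_Q0_induct)
  case zero
  then show ?case using assms(2) by (auto simp: pexp_0)
next
  case (single m c)
  have f: "fst (m + (0, a, b)) \<noteq> 0" using single by simp
  have "Poly_Mapping.single m c * (1 - lmon 0 a b) = Poly_Mapping.single m c + - Poly_Mapping.single (m + (0, a, b)) c"
    by (simp add: right_diff_distrib lmon_def mult_single)
  then have "pexp (Poly_Mapping.single m c * (1 - lmon 0 a b)) (us @ (a, b) # vs)
      = pexp (Poly_Mapping.single m c) (us @ (a, b) # vs) * pexp (- Poly_Mapping.single (m + (0, a, b)) c) (us @ (a, b) # vs)"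
    by (simp only: pexp_add[OF assms(2) no_Q0_single[OF single] no_Q0_uminus[THEN iffD2, OF no_Q0_single[OF f]]])
  also have "\<dots> = pexp (Poly_Mapping.single m c) (us @ vs)"
    using pexp_uminus[OF assms(2) no_Q0_single[OF f], of c]
    by (simp only: pexp_single_insert[OF assms(2) single] mult.assoc mult_1_right)
  finally show ?case .
next
  case (add \<mu> \<nu>)
  have "Q_degree_0 (1 - lmon 0 a b)" by (intro Q_degree_0_intros)
  moreover have "valid (us @ vs)" using assms(2) by auto
  ultimately show ?case using add
    by (simp only: distrib_right pexp_add[OF assms(2)] pexp_add no_Q0_mult)
qed

lemma pexp_append_right:
  assumes "no_Q0 \<mu>" "valid (ds @ es)"
  shows "pexp (\<mu> * den es) (ds @ es) = pexp \<mu> ds"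
  using assms
proof (induction es arbitrary: \<mu> ds)
  case (Cons e es)
  obtain a b where e: "e = (a, b)" by (cases e)
  have no: "no_Q0 (\<mu> * (1 - lmon 0 a b))"
    using Cons.prems by (intro no_Q0_mult Q_degree_0_intros)
  have "pexp (\<mu> * den (e # es)) (ds @ e # es) = pexp (\<mu> * (1 - lmon 0 a b) * den es) ((ds @ [e]) @ es)"
    by (simp add: e mult.assoc)
  also have "\<dots> = pexp (\<mu> * (1 - lmon 0 a b)) (ds @ [e])"
    using Cons.prems by (intro Cons.IH no) auto
  also have "\<dots> = pexp \<mu> ds"
    using pexp_insert[of \<mu> ds a b "[]"] Cons.prems by (simp add: e)
  finally show ?case .
qed simp

lemma pexp_append_left:
  assumes "no_Q0 \<mu>" "valid (ds @ es)"
  shows "pexp (\<mu> * den ds) (ds @ es) = pexp \<mu> es"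
  using assms
proof (induction ds)
  case (Cons d ds)
  obtain a b where d: "d = (a, b)" by (cases d)
  have "pexp (\<mu> * den (d # ds)) ((d # ds) @ es) = pexp ((\<mu> * den ds) * (1 - lmon 0 a b)) ([] @ d # ds @ es)"
    by (simp add: d mult_ac)
  also have "\<dots> = pexp (\<mu> * den ds) ([] @ ds @ es)"
    using Cons.prems unfolding d by (intro pexp_insert no_Q0_mult Q_degree_0_den) auto
  also have "\<dots> = pexp \<mu> es" using Cons by simp
  finally show ?case .
qed simp

text \<open>The exponent depends only on the fraction: both sides are extended to the common
  denominator \<open>ds @ es\<close>, where only numerators are compared. Nothing is divided in the
  Laurent ring.\<close>

lemma pexp_eqI:
  assumes "no_Q0 \<mu>" "no_Q0 \<nu>" "valid ds" "valid es" "\<mu> * den es = \<nu> * den ds"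
  shows "pexp \<mu> ds = pexp \<nu> es"
proof -
  have "valid (ds @ es)" using assms by auto
  with pexp_append_right[of \<mu> ds es] pexp_append_left[of \<nu> ds es] assms show ?thesis by metis
qed

lemma pexp_mult:
  assumes "no_Q0 \<mu>" "no_Q0 \<nu>" "valid ds" "valid es"
  shows "pexp \<mu> ds * pexp \<nu> es = pexp (\<mu> * den es + \<nu> * den ds) (ds @ es)"
proof -
  have "valid (ds @ es)" using assms by auto
  then show ?thesis
    using pexp_append_right[of \<mu> ds es] pexp_append_left[of \<nu> ds es] assms
    by (simp only: pexp_add no_Q0_mult Q_degree_0_den)
qed

subsection \<open>Monomial substitutions\<close>

text \<open>The exponent vector as a row multiplied by M, which is the effect of the substitution on
  the monomial p^i s^j.\<close>

definition subst2 :: "int^2^2 \<Rightarrow> int \<times> int \<Rightarrow> int \<times> int" where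
  "subst2 M d = (fst d * M$1$1 + snd d * M$2$1, fst d * M$1$2 + snd d * M$2$2)"

definition subst_laurent :: "int^2^2 \<Rightarrow> laurent \<Rightarrow> laurent" where
  "subst_laurent M \<mu> = (\<Sum>m\<in>Poly_Mapping.keys \<mu>. Poly_Mapping.single (fst m, subst2 M (snd m)) (Poly_Mapping.lookup \<mu> m))"

lemma subst_laurent_single [simp]:
  "subst_laurent M (Poly_Mapping.single m c) = Poly_Mapping.single (fst m, subst2 M (snd m)) c"
  by (simp add: subst_laurent_def)

lemma subst_laurent_lmon [simp]: "subst_laurent M (lmon i j k) = lmon i (fst (subst2 M (j, k))) (snd (subst2 M (j, k)))"
  by (simp add: lmon_def)

lemma subst_laurent_0 [simp]: "subst_laurent M 0 = 0"
  by (simp add: subst_laurent_def)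

lemma subst_laurent_add [simp]: "subst_laurent M (\<mu> + \<nu>) = subst_laurent M \<mu> + subst_laurent M \<nu>"
  unfolding subst_laurent_def by (rule setsum_keys_plus_distrib) (simp_all add: single_add)

lemma subst_laurent_uminus [simp]: "subst_laurent M (- \<mu>) = - subst_laurent M \<mu>"
  using subst_laurent_add[of M \<mu> "- \<mu>"] by (simp add: eq_neg_iff_add_eq_0 add.commute)

lemma subst_laurent_diff [simp]: "subst_laurent M (\<mu> - \<nu>) = subst_laurent M \<mu> - subst_laurent M \<nu>"
  using subst_laurent_add[of M \<mu> "- \<nu>"] by simp

lemma subst_laurent_mult [simp]: "subst_laurent M (\<mu> * \<nu>) = subst_laurent M \<mu> * subst_laurent M \<nu>"
proof -
  have 1: "subst_laurent M (Poly_Mapping.single m c * \<nu>) = subst_laurent M (Poly_Mapping.single m c) * subst_laurent M \<nu>" for m c \<nu>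
    by (rule poly_mapping_additive_eqI[of "\<lambda>\<nu>. subst_laurent M (Poly_Mapping.single m c * \<nu>)"
          "\<lambda>\<nu>. subst_laurent M (Poly_Mapping.single m c) * subst_laurent M \<nu>"])
      (simp_all add: distrib_left mult_single subst2_def algebra_simps)
  show ?thesis
    by (rule poly_mapping_additive_eqI[of "\<lambda>\<mu>. subst_laurent M (\<mu> * \<nu>)" "\<lambda>\<mu>. subst_laurent M \<mu> * subst_laurent M \<nu>"])
      (simp_all add: distrib_right 1)
qed

lemma no_Q0_subst_laurent: "no_Q0 \<mu> \<Longrightarrow> no_Q0 (subst_laurent M \<mu>)"
  by (induction \<mu> rule: no_Q0_induct) (auto intro: no_Q0_add no_Q0_single)

lemma mono2_mono_map: "z \<in> Cx3 \<Longrightarrow> mono2 d (mono_map M z) = mono2 (subst2 M d) z"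
  by (auto simp: mono2_def mono_map_def subst2_def Cx3_def power_int_mult_distrib power_int_add mult_ac
      simp flip: power_int_mult)

lemma subst2_nonzero:
  assumes "det M = 1" "d \<noteq> 0"
  shows "subst2 M d \<noteq> 0"
proof
  assume "subst2 M d = 0"
  then have *: "fst d * M$1$1 + snd d * M$2$1 = 0" "fst d * M$1$2 + snd d * M$2$2 = 0"
    by (simp_all add: subst2_def zero_prod_def)
  have "fst d * det M = (fst d * M$1$1 + snd d * M$2$1) * M$2$2 - (fst d * M$1$2 + snd d * M$2$2) * M$2$1"
    "snd d * det M = (fst d * M$1$2 + snd d * M$2$2) * M$1$1 - (fst d * M$1$1 + snd d * M$2$1) * M$1$2"
    by (simp_all add: det_2 algebra_simps)
  with * assms show False by (simp add: prod_eq_iff)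
qed

lemma delta_pexp:
  assumes "det M = 1" "no_Q0 \<mu>" "valid ds"
  shows "delta M (pexp \<mu> ds) = pexp (subst_laurent M \<mu>) (map (subst2 M) ds)"
  using assms(2)
proof (induction \<mu> rule: no_Q0_induct)
  have v: "valid (map (subst2 M) ds)" using assms subst2_nonzero by auto
  {
    case zero
    then show ?case using v assms by (simp add: pexp_0 delta_one)
  next
    case (add \<mu> \<nu>)
    then show ?case using v assms by (simp add: pexp_add delta_mult no_Q0_subst_laurent)
  next
    case (single m c)
    show ?case
    proof (cases "c = 0")
      case True
      then show ?thesis using v assms by (simp add: pexp_0 delta_one)
    next
      case False
      let ?m = "(fst m, subst2 M (snd m))"
      have f: "fst ?m \<noteq> 0" using single by simp
      note 1 = pexp_germ[OF assms(3) no_Q0_single[OF single], of c]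
      note 2 = pexp_germ[OF v no_Q0_single[OF f], of c]
      have *: "pexp_factor ds m (mono_map M z) = pexp_factor (map (subst2 M) ds) ?m z" if "z \<in> Cx3" for z
        using mono2_mono_map[OF that] by (simp add: pexp_factor_eq mono3_def comp_def)
          (simp add: mono_map_def case_prod_unfold)
      note d = delta_germ[OF assms(1) 1]
      show ?thesis
        unfolding pexp_def d(1) subst_laurent_single
        by (rule germ_eqI[OF d(2,3) 2 open_dense_Cx3]) (simp add: False *)
    qed
  }
qed

section \<open>Triangle units, the cocycle built from them, and its compatibility with the
  rotation\<close>

section \<open>The factor of a Farey triangle\<close>

definition psmon :: "int \<times> int \<Rightarrow> laurent" where
  "psmon d = lmon 0 (fst d) (snd d)"

lemma psmon_add: "psmon (d + e) = psmon d * psmon e"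
  by (simp add: psmon_def lmon_def mult_single plus_prod_def)

lemma psmon_0: "psmon 0 = 1"
  by (simp add: psmon_def lmon_def flip: zero_prod_def)

lemma psmon_uminus: "psmon d * psmon (- d) = 1"
  by (simp add: psmon_0 flip: psmon_add)

lemma den_psmon: "den (d # ds) = (1 - psmon d) * den ds"
  by (cases d) (simp add: psmon_def)

lemma Q_degree_0_psmon: "Q_degree_0 (psmon d)"
  unfolding psmon_def by (rule Q_degree_0_intros)

lemma no_Q0_Q8: "no_Q0 Q8"
  unfolding Q8_def diff_conv_add_uminus lmon_def by (intro no_Q0_add no_Q0_single) (auto intro: no_Q0_single)

text \<open>With \<open>x\<close>, \<open>y\<close> the monomials of \<open>d\<close>, \<open>e\<close>, the exponent is \<open>x y / ((1 + x) (1 + y) (1 + x y))\<close>, which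
  is invariant under permutations of \<open>x\<close>, \<open>y\<close>, \<open>1 / (x y)\<close> and under inverting all three.\<close>

definition tri :: "int \<times> int \<Rightarrow> int \<times> int \<Rightarrow> germR" where
  "tri d e = pexp_plus Q8 [d, e, - (d + e)]"

definition tri_inv :: "int \<times> int \<Rightarrow> int \<times> int \<Rightarrow> germR" where
  "tri_inv d e = pexp_plus (- Q8) [d, e, - (d + e)]"

lemma pexp_plus3:
  "pexp_plus \<mu> [d, e, f] = pexp (\<mu> * ((1 - psmon d) * ((1 - psmon e) * (1 - psmon f)))) [d + d, e + e, f + f]"
  by (cases d; cases e; cases f) (simp add: pexp_plus_def psmon_def)

definition indep :: "int \<times> int \<Rightarrow> int \<times> int \<Rightarrow> bool" where
  "indep d e \<longleftrightarrow> fst d * snd e - snd d * fst e \<noteq> 0"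

lemma indep_nonzero:
  assumes "indep d e"
  shows "d \<noteq> 0" "e \<noteq> 0" "d + e \<noteq> 0"
  using assms by (auto simp: indep_def prod_eq_iff zero_prod_def add_eq_0_iff)

lemma indep_intros:
  "indep d e \<Longrightarrow> indep e d" "indep d e \<Longrightarrow> indep (- d) (d + e)"
  by (auto simp: indep_def algebra_simps)

lemma double_nonzero: "(d :: int \<times> int) \<noteq> 0 \<Longrightarrow> d + d \<noteq> 0"
  by (auto simp: prod_eq_iff zero_prod_def)

lemma valid_tri: "indep d e \<Longrightarrow> valid [d + d, e + e, - (d + e) + - (d + e)]"
  using indep_nonzero[of d e, THEN double_nonzero] double_nonzero[of "- (d + e)"] indep_nonzero(3)[of d e]
  by (simp del: minus_add_distrib)

lemma no_Q0_tri: "no_Q0 \<mu> \<Longrightarrow> no_Q0 (\<mu> * ((1 - psmon d) * ((1 - psmon e) * (1 - psmon f))))"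
  by (intro no_Q0_mult Q_degree_0_intros Q_degree_0_psmon)

lemma tri_commute: "indep d e \<Longrightarrow> tri d e = tri e d"
  unfolding tri_def pexp_plus3
  using valid_tri[of d e] valid_tri[of e d]
  by (intro pexp_eqI no_Q0_tri no_Q0_Q8) (auto simp: indep_intros den_psmon mult_ac add.commute)

text \<open>The triple of the right side is -d, d + e, -e, the negative of d, -(d + e), e. The
  identity behind it is (1 + x)(1 + y)(1 + 1/(xy)) = (1 + 1/x)(1 + 1/y)(1 + xy).\<close>

lemma tri_rotate:
  assumes "indep d e"
  shows "tri d e = tri (- d) (d + e)"
proof -
  define x where "x = psmon d"
  define x' where "x' = psmon (- d)"
  define y where "y = psmon e"
  define y' where "y' = psmon (- e)"
  note xy = x_def x'_def y_def y'_def
  have u: "x * x' = 1" "y * y' = 1" by (simp_all add: xy psmon_uminus)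
  have Xs: "psmon (d + e) = x * y" "psmon (- (d + e)) = x' * y'" "psmon (- (- d + (d + e))) = y'" "psmon d = x" "psmon e = y" "psmon (- d) = x'"
    by (simp_all only: psmon_add minus_add_distrib xy minus_add_cancel)
  have 1: "(1 + x) * (1 + y) * (1 + x' * y') = (1 + x') * (1 + y') * (1 + x * y)"
  proof -
    have "(1 + x) * (1 + y) * (1 + x' * y') = (1 + x) * (1 + y) + (x' + x * x') * (y' + y * y')"
      by (simp add: algebra_simps)
    moreover have "(1 + x') * (1 + y') * (1 + x * y) = (1 + x') * (1 + y') + (x + x * x') * (y + y * y')"
      by (simp add: algebra_simps)
    ultimately show ?thesis
      unfolding u by (simp only: add_ac)
  qed
  \<comment> \<open>Denominators have the form 1 - t^2. Splitting each one gives a factor 1 - t,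
    which matches the numerators, and a factor 1 + t, which enters the symmetric product
    above.\<close>
  have sq: "1 - t * t = (1 - t) * (1 + t)" for t :: laurent
    by (simp add: algebra_simps)
  have "Q8 * ((1 - x) * ((1 - y) * (1 - x' * y'))) * ((1 - x' * x') * ((1 - x * y * (x * y)) * (1 - y' * y')))
      = Q8 * (1 - x) * (1 - y) * (1 - x' * y') * (1 - x') * (1 - y') * (1 - x * y) * ((1 + x') * (1 + y') * (1 + x * y))"
    unfolding sq by (simp only: mult_ac)
  also have "\<dots> = Q8 * ((1 - x') * ((1 - x * y) * (1 - y'))) * ((1 - x * x) * ((1 - y * y) * (1 - x' * y' * (x' * y'))))"
    unfolding 1[symmetric] sq by (simp only: mult_ac)
  finally have "Q8 * ((1 - psmon d) * ((1 - psmon e) * (1 - psmon (- (d + e))))) * den [- d + - d, d + e + (d + e), - (- d + (d + e)) + - (- d + (d + e))]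
      = Q8 * ((1 - psmon (- d)) * ((1 - psmon (d + e)) * (1 - psmon (- (- d + (d + e)))))) * den [d + d, e + e, - (d + e) + - (d + e)]"
    unfolding den_psmon den_simps(1) mult_1_right psmon_add[of "- d" "- d"] psmon_add[of d d] psmon_add[of e e]
      psmon_add[of "d + e" "d + e"] psmon_add[of "- (d + e)"] psmon_add[of "- (- d + (d + e))"] Xs by simp
  then show ?thesis
    unfolding tri_def pexp_plus3
    using valid_tri[OF assms] valid_tri[OF indep_intros(2)[OF assms]]
    by (intro pexp_eqI no_Q0_tri no_Q0_Q8)
qed

text \<open>\<open>tri_rotate\<close> negates the triple while rearranging it. Three applications,
  with swaps in between, negate it once in total and bring the first two entries back.\<close>

lemma tri_minus:
  assumes "indep d e"
  shows "tri (- d) (- e) = tri d e"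
proof -
  note i = indep_intros
  have "tri d e = tri (- d) (d + e)" by (rule tri_rotate[OF assms])
  also have "\<dots> = tri (d + e) (- d)" by (rule tri_commute[OF i(2)[OF assms]])
  also have "\<dots> = tri (- (d + e)) e" using tri_rotate[OF i(1)[OF i(2)[OF assms]]] by simp
  also have "\<dots> = tri e (- (d + e))" using i(2)[OF i(1)[OF i(2)[OF assms]]] by (intro tri_commute) simp
  also have "\<dots> = tri (- e) (- d)"
    using tri_rotate[of e "- (d + e)"] i(1)[OF i(2)[OF i(1)[OF i(2)[OF assms]]]] by simp
  also have "\<dots> = tri (- d) (- e)"
    using assms by (intro tri_commute) (simp add: indep_def algebra_simps)
  finally show ?thesis ..
qed

lemma tri_inverse: "indep d e \<Longrightarrow> tri d e * tri_inv d e = 1"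
  unfolding tri_def tri_inv_def pexp_plus3 mult_minus_left
  using valid_tri[of d e] by (intro pexp_uminus no_Q0_tri no_Q0_Q8)

lemma subst2_add: "subst2 M (d + e) = subst2 M d + subst2 M e"
  by (simp add: subst2_def algebra_simps)

lemma subst2_uminus: "subst2 M (- d) = - subst2 M d"
  by (simp add: subst2_def)

lemma subst_laurent_psmon: "subst_laurent M (psmon d) = psmon (subst2 M d)"
  by (simp add: psmon_def)

lemma subst_laurent_one: "subst_laurent M 1 = 1"
  using subst_laurent_psmon[of M 0] by (simp add: psmon_0 subst2_def zero_prod_def[symmetric])

lemma subst_laurent_Q8: "subst_laurent M Q8 = Q8"
  by (simp add: Q8_def subst2_def)

lemma delta_tri:
  assumes "det M = 1" "indep d e"
  shows "delta M (tri d e) = tri (subst2 M d) (subst2 M e)"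
  unfolding tri_def pexp_plus3 delta_pexp[OF assms(1) no_Q0_tri[OF no_Q0_Q8] valid_tri[OF assms(2)]]
  by (simp only: subst_laurent_mult subst_laurent_diff subst_laurent_psmon subst_laurent_one subst_laurent_Q8
      list.map subst2_add subst2_uminus)

section \<open>Units\<close>

text \<open>\<open>germR\<close> is not a domain: an open dense set may be disconnected, and a
  function that is 1 on some components and 0 on the others is a zero divisor. Invertibility
  therefore has to be carried along explicitly.\<close>

definition unit :: "germR \<Rightarrow> bool" where
  "unit x \<longleftrightarrow> x * unit_inv x = 1"

lemma unitI: "x * y = 1 \<Longrightarrow> unit x"
  using unit_inv_eqI[of x y] by (simp add: unit_def)

lemma unit_one [simp]: "unit 1" "unit_inv 1 = 1"
  by (auto intro: unitI unit_inv_eqI)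

lemma unit_mult:
  assumes "unit x" "unit y"
  shows "unit (x * y)" "unit_inv (x * y) = unit_inv x * unit_inv y"
proof -
  have "(x * y) * (unit_inv x * unit_inv y) = (x * unit_inv x) * (y * unit_inv y)" by (simp add: mult_ac)
  also have "\<dots> = 1" using assms by (simp add: unit_def)
  finally have "(x * y) * (unit_inv x * unit_inv y) = 1" .
  then show "unit (x * y)" "unit_inv (x * y) = unit_inv x * unit_inv y"
    by (auto intro: unitI unit_inv_eqI)
qed

lemma unit_unit_inv:
  assumes "unit x"
  shows "unit (unit_inv x)" "unit_inv (unit_inv x) = x"
proof -
  have "unit_inv x * x = 1" using assms by (simp add: unit_def mult.commute)
  then show "unit (unit_inv x)" "unit_inv (unit_inv x) = x" by (auto intro: unitI unit_inv_eqI)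
qed

lemma delta_unit:
  assumes "det M = 1" "unit x"
  shows "unit (delta M x)" "unit_inv (delta M x) = delta M (unit_inv x)"
proof -
  have "delta M x * delta M (unit_inv x) = 1"
    using assms by (simp add: unit_def delta_one flip: delta_mult)
  then show "unit (delta M x)" "unit_inv (delta M x) = delta M (unit_inv x)"
    by (auto intro: unitI unit_inv_eqI)
qed

lemma unit_tri: "indep d e \<Longrightarrow> unit (tri d e)" "indep d e \<Longrightarrow> unit_inv (tri d e) = tri_inv d e"
  by (auto intro: unitI unit_inv_eqI tri_inverse)

section \<open>The cocycle\<close>

text \<open>The row \<open>(i, j)\<close> of a matrix stands for the monomial \<open>p\<^sup>i s\<^sup>-\<^sup>j\<close>.\<close>

definition erow :: "int^2^2 \<Rightarrow> 2 \<Rightarrow> int \<times> int" where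
  "erow M k = (M$k$1, - (M$k$2))"

text \<open>The value at the letter b^-1 is forced by cancellation: it is the inverse of the value
  at b in the frame reached after b^-1, whose second row is the difference of the rows. The letters
  a^{+1}, a^{-1} contribute nothing, in accordance with the invariance of the A matrices under left
  multiplication by a.\<close>

fun letter_factor :: "letter \<Rightarrow> int^2^2 \<Rightarrow> germR" where
  "letter_factor Lb M = tri (erow M 1) (erow M 2)"
| "letter_factor Lb_inv M = unit_inv (tri (erow M 1) (erow M 2 - erow M 1))"
| "letter_factor La M = 1"
| "letter_factor La_inv M = 1"

definition phiw :: "letter list \<Rightarrow> int^2^2" where
  "phiw w = foldr (\<lambda>x M. phi_letter x ** M) w (mat 1)"

lemma phiw_simps [simp]: "phiw [] = mat 1" "phiw (x # w) = phi_letter x ** phiw w"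
  by (simp_all add: phiw_def)

lemma phi_eq_phiw: "phi g = phiw (word_of g)"
  by (simp add: phi_def phiw_def)

lemma det_phi_letter: "det (phi_letter x) = 1"
  by (cases x) (simp_all add: mat2_def det_2)

lemma det_phiw: "det (phiw w) = 1"
  by (induction w) (simp_all add: det_mul det_phi_letter)

lemma det_phi: "det (phi g) = 1"
  by (simp add: phi_eq_phiw det_phiw)

lemma indep_rows:
  assumes "det M = 1"
  shows "indep (erow M 1) (erow M 2)" "indep (erow M 1) (erow M 2 - erow M 1)" "indep (- erow M 1) (erow M 2)"
  using assms by (simp_all add: indep_def erow_def det_2 algebra_simps)

lemma rows_phi_letter:
  "erow (phi_letter La ** M) 1 = erow M 1 - erow M 2" "erow (phi_letter La ** M) 2 = erow M 2"
  "erow (phi_letter La_inv ** M) 1 = erow M 1 + erow M 2" "erow (phi_letter La_inv ** M) 2 = erow M 2"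
  "erow (phi_letter Lb ** M) 1 = erow M 1" "erow (phi_letter Lb ** M) 2 = erow M 1 + erow M 2"
  "erow (phi_letter Lb_inv ** M) 1 = erow M 1" "erow (phi_letter Lb_inv ** M) 2 = erow M 2 - erow M 1"
  by (simp_all add: erow_def mat2_def matrix_matrix_mult_def sum_2)

lemma unit_letter_factor: "det M = 1 \<Longrightarrow> unit (letter_factor x M)"
  by (cases x) (auto simp: indep_rows unit_tri(1) intro: unit_unit_inv)

lemma letter_factor_cancel:
  assumes "det M = 1"
  shows "letter_factor x (phi_letter (letter_inv x) ** M) * letter_factor (letter_inv x) M = 1"
  using unit_tri(1)[OF indep_rows(1)[OF assms]] unit_tri(1)[OF indep_rows(2)[OF assms]]
  by (cases x) (simp_all add: rows_phi_letter unit_def mult.commute del: phi_letter.simps)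

fun word_factor :: "letter list \<Rightarrow> int^2^2 \<Rightarrow> germR" where
  "word_factor [] M = 1"
| "word_factor (x # w) M = letter_factor x (phiw w ** M) * word_factor w M"

text \<open>A cancelling pair of letters contributes 1, so the factor of a word depends only on the
  element of the free group that it represents.\<close>

lemma word_factor_cons_red:
  assumes "det M = 1"
  shows "word_factor (cons_red x w) M = word_factor (x # w) M"
proof (cases w)
  case (Cons y v)
  show ?thesis
  proof (cases "y = letter_inv x")
    case True
    have "det (phiw v ** M) = 1" using assms by (simp add: det_mul det_phiw)
    from letter_factor_cancel[OF this, of x] show ?thesis
      using True Cons by (simp add: matrix_mul_assoc flip: mult.assoc)
  qed (simp add: Cons)
qed simp

lemma phiw_cons_red: "phiw (cons_red x w) = phiw (x # w)"
  using phi_letter_inv by (cases w) (auto simp: matrix_mul_assoc)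

lemma phiw_reduce: "phiw (reduce w) = phiw w"
  by (induction w) (simp_all add: reduce_def phiw_cons_red)

lemma phiw_append: "phiw (u @ v) = phiw u ** phiw v"
  by (induction u) (simp_all add: matrix_mul_assoc)

lemma word_factor_reduce: "det M = 1 \<Longrightarrow> word_factor (reduce w) M = word_factor w M"
proof (induction w)
  case (Cons x w)
  have "phiw (foldr cons_red w []) = phiw w" using phiw_reduce[of w] by (simp add: reduce_def)
  with Cons show ?case by (simp add: reduce_def word_factor_cons_red)
qed (simp add: reduce_def)

lemma word_factor_append: "word_factor (u @ v) M = word_factor u (phiw v ** M) * word_factor v M"
  by (induction u) (simp_all add: phiw_append matrix_mul_assoc mult.assoc)

text \<open>The matrix \<open>M\<close> is a base frame: \<open>cocycle g M\<close> is the unit of \<open>g\<close> with the monomials of the rows of \<open>M\<close>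
  in place of \<open>p\<close> and \<open>1/s\<close>.\<close>

definition cocycle :: "free2 \<Rightarrow> int^2^2 \<Rightarrow> germR" where
  "cocycle g M = word_factor (word_of g) M"

lemma cocycle_mult: "det M = 1 \<Longrightarrow> cocycle (g * h) M = cocycle g (phi h ** M) * cocycle h M"
  by (simp add: cocycle_def times_free2.rep_eq word_factor_reduce word_factor_append phi_eq_phiw)

lemma cocycle_one: "cocycle 1 M = 1"
  by (simp add: cocycle_def one_free2.rep_eq)

lemma inverse_gens: "word_of (inverse fa) = [La_inv]" "word_of (inverse fb) = [Lb_inv]"
  by (simp_all add: inverse_free2.rep_eq fa.rep_eq fb.rep_eq reduce_def)

lemma cocycle_gens:
  "cocycle fa M = 1" "cocycle (inverse fa) M = 1"
  "cocycle fb M = tri (erow M 1) (erow M 2)"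
  "cocycle (inverse fb) M = unit_inv (tri (erow M 1) (erow M 2 - erow M 1))"
  by (simp_all add: cocycle_def inverse_gens fa.rep_eq fb.rep_eq matrix_mul_lid)

lemma phi_inverse_gens: "phi (inverse fa) = mat2 1 1 0 1" "phi (inverse fb) = mat2 1 0 (- 1) 1"
  by (simp_all add: phi_eq_phiw inverse_gens matrix_mul_rid)

lemma phi_gens_letter:
  "phi fa = phi_letter La" "phi (inverse fa) = phi_letter La_inv"
  "phi fb = phi_letter Lb" "phi (inverse fb) = phi_letter Lb_inv"
  by (simp_all add: phi_gens phi_inverse_gens)

lemma unit_word_factor: "det M = 1 \<Longrightarrow> unit (word_factor w M)"
  by (induction w) (auto intro!: unit_mult unit_letter_factor simp: det_mul det_phiw)

lemma unit_cocycle: "det M = 1 \<Longrightarrow> unit (cocycle g M)"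
  by (simp add: cocycle_def unit_word_factor)

text \<open>Conjugation by \<open>diag(1, -1)\<close>, which accounts for the sign in \<^const>\<open>erow\<close>.\<close>

definition flip2 :: "int^2^2 \<Rightarrow> int^2^2" where
  "flip2 M = mat2 (M$1$1) (- (M$1$2)) (- (M$2$1)) (M$2$2)"

lemma subst2_erow: "subst2 N (erow M k) = erow (M ** flip2 N) k"
  by (simp add: subst2_def erow_def flip2_def mat2_def matrix_matrix_mult_def sum_2 algebra_simps)

lemma subst2_diff: "subst2 M (d - e) = subst2 M d - subst2 M e"
  using subst2_add[of M d "- e"] by (simp add: subst2_uminus)

lemma delta_letter_factor:
  assumes "det N = 1" "det M = 1"
  shows "delta N (letter_factor x M) = letter_factor x (M ** flip2 N)"
  using assms unit_tri(1)[OF indep_rows(2)[OF assms(2)]]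
  by (cases x) (simp_all add: delta_tri indep_rows subst2_erow subst2_diff delta_one flip: delta_unit(2))

text \<open>Letters act on the frame from the left and substitutions from the right, so the two
  actions commute.\<close>

lemma delta_cocycle:
  assumes "det N = 1" "det M = 1"
  shows "delta N (cocycle g M) = cocycle g (M ** flip2 N)"
proof -
  have "delta N (word_factor w M) = word_factor w (M ** flip2 N)" for w
    using assms
    by (induction w) (simp_all add: delta_one delta_mult delta_letter_factor det_mul det_phiw matrix_mul_assoc)
  then show ?thesis by (simp add: cocycle_def)
qed

lemma erow_uminus: "erow (- M) k = - erow M k"
  by (simp add: erow_def)

lemma matrix_mul_uminus: "M ** (- N) = - (M ** N)" for M N :: "int^2^2"
  by (simp add: vec_eq_iff matrix_matrix_mult_def sum_negf)

lemma letter_factor_uminus: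
  assumes "det M = 1"
  shows "letter_factor x (- M) = letter_factor x M"
  using tri_minus[OF indep_rows(1)[OF assms]] tri_minus[OF indep_rows(2)[OF assms]]
  by (cases x) (simp_all add: erow_uminus)

text \<open>A triangle unit ignores a simultaneous change of sign of its edges, so the cocycle sees
  a frame only modulo sign, as an element of PSL(2, Z).\<close>

lemma cocycle_uminus:
  assumes "det M = 1"
  shows "cocycle g (- M) = cocycle g M"
proof -
  have "word_factor w (- M) = word_factor w M" for w
    using assms by (induction w) (simp_all add: matrix_mul_uminus letter_factor_uminus det_mul det_phiw)
  then show ?thesis by (simp add: cocycle_def)
qed

abbreviation rot :: "int^2^2" where "rot \<equiv> mat2 0 1 (- 1) 0"

lemma det_rot: "det rot = 1"
  by (simp add: mat2_def det_2)

text \<open>Conjugation by the rotation exchanges \<phi>(a) and \<phi>(b), and hence realises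
  \<sigma> on matrices.\<close>

lemma phi_sigma: "phi (sigma g) ** rot = rot ** phi g"
proof -
  have *: "phi_letter (letter_swap x) ** rot = rot ** phi_letter x" for x
    by (cases x) (simp_all add: vec_eq_iff forall_2 matrix_matrix_mult_def sum_2 mat2_def)
  have "phiw (map letter_swap w) ** rot = rot ** phiw w" for w
  proof (induction w)
    case (Cons x w)
    have "phiw (map letter_swap (x # w)) ** rot = phi_letter (letter_swap x) ** (phiw (map letter_swap w) ** rot)"
      by (simp add: matrix_mul_assoc)
    also have "\<dots> = (phi_letter (letter_swap x) ** rot) ** phiw w" by (simp add: Cons matrix_mul_assoc)
    finally show ?case by (simp add: * matrix_mul_assoc)
  qed (simp add: matrix_mul_lid matrix_mul_rid)
  then show ?thesis by (simp add: phi_eq_phiw sigma.rep_eq)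
qed

lemma phi_braid: "phi (fa * fb * fa) = - rot" "phi (inverse fa * inverse fb * inverse fa) = rot"
  "phi (fb * fa * fb) = - rot" "phi (inverse fb * inverse fa * inverse fb) = rot"
  by (simp_all add: phi_mult phi_gens phi_inverse_gens vec_eq_iff forall_2 matrix_matrix_mult_def sum_2 mat2_def)

lemma rot_rot: "rot ** (rot ** M) = - M"
  by (simp add: vec_eq_iff forall_2 matrix_matrix_mult_def sum_2 mat2_def)

lemma rows_rot: "erow (rot ** M) 1 = erow M 2" "erow (rot ** M) 2 = - erow M 1"
  by (simp_all add: erow_def mat2_def matrix_matrix_mult_def sum_2)

text \<open>With v, w the rows of M, only the letter b contributes on the left, in the frame with
  rows v - w and w. Its triple v - w, w, -v is a permutation of the triple w, -v, v - w on the
  right.\<close>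

lemma cocycle_braid:
  assumes "det M = 1"
  shows "cocycle (fa * fb * fa) M = cocycle fb (rot ** M)"
proof -
  let ?v = "erow M 1" and ?w = "erow M 2"
  have "cocycle (fa * fb * fa) M = tri (?v - ?w) ?w"
    using assms by (simp add: cocycle_mult cocycle_gens phi_gens_letter rows_phi_letter det_phi det_mul det_phi_letter del: phi_letter.simps)
  also have "\<dots> = tri ?w (?v - ?w)"
    using assms by (intro tri_commute) (simp add: indep_def erow_def det_2 algebra_simps)
  also have "\<dots> = tri (- ?w) ?v"
    using assms by (subst tri_rotate) (simp_all add: indep_def erow_def det_2 algebra_simps)
  also have "\<dots> = tri ?w (- ?v)"
    using assms tri_minus[of "- ?w" ?v] by (simp add: indep_def erow_def det_2 algebra_simps)
  finally show ?thesis by (simp add: cocycle_gens rows_rot)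
qed

text \<open>Both sides are inverses of triangle units. Their triples are v + w, -v, -w and w, -v -
  w, v, which are opposite to each other up to order.\<close>

lemma cocycle_braid_inverse:
  assumes "det M = 1"
  shows "cocycle (inverse fa * inverse fb * inverse fa) M = cocycle (inverse fb) (rot ** M)"
proof -
  let ?v = "erow M 1" and ?w = "erow M 2"
  have "cocycle (inverse fa * inverse fb * inverse fa) M = unit_inv (tri (?v + ?w) (- ?v))"
    using assms by (simp add: cocycle_mult cocycle_gens phi_gens_letter rows_phi_letter det_phi det_mul det_phi_letter del: phi_letter.simps)
  also have "tri (?v + ?w) (- ?v) = tri (- ?v) (?v + ?w)"
    using assms by (intro tri_commute) (simp add: indep_def erow_def det_2 algebra_simps)
  also have "\<dots> = tri ?v ?w"
    using assms tri_rotate[of ?v ?w] by (simp add: indep_def erow_def det_2 algebra_simps)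
  also have "\<dots> = tri ?w ?v"
    using assms by (intro tri_commute) (simp add: indep_def erow_def det_2 algebra_simps)
  also have "\<dots> = tri (- ?w) (- ?v)"
    using assms tri_minus[of ?w ?v] by (simp add: indep_def erow_def det_2 algebra_simps)
  also have "\<dots> = tri ?w (- ?v - ?w)"
    using assms tri_rotate[of "- ?w" "- ?v"] by (simp add: indep_def erow_def det_2 algebra_simps)
  finally show ?thesis by (simp add: cocycle_gens rows_rot)
qed

section \<open>Relations between the special plethystic exponents\<close>

abbreviation shear :: "int^2^2" where "shear \<equiv> mat2 1 1 0 1"

lemma det_shear: "det shear = 1"
  by (simp add: mat2_def det_2)

lemma subst2_concrete: "subst2 shear d = (fst d, fst d + snd d)" "subst2 rot d = (- snd d, fst d)"
  by (simp_all add: subst2_def mat2_def)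

lemma lmon_mult: "lmon i j k * lmon i' j' k' = lmon (i + i') (j + j') (k + k')"
  "lmon i j k * (lmon i' j' k' * \<mu>) = lmon (i + i') (j + j') (k + k') * \<mu>"
  by (simp_all add: lmon_def mult_single flip: mult.assoc)

lemma lmon_0: "lmon 0 0 0 = 1"
  by (simp add: lmon_def flip: zero_prod_def)

lemma subst_laurent_two: "subst_laurent M 2 = 2"
  using subst_laurent_add[of M 1 1] by (simp add: subst_laurent_one)

lemma Q_degree_0_two: "Q_degree_0 2"
  using Q_degree_0_intros(4)[OF Q_degree_0_intros(2) Q_degree_0_intros(2)] by simp

lemma no_Q0_Q8_mult: "Q_degree_0 \<mu> \<Longrightarrow> no_Q0 (Q8 * \<mu>)"
  by (intro no_Q0_mult no_Q0_Q8)

lemma pexp_Q8_mult: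
  assumes "Q_degree_0 \<mu>" "Q_degree_0 \<nu>" "Q_degree_0 \<rho>" "valid ds" "valid es" "valid fs"
    and "(\<mu> * den es + \<nu> * den ds) * den fs = \<rho> * (den ds * den es)"
  shows "pexp (Q8 * \<mu>) ds * pexp (Q8 * \<nu>) es = pexp (Q8 * \<rho>) fs"
proof -
  have "pexp (Q8 * \<mu>) ds * pexp (Q8 * \<nu>) es = pexp (Q8 * \<mu> * den es + Q8 * \<nu> * den ds) (ds @ es)"
    using assms by (intro pexp_mult no_Q0_Q8_mult)
  also have "\<dots> = pexp (Q8 * \<rho>) fs"
  proof (rule pexp_eqI)
    have "(Q8 * \<mu> * den es + Q8 * \<nu> * den ds) * den fs = Q8 * ((\<mu> * den es + \<nu> * den ds) * den fs)"
      by (simp add: algebra_simps)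
    then show "(Q8 * \<mu> * den es + Q8 * \<nu> * den ds) * den fs = Q8 * \<rho> * den (ds @ es)"
      by (simp add: assms(7) mult.assoc)
    show "no_Q0 (Q8 * \<mu> * den es + Q8 * \<nu> * den ds)"
      using assms by (intro no_Q0_add no_Q0_mult no_Q0_Q8 Q_degree_0_den)
    show "valid (ds @ es)" using assms(4,5) by auto
  qed (use assms in \<open>auto intro: no_Q0_Q8_mult\<close>)
  finally show ?thesis .
qed

text \<open>The numerators of \<alpha>, \<beta>, \<gamma> after the substitution p -> p s, which is
  how D_B enters the product D_A D_B D_A. It turns their denominator into (1 - s^2)(1 - p^2), the
  one of e.\<close>

definition num_alpha :: laurent where "num_alpha = - (lmon 0 1 0 * (lmon 0 0 2 + 2 * lmon 0 1 2 + lmon 0 1 1))"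
definition num_beta :: laurent where "num_beta = - (lmon 0 1 0 * (lmon 0 0 1 + 2 * lmon 0 1 2 + lmon 0 1 1))"
definition num_gamma :: laurent where "num_gamma = - (lmon 0 1 1 * (lmon 0 0 1 + 2 * lmon 0 1 1 + 1))"
definition num_e :: laurent where "num_e = lmon 0 1 1 * (1 - lmon 0 1 0)"

lemmas Q_degree_0s = Q_degree_0_intros Q_degree_0_two

lemma Q_degree_0_nums: "Q_degree_0 num_alpha" "Q_degree_0 num_beta" "Q_degree_0 num_gamma" "Q_degree_0 num_e"
  unfolding num_alpha_def num_beta_def num_gamma_def num_e_def by (intro Q_degree_0s)+

lemma sheared_germs:
  "delta shear alpha = pexp (Q8 * num_alpha) [(0, 2), (2, 0)]"
  "delta shear beta = pexp (Q8 * num_beta) [(0, 2), (2, 0)]"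
  "delta shear gamma = pexp (Q8 * num_gamma) [(0, 2), (2, 0)]"
proof -
  have *: "delta shear (pexp (- Q8 * \<mu> * \<nu>) [(0, 2), (2, - 2)])
      = pexp (Q8 * (- (subst_laurent shear \<mu> * subst_laurent shear \<nu>))) [(0, 2), (2, 0)]"
    if "Q_degree_0 \<mu>" "Q_degree_0 \<nu>" for \<mu> \<nu>
  proof -
    have "no_Q0 (- Q8 * \<mu> * \<nu>)" using that by (intro no_Q0_mult) (simp_all add: no_Q0_Q8)
    moreover have "valid [(0, 2), (2, - 2)]" by (simp add: zero_prod_def)
    ultimately show ?thesis
      by (simp add: delta_pexp[OF det_shear] subst_laurent_Q8 subst2_concrete mult.assoc)
  qed
  note defs = alpha_def beta_def gamma_def num_alpha_def num_beta_def num_gamma_def subst2_concrete subst_laurent_two subst_laurent_one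
  show "delta shear alpha = pexp (Q8 * num_alpha) [(0, 2), (2, 0)]"
    unfolding alpha_def by (subst *) (intro Q_degree_0s, intro Q_degree_0s, simp add: defs)
  show "delta shear beta = pexp (Q8 * num_beta) [(0, 2), (2, 0)]"
    unfolding beta_def by (subst *) (intro Q_degree_0s, intro Q_degree_0s, simp add: defs)
  show "delta shear gamma = pexp (Q8 * num_gamma) [(0, 2), (2, 0)]"
    unfolding gamma_def by (subst *) (intro Q_degree_0s, intro Q_degree_0s, simp add: defs)
qed

lemma e_germ_eq: "e_germ = pexp (Q8 * num_e) [(0, 2), (2, 0)]"
  by (simp add: e_germ_def num_e_def mult.assoc)

lemma delta_e_germ:
  "delta rot e_germ = pexp (Q8 * (lmon 0 (- 1) 1 * (1 - lmon 0 0 1))) [(- 2, 0), (0, 2)]"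
  "delta shear e_germ = pexp (Q8 * (lmon 0 1 2 * (1 - lmon 0 1 1))) [(0, 2), (2, 2)]"
  unfolding e_germ_eq using delta_pexp[OF det_rot no_Q0_Q8_mult[OF Q_degree_0_nums(4)], of "[(0, 2), (2, 0)]"]
    delta_pexp[OF det_shear no_Q0_Q8_mult[OF Q_degree_0_nums(4)], of "[(0, 2), (2, 0)]"]
  by (simp_all add: num_e_def subst_laurent_one subst_laurent_Q8 subst2_concrete zero_prod_def)

text \<open>All three exponents share one denominator and their numerators add up. This is what
  makes conjugation by S carry the B matrices back to the A matrices.\<close>

lemma e_gamma: "e_germ * delta shear gamma = delta shear alpha"
  unfolding e_germ_eq sheared_germs
proof (rule pexp_Q8_mult)
  have "num_e + num_gamma = num_alpha"
    by (simp add: num_alpha_def num_gamma_def num_e_def lmon_mult algebra_simps)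
  then show "(num_e * den [(0, 2), (2, 0)] + num_gamma * den [(0, 2), (2, 0)]) * den [(0, 2), (2, 0)]
      = num_alpha * (den [(0, 2), (2, 0)] * den [(0, 2), (2, 0)])"
    by (simp only: mult.assoc flip: distrib_right)
qed (simp_all add: Q_degree_0_nums zero_prod_def)

text \<open>The rotated e is the quotient of the sheared \<beta> and \<alpha>; this identifies the
  S-conjugates of the A matrices with the matrices of units E_g.\<close>

lemma e_alpha: "delta rot e_germ * delta shear alpha = delta shear beta"
  unfolding delta_e_germ sheared_germs
proof (rule pexp_Q8_mult)
  let ?d = "[(0, 2), (2, 0)]" and ?d' = "[(- 2, 0), (0, 2)]" and ?n = "lmon 0 (- 1) 1 * (1 - lmon 0 0 1)"
  have "?n * den ?d + num_alpha * den ?d' = num_beta * den ?d'"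
    by (simp add: num_alpha_def num_beta_def lmon_mult lmon_0 algebra_simps)
  then have "(?n * den ?d + num_alpha * den ?d') * den ?d = num_beta * den ?d' * den ?d" by (simp only:)
  then show "(?n * den ?d + num_alpha * den ?d') * den ?d = num_beta * (den ?d' * den ?d)"
    by (simp only: mult.assoc)
qed (auto simp: Q_degree_0_nums zero_prod_def intro!: Q_degree_0s)

text \<open>The change of e under p -> p s is a triangle unit. It compensates the change of frame of
  the cocycle in \<open>delta_shear_factor_B\<close>.\<close>

lemma e_tri: "delta shear e_germ * tri (erow rot 1) (erow rot 2) = e_germ"
proof -
  have r: "erow rot 1 = (0, - 1)" "erow rot 2 = (- 1, 0)" by (simp_all add: erow_def mat2_def)
  show ?thesis
    unfolding delta_e_germ unfolding e_germ_eq tri_def pexp_plus3 r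
  proof (rule pexp_Q8_mult)
    have "(lmon 0 1 2 * (1 - lmon 0 1 1) * den [(0, - 2), (- 2, 0), (2, 2)]
      + ((1 - lmon 0 0 (- 1)) * ((1 - lmon 0 (- 1) 0) * (1 - lmon 0 1 1))) * den [(0, 2), (2, 2)]) * den [(0, 2), (2, 0)]
      = num_e * (den [(0, 2), (2, 2)] * den [(0, - 2), (- 2, 0), (2, 2)])"
      by (simp add: num_e_def lmon_mult lmon_0 algebra_simps)
    then show "(lmon 0 1 2 * (1 - lmon 0 1 1) * den [(0, - 1) + (0, - 1), (- 1, 0) + (- 1, 0), - ((0, - 1) + (- 1, 0)) + - ((0, - 1) + (- 1, 0))]
      + ((1 - psmon (0, - 1)) * ((1 - psmon (- 1, 0)) * (1 - psmon (- ((0, - 1) + (- 1, 0)))))) * den [(0, 2), (2, 2)]) * den [(0, 2), (2, 0)]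
      = num_e * (den [(0, 2), (2, 2)] * den [(0, - 1) + (0, - 1), (- 1, 0) + (- 1, 0), - ((0, - 1) + (- 1, 0)) + - ((0, - 1) + (- 1, 0))])"
      by (simp add: psmon_def)
  qed (auto simp: Q_degree_0_nums zero_prod_def intro!: Q_degree_0s Q_degree_0_psmon)
qed

lemma unit_e_germ: "unit e_germ"
  unfolding e_germ_eq using pexp_uminus[OF _ no_Q0_Q8_mult[OF Q_degree_0_nums(4)], of "[(0, 2), (2, 0)]"]
  by (intro unitI) (auto simp: zero_prod_def)

lemma unit_sheared: "unit (delta shear alpha)" "unit (delta shear beta)" "unit (delta shear gamma)"
  unfolding sheared_germs
  using pexp_uminus[OF _ no_Q0_Q8_mult[OF Q_degree_0_nums(1)], of "[(0, 2), (2, 0)]"]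
    pexp_uminus[OF _ no_Q0_Q8_mult[OF Q_degree_0_nums(2)], of "[(0, 2), (2, 0)]"]
    pexp_uminus[OF _ no_Q0_Q8_mult[OF Q_degree_0_nums(3)], of "[(0, 2), (2, 0)]"]
  by (auto simp: zero_prod_def intro: unitI)

section \<open>The recursion determines the family of A matrices\<close>

section \<open>Reduced words\<close>

definition of_word :: "letter list \<Rightarrow> free2" where
  "of_word w = Free2 (reduce w)"

lemma word_of_of_word: "word_of (of_word w) = reduce w"
  by (simp add: of_word_def Free2_inverse)

lemma of_word_word_of: "of_word (word_of g) = g"
  using word_of[of g] by (simp add: of_word_def reduce_reduced word_of_inverse)

lemma of_word_append: "of_word (u @ v) = of_word u * of_word v"
  by (simp add: word_of_inject[symmetric] times_free2.rep_eq word_of_of_word reduce_append_left reduce_append_right)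

lemma of_word_Nil: "of_word [] = 1"
  by (simp add: word_of_inject[symmetric] one_free2.rep_eq word_of_of_word reduce_reduced)

lemma of_word_single:
  "of_word [La] = fa" "of_word [La_inv] = inverse fa" "of_word [Lb] = fb" "of_word [Lb_inv] = inverse fb"
  by (simp_all add: word_of_inject[symmetric] word_of_of_word reduce_reduced inverse_gens fa.rep_eq fb.rep_eq)

lemma of_word_Cons: "of_word (x # w) = of_word [x] * of_word w"
  using of_word_append[of "[x]" w] by simp

lemma of_word_replicate: "of_word (replicate n x) = of_word [x] ^ n"
proof (induction n)
  case (Suc n)
  then show ?case using of_word_Cons[of x "replicate n x"] by simp
qed (simp add: of_word_Nil)

definition b_initial :: "letter list \<Rightarrow> bool" where
  "b_initial w \<longleftrightarrow> w = [] \<or> hd w \<in> {Lb, Lb_inv}"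

lemma a_powi_eq_of_word:
  "fa powi k = of_word (replicate (nat \<bar>k\<bar>) (if k \<ge> 0 then La else La_inv))"
  by (auto simp: power_int_def of_word_replicate of_word_single)

lemma split_a_power:
  assumes "reduced w"
  obtains k w' where "of_word w = fa powi k * of_word w'" "reduced w'" "b_initial w'" "length w' \<le> length w"
proof -
  have "\<exists>n x w'. w = replicate n x @ w' \<and> x \<in> {La, La_inv} \<and> b_initial w'"
    using assms
  proof (induction w)
    case Nil
    then show ?case by (intro exI[of _ 0] exI[of _ La] exI[of _ "[]"]) (simp add: b_initial_def)
  next
    case (Cons y v)
    show ?case
    proof (cases "y \<in> {Lb, Lb_inv}")
      case True
      then show ?thesis by (intro exI[of _ 0] exI[of _ La] exI[of _ "y # v"]) (simp add: b_initial_def)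
    next
      case False
      then have y: "y \<in> {La, La_inv}" by (cases y) auto
      from Cons obtain n x w' where v: "v = replicate n x @ w'" "x \<in> {La, La_inv}" "b_initial w'"
        using reduced_ConsD by blast
      show ?thesis
      proof (cases n)
        case 0
        with v y show ?thesis by (intro exI[of _ 1] exI[of _ y] exI[of _ w']) simp
      next
        case (Suc m)
        with v Cons.prems have "x \<noteq> letter_inv y" by simp
        with y v have "x = y" by auto
        with v y show ?thesis by (intro exI[of _ "Suc n"] exI[of _ x] exI[of _ w']) simp
      qed
    qed
  qed
  then obtain n x w' where w: "w = replicate n x @ w'" "x \<in> {La, La_inv}" "b_initial w'" by blast
  have "reduced w'" using assms unfolding w(1) by (induction n) (auto dest: reduced_ConsD)
  moreover have "\<exists>k. of_word (replicate n x) = fa powi k"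
  proof (cases "x = La")
    case True
    then show ?thesis using a_powi_eq_of_word[of "int n"] by (intro exI[of _ "int n"]) simp
  next
    case False
    then have "x = La_inv" using w(2) by simp
    then show ?thesis using a_powi_eq_of_word[of "- int n"]
      by (intro exI[of _ "- int n"]) (cases "n = 0"; simp)
  qed
  ultimately show thesis
    using that w by (auto simp: of_word_append)
qed

lemma one_or_b_initial_of_word: "reduced w \<Longrightarrow> b_initial w \<Longrightarrow> one_or_b_initial (of_word w)"
  by (simp add: one_or_b_initial_def word_of_of_word reduce_reduced b_initial_def)

text \<open>The nontrivial power of a separates b^-1 from w, so nothing cancels and the word still
  begins with b^-1.\<close>

lemma one_or_b_initial_binv_a_powi:
  assumes "reduced w" "b_initial w" "k \<noteq> 0"
  shows "one_or_b_initial (inverse fb * fa powi k * of_word w)"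
proof -
  let ?x = "if k \<ge> 0 then La else La_inv"
  have red: "reduced (replicate n ?x @ w)" for n
  proof (induction n)
    case (Suc n)
    then show ?case
      using assms(2) by (cases n; cases w) (auto simp: b_initial_def)
  qed (simp add: assms(1))
  obtain m where m: "nat \<bar>k\<bar> = Suc m" using assms(3) by (cases "nat \<bar>k\<bar>") auto
  have "inverse fb * fa powi k * of_word w = of_word (Lb_inv # replicate (nat \<bar>k\<bar>) ?x @ w)"
    using of_word_Cons[of Lb_inv "replicate (nat \<bar>k\<bar>) ?x @ w"]
    by (simp only: of_word_append a_powi_eq_of_word of_word_single mult.assoc)
  moreover have "reduced (Lb_inv # replicate (nat \<bar>k\<bar>) ?x @ w)"
    using red[of "nat \<bar>k\<bar>"] unfolding m by simp
  ultimately show ?thesis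
    by (simp only:) (rule one_or_b_initial_of_word, auto simp: b_initial_def)
qed

text \<open>The recursion does not produce a word beginning with a by mere concatenation. The value
  at a^k w with k \<noteq> 0 is reached through b (b^-1 a^k w): the rule for b^-1 gives the inner
  word, and the rule for b with exponent 0 applies to it although the outer b cancels. The remaining
  words begin with b or b^-1 and are handled by induction on length, for all k at once.\<close>

lemma Omat_A_family_unique:
  assumes F: "Omat_A_family F" and F': "Omat_A_family F'"
  shows "F = F'"
proof
  have plus: "F (fb * fa powi k * g) = F' (fb * fa powi k * g)"
    and minus: "F (inverse fb * fa powi k * g) = F' (inverse fb * fa powi k * g)"
    if "one_or_b_initial g" "F g = F' g" for k g
    using F F' that unfolding Omat_A_family_def by metis+
  have key: "F (fa powi k * of_word w) = F' (fa powi k * of_word w)" if "reduced w" "b_initial w" for k w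
    using that
  proof (induction w arbitrary: k rule: length_induct)
    case (1 w)
    have base: "F (of_word w) = F' (of_word w)"
    proof (cases w)
      case Nil
      then show ?thesis using F F' by (simp add: Omat_A_family_def of_word_Nil)
    next
      case (Cons y v)
      have "reduced v" using 1(2) Cons reduced_ConsD by blast
      then obtain j v' where v: "of_word v = fa powi j * of_word v'" "reduced v'" "b_initial v'" "length v' \<le> length v"
        by (rule split_a_power)
      have "length v' < length w" using v Cons by simp
      with 1(1) v have "F (fa powi 0 * of_word v') = F' (fa powi 0 * of_word v')" by blast
      then have eq: "F (of_word v') = F' (of_word v')" by simp
      have "y = Lb \<or> y = Lb_inv" using 1(3) Cons by (simp add: b_initial_def)
      then show ?thesis
        using plus[OF one_or_b_initial_of_word[OF v(2,3)] eq, of j] minus[OF one_or_b_initial_of_word[OF v(2,3)] eq, of j]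
        by (auto simp: Cons of_word_Cons[of y v] of_word_single v(1) mult.assoc)
    qed
    show ?case
    proof (cases "k = 0")
      case False
      let ?g = "inverse fb * fa powi k * of_word w"
      have "F ?g = F' ?g" by (rule minus[OF one_or_b_initial_of_word[OF 1(2,3)] base])
      from plus[OF one_or_b_initial_binv_a_powi[OF 1(2,3) False] this, of 0]
      have "F (fb * ?g) = F' (fb * ?g)" by simp
      moreover have "fb * ?g = fa powi k * of_word w"
        by (simp flip: mult.assoc)
      ultimately show ?thesis by simp
    qed (simp add: base)
  qed
  fix g
  have "reduced (word_of g)" using word_of[of g] by simp
  then obtain k w where "of_word (word_of g) = fa powi k * of_word w" "reduced w" "b_initial w"
    by (rule split_a_power)
  with key show "F g = F' g" by (simp add: of_word_word_of)
qed

section \<open>Monomial form of the generators and of the semilinear operators\<close>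

section \<open>Matrices in an adapted basis\<close>

definition mat3 :: "'a \<Rightarrow> 'a \<Rightarrow> 'a \<Rightarrow> 'a \<Rightarrow> 'a \<Rightarrow> 'a \<Rightarrow> 'a \<Rightarrow> 'a \<Rightarrow> 'a \<Rightarrow> 'a::zero^3^3" where
  "mat3 a b c d e f g h i = vector [vector [a, b, c], vector [d, e, f], vector [g, h, i]]"

lemma mat3_mult:
  fixes a :: "'a::comm_ring_1"
  shows "mat3 a b c d e f g h i ** mat3 a' b' c' d' e' f' g' h' i' =
    mat3 (a * a' + b * d' + c * g') (a * b' + b * e' + c * h') (a * c' + b * f' + c * i')
      (d * a' + e * d' + f * g') (d * b' + e * e' + f * h') (d * c' + e * f' + f * i')
      (g * a' + h * d' + i * g') (g * b' + h * e' + i * h') (g * c' + h * f' + i * i')"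
  by (simp add: mat3_def vec_eq_iff forall_3 matrix_matrix_mult_def sum_3)

lemma mat3_add:
  fixes a :: "'a::comm_ring_1"
  shows "mat3 a b c d e f g h i + mat3 a' b' c' d' e' f' g' h' i' =
    mat3 (a + a') (b + b') (c + c') (d + d') (e + e') (f + f') (g + g') (h + h') (i + i')"
  by (simp add: mat3_def vec_eq_iff forall_3)

lemma mat3_diff:
  fixes a :: "'a::comm_ring_1"
  shows "mat3 a b c d e f g h i - mat3 a' b' c' d' e' f' g' h' i' =
    mat3 (a - a') (b - b') (c - c') (d - d') (e - e') (f - f') (g - g') (h - h') (i - i')"
  by (simp add: mat3_def vec_eq_iff forall_3)

lemma mat3_uminus:
  fixes a :: "'a::comm_ring_1"
  shows "- mat3 a b c d e f g h i = mat3 (- a) (- b) (- c) (- d) (- e) (- f) (- g) (- h) (- i)"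
  by (simp add: mat3_def vec_eq_iff forall_3)

lemma mscale_mat3:
  "mscale k (mat3 a b c d e f g h i) = mat3 (k * a) (k * b) (k * c) (k * d) (k * e) (k * f) (k * g) (k * h) (k * i)"
  by (simp add: mat3_def mscale_def vec_eq_iff forall_3)

lemma mat3_one: "mat 1 = (mat3 1 0 0 0 1 0 0 0 1 :: 'a::comm_ring_1^3^3)"
  by (simp add: mat3_def mat_def vec_eq_iff forall_3)

lemma mat3_zero: "0 = (mat3 0 0 0 0 0 0 0 0 0 :: 'a::comm_ring_1^3^3)"
  by (simp add: mat3_def vec_eq_iff forall_3)

lemma mat3_eq_iff: "mat3 a b c d e f g h i = mat3 a' b' c' d' e' f' g' h' i' \<longleftrightarrow>
    a = a' \<and> b = b' \<and> c = c' \<and> d = d' \<and> e = e' \<and> f = f' \<and> g = g' \<and> h = h' \<and> i = i'"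
  by (auto simp: mat3_def vec_eq_iff forall_3)

lemma mscale_mult_left: "mscale c M ** N = mscale c (M ** N)"
  by (simp add: mscale_def matrix_matrix_mult_def vec_eq_iff sum_distrib_left mult.assoc)

lemma mscale_mult_right: "M ** mscale c N = mscale c (M ** N)"
  by (simp add: mscale_def matrix_matrix_mult_def vec_eq_iff sum_distrib_left mult_ac)

lemma two_nonzero [simp]: "(2 :: kfield) \<noteq> 0"
proof -
  have "(2 :: kfield) = Fract 1 1 + Fract 1 1"
    using one_add_one[where 'a = kfield] by (simp only: One_fract_def)
  also have "\<dots> = Fract (1 * 1 + 1 * 1) (1 * 1)" by (rule add_fract) simp_all
  finally have "(2 :: kfield) = Fract (1 * 1 + 1 * 1) (1 * 1)" .
  moreover have "Fract (1 * 1 + 1 * 1) (1 * 1) \<noteq> (Fract 0 1 :: kfield)"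
    by (subst eq_fract(1)) simp_all
  ultimately show ?thesis by (simp only: Zero_fract_def not_False_eq_True)
qed

text \<open>The columns are v+, v- and w.\<close>

definition basis :: "germR^3^3" where
  "basis = mat3 1 1 0 0 0 1 (emb (kappa\<^sup>2 / 2)) (emb (- (kappa\<^sup>2 / 2))) 0"

definition basis_inv :: "germR^3^3" where
  "basis_inv = mat3 (emb (1 / 2)) 0 (emb (1 / kappa\<^sup>2)) (emb (1 / 2)) 0 (emb (- (1 / kappa\<^sup>2))) 0 1 0"

lemma half_plus_half: "1 / 2 + 1 / 2 = (1 :: kfield)"
proof -
  have "1 / 2 + 1 / 2 = (1 + 1 :: kfield) / 2" by (simp only: add_divide_distrib)
  also have "\<dots> = 1" by (simp only: one_add_one divide_self two_nonzero not_False_eq_True)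
  finally show ?thesis .
qed

lemma emb_combine:
  "emb x * emb y = emb (x * y)" "emb x * (emb y * z) = emb (x * y) * z"
  "emb x * z * emb y = emb (x * y) * z"
  "emb x + emb y = emb (x + y)" "emb x * z + emb y * z = emb (x + y) * z"
  "- emb x = emb (- x)" "- (emb x * z) = emb (- x) * z"
  by (simp_all add: emb_mult emb_add emb_uminus algebra_simps)

lemma emb_combine_unit: "emb x * z = z" "emb x = 1" if "x = 1"
  using that by (simp_all add: emb_one)

lemma basis_inv_basis: "basis_inv ** basis = mat 1"
  unfolding basis_def basis_inv_def mat3_mult mat3_one mat3_eq_iff
  by (simp add: emb_combine) (simp add: half_plus_half emb_one emb_zero)

text \<open>The matrix, in the standard basis, of the operator that has matrix M in the adapted
  basis.\<close>

definition conv :: "germR^3^3 \<Rightarrow> germR^3^3" where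
  "conv M = basis ** M ** basis_inv"

lemma conv_mult: "conv M ** conv N = conv (M ** N)"
proof -
  have "conv M ** conv N = basis ** M ** (basis_inv ** basis) ** N ** basis_inv"
    by (simp only: conv_def matrix_mul_assoc)
  then show ?thesis by (simp only: basis_inv_basis matrix_mul_rid conv_def matrix_mul_assoc)
qed

lemma conv_one: "conv (mat 1) = mat 1"
  unfolding basis_def basis_inv_def conv_def mat3_mult mat3_one mat3_eq_iff
  by (simp add: emb_combine) (simp add: half_plus_half emb_one emb_zero)

lemma matrix_add_rdistrib: "(A + B) ** C = A ** C + B ** C" for A B :: "'a::semiring_1^'n^'m"
  by (simp add: matrix_matrix_mult_def vec_eq_iff sum.distrib distrib_right)

lemma conv_add: "conv (M + N) = conv M + conv N"
  by (simp add: conv_def matrix_add_ldistrib matrix_add_rdistrib)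

lemma conv_mscale: "conv (mscale c M) = mscale c (conv M)"
  by (simp add: conv_def mscale_mult_left mscale_mult_right)

lemma mscale_uminus: "mscale (- c) M = - mscale c M"
  by (simp add: mscale_def vec_eq_iff)

lemma mscale_1: "mscale 1 M = M"
  by (simp add: mscale_def vec_eq_iff)

lemma conv_uminus: "conv (- M) = - conv M"
  using conv_mscale[of "- 1" M] by (simp add: mscale_uminus mscale_1)

lemma conv_diff: "conv (M - N) = conv M - conv N"
  using conv_add[of M "- N"] by (simp add: conv_uminus)

abbreviation mk :: kfield where "mk \<equiv> - const_k \<i> * kappa"

lemma const_k_i: "const_k \<i> * const_k \<i> = - 1"
  by (simp add: const_k_def One_fract_def one_pCons)

lemma mk_mk: "mk * mk = - kappa\<^sup>2"
proof -
  have "mk * mk = (const_k \<i> * const_k \<i>) * kappa\<^sup>2" by (simp add: power2_eq_square)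
  then show ?thesis by (simp add: const_k_i)
qed

definition mat_A :: "germR \<Rightarrow> germR^3^3" where
  "mat_A c = mat3 0 (emb mk * c) 0 (emb mk * unit_inv c) 0 0 0 0 0"

definition mat_B :: "germR \<Rightarrow> germR^3^3" where
  "mat_B c = mat3 0 0 0 0 0 c 0 (emb (- kappa\<^sup>2) * unit_inv c) 0"

lemma Omat_A1_eq: "Omat_A1 = conv (mat_A 1)"
proof -
  have "Omat_A1 = mat3 (emb mk) 0 0 0 0 0 0 0 (emb (- mk))"
    by (simp add: Omat_A1_def mat3_def)
  moreover have "mk * (1 / 2) + mk * (1 / 2) = mk" "kappa\<^sup>2 / 2 * mk * (1 / kappa\<^sup>2) = mk / 2"
    using half_plus_half by (simp_all flip: distrib_left)
  ultimately show ?thesis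
    unfolding conv_def basis_def basis_inv_def mat_A_def mat3_mult
    by (simp add: mat3_eq_iff emb_combine emb_zero)
qed

lemma Omat_B1_eq: "Omat_B1 = conv (mat_B e_germ)"
proof -
  have "Omat_B1 = mat3 0 e_germ 0 (emb (- (kappa\<^sup>2 / 2)) * unit_inv e_germ) 0 (unit_inv e_germ) 0 (emb (- (kappa\<^sup>2 / 2)) * e_germ) 0"
    by (simp add: Omat_B1_def mat3_def)
  then show ?thesis
    unfolding conv_def basis_def basis_inv_def mat_B_def mat3_mult
    by (simp add: mat3_eq_iff emb_combine emb_zero emb_one)
qed

text \<open>In the adapted basis the square of \<open>Omat_B1\<close> is -\<kappa>^2 on v- and w and
  0 on v+. The correction term therefore changes the multiplier of the v- part from c to c - (c -
  1/c) = 1/c and leaves c on the v+ part.\<close>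

lemma step_A_conv:
  assumes "unit c" "unit d"
  shows "step_A c (conv (mat_A d)) = conv (mat_A (c * d))"
proof -
  have e: "e_germ * (unit_inv e_germ * x) = x" for x
    using unit_e_germ by (simp add: unit_def flip: mult.assoc)
  have k: "emb (1 / kappa\<^sup>2) * emb (- kappa\<^sup>2) = - 1"
    by (simp add: emb_combine) (simp add: emb_one emb_uminus)
  have "mscale c (mat_A d) + mscale (emb (1 / kappa\<^sup>2) * (c - unit_inv c)) (mat_B e_germ ** mat_B e_germ ** mat_A d)
      = mat_A (c * d)"
  proof -
    have "c * (emb mk * unit_inv d) + emb (1 / kappa\<^sup>2) * (c - unit_inv c) * (emb (- kappa\<^sup>2) * (emb mk * unit_inv d))
        = c * (emb mk * unit_inv d) + (emb (1 / kappa\<^sup>2) * emb (- kappa\<^sup>2)) * (c - unit_inv c) * (emb mk * unit_inv d)"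
      by (simp add: mult_ac)
    also have "\<dots> = emb mk * (unit_inv c * unit_inv d)"
      unfolding k by (simp add: algebra_simps)
    finally show ?thesis
      unfolding mat_A_def mat_B_def mat3_mult mscale_mat3 mat3_add mat3_eq_iff
      by (simp add: unit_mult(2)[OF assms] e mult_ac)
  qed
  then show ?thesis
    by (simp add: step_A_def Omat_B1_eq conv_mult flip: conv_mscale conv_add)
qed

section \<open>The matrices of the generators\<close>

lemma cocycle_a_powi: "det M = 1 \<Longrightarrow> cocycle (fa powi k * g) M = cocycle g M"
proof -
  assume M: "det M = 1"
  have 1: "cocycle (fa ^ n) N = 1" "cocycle (inverse fa ^ n) N = 1" if "det N = 1" for n N
    using that by (induction n arbitrary: N) (simp_all add: cocycle_one cocycle_mult cocycle_gens)
  then have "cocycle (fa powi k) N = 1" if "det N = 1" for N using that by (simp add: power_int_def)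
  then show ?thesis using M by (simp add: cocycle_mult det_mul det_phi)
qed

lemma erow_a_powi: "erow (phi (fa powi k * g)) 2 = erow (phi g) 2"
proof -
  have "erow (phi (fa ^ n) ** M) 2 = erow M 2" "erow (phi (inverse fa ^ n) ** M) 2 = erow M 2" for n M
    by (induction n) (simp_all add: phi_gens(1) phi_mult phi_gens_letter rows_phi_letter matrix_mul_lid
        del: phi_letter.simps flip: matrix_mul_assoc)
  then show ?thesis by (simp add: power_int_def phi_mult)
qed

text \<open>A power of a does not change the second row. With v, w the rows of \<phi>(a^k g), the
  three monomials of \<open>c_plus\<close> are therefore those of w, v and -(v + w).\<close>

lemma c_plus_eq: "c_plus (fb * fa powi k) g = cocycle fb (phi (fa powi k * g))"
proof -
  let ?G = "phi (fa powi k * g)"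
  have H: "phi (fb * fa powi k * g) = phi_letter Lb ** ?G"
    by (simp only: mult.assoc phi_mult[of fb] phi_gens_letter)
  have i: "indep (erow ?G 2) (erow ?G 1)" by (rule indep_intros(1)[OF indep_rows(1)[OF det_phi]])
  have "c_plus (fb * fa powi k) g = pexp_plus Q8 [erow (phi g) 2, erow (phi_letter Lb ** ?G) 1, - erow (phi_letter Lb ** ?G) 2]"
    unfolding c_plus_def Let_def H by (simp add: erow_def del: phi_letter.simps)
  also have "\<dots> = tri (erow ?G 2) (erow ?G 1)"
    unfolding tri_def rows_phi_letter erow_a_powi by (simp add: add.commute)
  also have "\<dots> = cocycle fb ?G" using tri_commute[OF i] by (simp add: cocycle_gens)
  finally show ?thesis .
qed

text \<open>The triple of \<open>c_minus\<close> is w, -v, v - w, whereas the cocycle uses the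
  opposite one v, w - v, -w; invariance under inverting all three monomials reconciles them.\<close>

lemma c_minus_eq: "c_minus (inverse fb * fa powi k) g = cocycle (inverse fb) (phi (fa powi k * g))"
proof -
  let ?G = "phi (fa powi k * g)"
  have H: "phi (inverse fb * fa powi k * g) = phi_letter Lb_inv ** ?G"
    by (simp only: mult.assoc phi_mult[of "inverse fb"] phi_gens_letter)
  have i: "indep (- erow ?G 1) (erow ?G 2)" by (rule indep_rows(3)[OF det_phi])
  have "c_minus (inverse fb * fa powi k) g
      = pexp_plus (- Q8) [erow (phi g) 2, - erow (phi_letter Lb_inv ** ?G) 1, - erow (phi_letter Lb_inv ** ?G) 2]"
    unfolding c_minus_def Let_def H by (simp add: erow_def del: phi_letter.simps)
  also have "\<dots> = tri_inv (erow ?G 2) (- erow ?G 1)"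
    unfolding tri_inv_def rows_phi_letter erow_a_powi by simp
  also have "\<dots> = unit_inv (tri (erow ?G 2) (- erow ?G 1))"
    using unit_tri(2)[OF indep_intros(1)[OF i]] by simp
  also have "tri (erow ?G 2) (- erow ?G 1) = tri (- erow ?G 1) (erow ?G 2)"
    by (rule tri_commute[OF indep_intros(1)[OF i]])
  also have "\<dots> = tri (erow ?G 1) (erow ?G 2 - erow ?G 1)"
    using tri_rotate[OF i] by (simp add: add.commute)
  finally show ?thesis by (simp add: cocycle_gens)
qed

lemma det_one: "det (mat 1 :: int^2^2) = 1"
  by simp

abbreviation factor_A :: "free2 \<Rightarrow> germR" where
  "factor_A g \<equiv> cocycle g (mat 1)"

lemma unit_factor_A: "unit (factor_A g)"
  by (rule unit_cocycle[OF det_one])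

text \<open>The cocycle law holds in the group and not merely for reduced words, so it yields the
  recursion also in the instances where letters cancel.\<close>

lemma Omat_A_family_conv: "Omat_A_family (\<lambda>g. conv (mat_A (factor_A g)))"
  unfolding Omat_A_family_def
proof (intro conjI allI impI)
  show "conv (mat_A (factor_A 1)) = Omat_A1" by (simp add: cocycle_one Omat_A1_eq)
  fix k g
  have *: "factor_A (h * fa powi k * g) = cocycle h (phi (fa powi k * g)) * factor_A g" for h
    using cocycle_mult[OF det_one, of h "fa powi k * g"] cocycle_a_powi[OF det_one, of k g]
    by (simp add: mult.assoc matrix_mul_rid)
  show "conv (mat_A (factor_A (fb * fa powi k * g))) = step_A (c_plus (fb * fa powi k) g) (conv (mat_A (factor_A g)))"
    "conv (mat_A (factor_A (inverse fb * fa powi k * g))) = step_A (c_minus (inverse fb * fa powi k) g) (conv (mat_A (factor_A g)))"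
    unfolding * c_plus_eq c_minus_eq by (simp_all add: step_A_conv unit_cocycle det_phi)
qed

lemma Omat_A_eq: "Omat_A g = conv (mat_A (factor_A g))"
  unfolding Omat_A_def
  using the_equality[of Omat_A_family, OF Omat_A_family_conv Omat_A_family_unique[OF _ Omat_A_family_conv]] by metis

section \<open>Semilinear operators\<close>

definition dmat :: "int^2^2 \<Rightarrow> germR^3^3 \<Rightarrow> germR^3^3" where
  "dmat M N = (\<chi> i j. delta M (N$i$j))"

lemma dmat_mat3:
  "dmat M (mat3 a b c d e f g h i) = mat3 (delta M a) (delta M b) (delta M c) (delta M d) (delta M e)
    (delta M f) (delta M g) (delta M h) (delta M i)"
  by (simp add: dmat_def mat3_def vec_eq_iff forall_3)

lemma dmat_mult: "det M = 1 \<Longrightarrow> dmat M (A ** B) = dmat M A ** dmat M B"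
  by (simp add: dmat_def vec_eq_iff matrix_matrix_mult_def sum_3 delta_add delta_mult)

lemma dmat_add: "det M = 1 \<Longrightarrow> dmat M (A + B) = dmat M A + dmat M B"
  by (simp add: dmat_def vec_eq_iff delta_add)

lemma dmat_zero: "det M = 1 \<Longrightarrow> dmat M 0 = 0"
  by (simp add: dmat_def vec_eq_iff delta_zero)

lemma dmat_one: "det M = 1 \<Longrightarrow> dmat M (mat 1) = mat 1"
  by (simp add: mat3_one dmat_mat3 delta_zero delta_one)

lemma dmat_mscale: "det M = 1 \<Longrightarrow> dmat M (mscale (emb c) A) = mscale (emb c) (dmat M A)"
  by (simp add: dmat_def mscale_def vec_eq_iff delta_mult delta_emb)

lemma dmat_conv: "det M = 1 \<Longrightarrow> dmat M (conv A) = conv (dmat M A)"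
  by (simp add: conv_def dmat_mult basis_def basis_inv_def dmat_mat3 delta_emb delta_zero delta_one)

lemma delta_hat_mult: "det M = 1 \<Longrightarrow> delta_hat M (A *v v) = dmat M A *v delta_hat M v"
  by (simp add: delta_hat_def dmat_def vec_eq_iff matrix_vector_mult_def sum_3 delta_add delta_mult)

lemma delta_hat_delta_hat: "det M = 1 \<Longrightarrow> det N = 1 \<Longrightarrow> delta_hat M (delta_hat N v) = delta_hat (N ** M) v"
  by (simp add: delta_hat_def delta_delta)

lemma bij_delta_hat:
  assumes "det M = 1"
  shows "bij (delta_hat M)"
proof (rule o_bij)
  have d: "det (adj2 M) = 1" using assms by (simp add: det_adj2)
  have "adj2 M ** M = mat 1" "M ** adj2 M = mat 1"
    using assms by (simp_all add: adj2_def vec_eq_iff forall_2 matrix_matrix_mult_def sum_2 mat_def det_2 algebra_simps)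
  moreover have "delta_hat (mat 1) v = v" for v by (simp add: delta_hat_def delta_mat_1 vec_eq_iff)
  ultimately show "delta_hat (adj2 M) \<circ> delta_hat M = id" "delta_hat M \<circ> delta_hat (adj2 M) = id"
    using assms d by (auto simp: fun_eq_iff delta_hat_delta_hat)
qed

lemma bij_semilinear:
  assumes "det M = 1" "D ** D' = mat 1" "D' ** D = mat 1"
  shows "bij ((*v) D \<circ> delta_hat M)"
proof (rule bij_comp[OF bij_delta_hat[OF assms(1)]])
  show "bij ((*v) D)"
    using assms by (intro o_bij[of "(*v) D'"]) (auto simp: fun_eq_iff matrix_vector_mul_assoc matrix_vector_mul_lid)
qed

text \<open>Moving the substitution past N turns T N = A T into an identity of matrices; bijectivity
  of T then gives the conjugate without any formula for its inverse.\<close>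

lemma semilinear_intertwine:
  assumes "det M = 1" "T = (*v) D \<circ> delta_hat M" "bij T" "D ** dmat M N = A ** D"
  shows "(*v) N = inv T \<circ> (*v) A \<circ> T"
proof
  fix v
  have "T (N *v v) = (D ** dmat M N) *v delta_hat M v"
    by (simp add: assms(2) delta_hat_mult[OF assms(1)] matrix_vector_mul_assoc)
  also have "\<dots> = A *v T v"
    by (simp add: assms(2,4) matrix_vector_mul_assoc)
  finally have "T (N *v v) = A *v T v" .
  then have "inv T (T (N *v v)) = inv T (A *v T v)" by simp
  then show "N *v v = (inv T \<circ> (*v) A \<circ> T) v"
    using assms(3) by (simp add: bij_is_inj)
qed

lemma conj_mat_eqI: "(*v) N = inv T \<circ> (*v) M \<circ> T \<Longrightarrow> conj_mat T M = N"
  unfolding conj_mat_def by (rule the_equality) (auto simp: matrix_eq fun_eq_iff)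

text \<open>D_A in the adapted basis: it exchanges v+ and v- and scales w, so it is monomial rather
  than diagonal.\<close>

definition diag_A :: "germR^3^3" where
  "diag_A = mat3 0 1 0 1 0 0 0 0 (emb (- const_k \<i> * Qk))"

text \<open>The matrix part of S in the adapted basis. It exchanges the lines of v+ and w and keeps
  that of v-, which is why it converts matrices supported on v+, v- into matrices supported on w, v-
  and conversely.\<close>

definition diag_S :: "germR^3^3" where
  "diag_S = mat3 0 0 (emb (2 * const_k \<i> / kappa) * delta shear beta)
     0 (emb 2 * delta shear alpha) 0
     (emb (- (2 * const_k \<i> * kappa)) * delta shear gamma) 0 0"

lemma mat3_inverse_cases:
  fixes x y z :: germR
  assumes "x * x' = 1" "y * y' = 1" "z * z' = 1"
  shows "mat3 0 0 x 0 y 0 z 0 0 ** mat3 0 0 z' 0 y' 0 x' 0 0 = mat 1"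
    "mat3 0 0 z' 0 y' 0 x' 0 0 ** mat3 0 0 x 0 y 0 z 0 0 = mat 1"
    "mat3 0 x 0 y 0 0 0 0 z ** mat3 0 y' 0 x' 0 0 0 0 z' = mat 1"
    "mat3 0 y' 0 x' 0 0 0 0 z' ** mat3 0 x 0 y 0 0 0 0 z = mat 1"
  using assms by (simp_all add: mat3_mult mat3_one mult.commute)

lemma emb_unit: "x \<noteq> 0 \<Longrightarrow> unit (emb x)"
  by (rule unitI[of _ "emb (1 / x)"]) (simp add: emb_combine emb_one)

lemma const_k_i_mult: "const_k \<i> * (const_k \<i> * z) = - z"
  by (simp add: const_k_i flip: mult.assoc)

lemma const_k_i_nonzero: "const_k \<i> \<noteq> 0"
  using const_k_i by auto

lemma diag_A_inverse: "\<exists>D. diag_A ** D = mat 1 \<and> D ** diag_A = mat 1"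
proof -
  have "unit (emb (- const_k \<i> * Qk))" by (rule emb_unit) (simp add: const_k_i_nonzero)
  then show ?thesis
    unfolding diag_A_def unit_def using mat3_inverse_cases(3,4)[of 1 1 1 1] by fastforce
qed

lemma diag_S_inverse: "\<exists>D. diag_S ** D = mat 1 \<and> D ** diag_S = mat 1"
proof -
  have "unit (emb (2 * const_k \<i> / kappa) * delta shear beta)" "unit (emb 2 * delta shear alpha)"
    "unit (emb (- (2 * const_k \<i> * kappa)) * delta shear gamma)"
    by (auto intro!: unit_mult(1) unit_sheared emb_unit simp: const_k_i_nonzero)
  then show ?thesis
    unfolding diag_S_def unit_def using mat3_inverse_cases(1,2) by blast
qed

lemma conv_inverse:
  assumes "\<exists>D'. D ** D' = mat 1 \<and> D' ** D = mat 1"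
  obtains D' where "conv D ** D' = mat 1" "D' ** conv D = mat 1"
proof -
  obtain D' where "D ** D' = mat 1" "D' ** D = mat 1" using assms by blast
  then have "conv D ** conv D' = mat 1" "conv D' ** conv D = mat 1"
    by (simp_all add: conv_mult conv_one)
  then show thesis by (rule that)
qed

lemma D_A_eq: "D_A = conv diag_A"
proof -
  have "D_A = mat3 1 0 0 0 (emb (- const_k \<i> * Qk)) 0 0 0 (- 1)"
    by (simp add: D_A_def mat3_def)
  then show ?thesis
    unfolding conv_def basis_def basis_inv_def diag_A_def mat3_mult
    by (simp add: mat3_eq_iff emb_combine) (simp add: half_plus_half emb_one emb_zero emb_uminus)
qed

lemma one_minus_Qk4: "1 - Qk ^ 4 = - (Qk\<^sup>2 * kappa)"
proof -
  have "Qk\<^sup>2 * inverse Qk ^ 2 = 1" by (simp flip: power_mult_distrib)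
  moreover have "Qk\<^sup>2 * Qk\<^sup>2 = Qk ^ 4" by (simp flip: power_add)
  ultimately show ?thesis by (simp add: kappa_def right_diff_distrib)
qed

lemma D_B_coefficients:
  "2 * Qk / (1 - Qk ^ 4) = - 2 / (Qk * kappa)" "2 * Qk ^ 4 / (1 - Qk ^ 4)\<^sup>2 = 2 / kappa\<^sup>2"
  "- (1 - Qk ^ 4) / Qk ^ 3 = kappa / Qk" "(1 - Qk ^ 4)\<^sup>2 / (2 * Qk ^ 4) = kappa\<^sup>2 / 2"
  unfolding one_minus_Qk4 by (simp_all add: power2_eq_square power3_eq_cube eval_nat_numeral field_simps)

definition diag_B :: "germR^3^3" where
  "diag_B = mat3 (emb 2 * alpha) 0 0 0 0 (emb (- (2 / (Qk * kappa))) * beta) 0 (emb (2 * kappa / Qk) * gamma) 0"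

lemma D_B_eq: "D_B = conv diag_B"
proof -
  have "D_B = mat3 alpha (emb (- 2 / (Qk * kappa)) * beta) (emb (2 / kappa\<^sup>2) * alpha)
      (emb (kappa / Qk) * gamma) 0 (emb (- 2 / (Qk * kappa)) * gamma)
      (emb (kappa\<^sup>2 / 2) * alpha) (emb (kappa / Qk) * beta) alpha"
    unfolding D_B_def D_B_coefficients mat3_def ..
  then show ?thesis
    unfolding conv_def basis_def basis_inv_def diag_B_def mat3_mult
    by (simp add: mat3_eq_iff emb_combine) (simp add: emb_combine_unit power2_eq_square)
qed

lemma D_A_hat_eq: "D_A_hat = (*v) (conv diag_A) \<circ> delta_hat shear"
  by (simp add: D_A_hat_def D_A_eq)

lemma bij_D_A_hat: "bij D_A_hat"
  by (rule conv_inverse[OF diag_A_inverse]) (auto simp: D_A_hat_eq intro: bij_semilinear[OF det_shear])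

lemma dmat_diag_A: "det M = 1 \<Longrightarrow> dmat M diag_A = diag_A"
  by (simp add: diag_A_def dmat_mat3 delta_zero delta_one delta_emb)

lemma diag_S_eq: "diag_A ** dmat shear diag_B ** diag_A = diag_S"
proof -
  have "- const_k \<i> * Qk * (2 * kappa / Qk) = - (2 * const_k \<i> * kappa)"
    "- (2 / (Qk * kappa)) * (- const_k \<i> * Qk) = 2 * const_k \<i> / kappa"
    by (simp_all add: field_simps)
  then show ?thesis
    unfolding diag_A_def diag_B_def diag_S_def dmat_mat3 mat3_mult
    by (simp add: mat3_eq_iff delta_zero delta_mult delta_emb det_shear emb_combine)
      (simp add: mult_ac)
qed

text \<open>All substitutions are moved to the right through the matrices. Only D_B is altered on
  the way, by the shear, because the entries of D_A lie in k.\<close>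

lemma S_hat_eq: "S_hat = (*v) (conv diag_S) \<circ> delta_hat rot"
proof
  fix v
  let ?b = "mat2 1 0 (- 1) 1"
  have b: "det ?b = 1" by (simp add: mat2_def det_2)
  \<comment> \<open>The product is a palindrome, so the contravariance of pullbacks is invisible
    here.\<close>
  have "(shear ** ?b) ** shear = rot"
    by (simp add: mat2_def vec_eq_iff forall_2 matrix_matrix_mult_def sum_2)
  then have d: "delta_hat shear (delta_hat ?b (delta_hat shear v)) = delta_hat rot v"
    by (simp add: delta_hat_delta_hat b det_shear det_mul)
  have "S_hat v = (conv diag_A ** dmat shear (conv diag_B) ** dmat shear (dmat ?b (conv diag_A))) *v
      delta_hat shear (delta_hat ?b (delta_hat shear v))"
    by (simp add: S_hat_def D_A_hat_eq D_B_hat_def D_B_eq delta_hat_mult b det_shear dmat_mult matrix_vector_mul_assoc matrix_mul_assoc)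
  then show "S_hat v = ((*v) (conv diag_S) \<circ> delta_hat rot) v"
    by (simp add: d dmat_conv b det_shear dmat_diag_A conv_mult diag_S_eq)
qed

lemma bij_S_hat: "bij S_hat"
  by (rule conv_inverse[OF diag_S_inverse]) (auto simp: S_hat_eq intro: bij_semilinear[OF det_rot])

text \<open>Solved from the intertwining relation with S: the rotation moves the base frame of the
  cocycle from the identity to \<open>rot\<close>, up to sign, and e accounts for the ratio of the
  entries of \<open>diag_S\<close>.\<close>

definition factor_B :: "free2 \<Rightarrow> germR" where
  "factor_B g = e_germ * unit_inv (cocycle (sigma g) rot)"

lemma unit_factor_B: "unit (factor_B g)"
  unfolding factor_B_def by (intro unit_mult unit_e_germ unit_unit_inv unit_cocycle det_rot)

lemma dmat_mat_A: "det M = 1 \<Longrightarrow> unit c \<Longrightarrow> dmat M (mat_A c) = mat_A (delta M c)"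
  by (simp add: mat_A_def dmat_mat3 delta_zero delta_mult delta_emb delta_unit)

lemma dmat_mat_B: "det M = 1 \<Longrightarrow> unit c \<Longrightarrow> dmat M (mat_B c) = mat_B (delta M c)"
  by (simp add: mat_B_def dmat_mat3 delta_zero delta_mult delta_emb delta_unit)

lemma flip2_rot: "flip2 rot = - rot"
  by (simp add: flip2_def mat2_def vec_eq_iff forall_2)

lemma rot_minus_rot: "rot ** - rot = mat 1"
  by (simp add: mat2_def vec_eq_iff forall_2 matrix_matrix_mult_def sum_2 mat_def)

lemma delta_rot_factor_A: "delta rot (factor_A g) = cocycle g rot"
  using cocycle_uminus[OF det_rot] by (simp add: delta_cocycle det_rot flip2_rot matrix_mul_lid)

lemma delta_rot_factor_B: "delta rot (factor_B g) = delta rot e_germ * unit_inv (factor_A (sigma g))"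
proof -
  have "delta rot (cocycle (sigma g) rot) = factor_A (sigma g)"
    using delta_cocycle[OF det_rot det_rot, of "sigma g"] unfolding flip2_rot rot_minus_rot .
  then show ?thesis
    by (simp add: factor_B_def delta_mult det_rot flip: delta_unit(2)[OF det_rot unit_cocycle[OF det_rot]])
qed

lemma mult_unit_inv_cancel: "unit x \<Longrightarrow> x * (unit_inv x * z) = z" "unit x \<Longrightarrow> unit_inv x * (x * z) = z"
  by (simp_all add: unit_def mult.commute flip: mult.assoc)

text \<open>Each side has two nonzero entries, hence two scalar identities: one is
  \<open>e_alpha\<close>, the other a rearrangement of it that uses that c and E are units.\<close>

lemma diag_S_mat_B: "diag_S ** dmat rot (mat_B (factor_B g)) = mat_A (factor_A (sigma g)) ** diag_S"
proof -
  let ?c = "factor_A (sigma g)" and ?E = "delta rot (factor_B g)" and ?\<alpha> = "delta shear alpha" and ?\<beta> = "delta shear beta"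
  have u: "unit ?c" "unit ?E" by (rule unit_factor_A) (rule delta_unit(1)[OF det_rot unit_factor_B])
  have 1: "?E * ?\<alpha> = unit_inv ?c * ?\<beta>"
    unfolding delta_rot_factor_B e_alpha[symmetric] by (simp only: mult_ac)
  have 2: "?\<beta> * unit_inv ?E = ?c * ?\<alpha>"
  proof -
    have "?c * ?\<alpha> = ?c * (unit_inv ?E * (?E * ?\<alpha>))" using u by (simp only: mult_unit_inv_cancel)
    also have "\<dots> = (?c * (unit_inv ?c * (?\<beta> * unit_inv ?E)))" unfolding 1 by (simp only: mult_ac)
    finally show ?thesis using u by (simp only: mult_unit_inv_cancel)
  qed
  have "mat_A ?c ** diag_S = mat3 0 (emb (mk * 2) * (?c * ?\<alpha>)) 0 0 0 (emb (mk * (2 * const_k \<i> / kappa)) * (unit_inv ?c * ?\<beta>)) 0 0 0"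
    unfolding mat_A_def diag_S_def mat3_mult
    by (simp only: mat3_eq_iff emb_mult mult_zero_left mult_zero_right add_0_left add_0_right)
      (simp only: mult_ac simp_thms)
  moreover have "diag_S ** mat_B ?E = mat3 0 (emb (2 * const_k \<i> / kappa * - kappa\<^sup>2) * (?\<beta> * unit_inv ?E)) 0 0 0 (emb 2 * (?E * ?\<alpha>)) 0 0 0"
    unfolding mat_B_def diag_S_def mat3_mult
    by (simp only: mat3_eq_iff emb_mult mult_zero_left mult_zero_right add_0_left add_0_right)
      (simp only: mult_ac simp_thms)
  moreover have "mk * (2 * const_k \<i> / kappa) = 2" "2 * const_k \<i> / kappa * - kappa\<^sup>2 = mk * 2"
    by (simp_all add: power2_eq_square field_simps const_k_i_mult)
  ultimately show ?thesis
    using 1 2 by (simp only: dmat_mat_B[OF det_rot unit_factor_B])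
qed

text \<open>The B matrices are S-conjugates of A matrices by definition. That a second conjugation
  leads back, as it must since s is an involution on the generators, is a separate fact and rests on
  \<open>e_gamma\<close>.\<close>

lemma diag_S_mat_A: "diag_S ** dmat rot (mat_A (factor_A (sigma g))) = mat_B (factor_B g) ** diag_S"
proof -
  let ?c = "delta rot (factor_A (sigma g))" and ?E = "factor_B g" and ?\<alpha> = "delta shear alpha" and ?\<gamma> = "delta shear gamma"
  have u: "unit ?c" "unit ?E" by (rule delta_unit(1)[OF det_rot unit_factor_A]) (rule unit_factor_B)
  have E: "?E = e_germ * unit_inv ?c" by (simp add: factor_B_def delta_rot_factor_A)
  have 1: "?\<alpha> * unit_inv ?c = ?E * ?\<gamma>"
    unfolding E e_gamma[symmetric] by (simp only: mult_ac)
  have 2: "?\<gamma> * ?c = unit_inv ?E * ?\<alpha>"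
  proof -
    have "?\<gamma> * ?c = unit_inv ?E * (?E * ?\<gamma>) * ?c" using u by (simp only: mult_unit_inv_cancel)
    also have "\<dots> = unit_inv ?E * (?c * (unit_inv ?c * ?\<alpha>))" unfolding 1[symmetric] by (simp only: mult_ac)
    finally show ?thesis using u by (simp only: mult_unit_inv_cancel)
  qed
  have "mat_B ?E ** diag_S = mat3 0 0 0 (emb (- (2 * const_k \<i> * kappa)) * (?E * ?\<gamma>)) 0 0 0 (emb (- kappa\<^sup>2 * 2) * (unit_inv ?E * ?\<alpha>)) 0"
    unfolding mat_B_def diag_S_def mat3_mult
    by (simp only: mat3_eq_iff emb_mult mult_zero_left mult_zero_right add_0_left add_0_right)
      (simp only: mult_ac simp_thms)
  moreover have "diag_S ** mat_A ?c = mat3 0 0 0 (emb (2 * mk) * (?\<alpha> * unit_inv ?c)) 0 0 0 (emb (- (2 * const_k \<i> * kappa) * mk) * (?\<gamma> * ?c)) 0"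
    unfolding mat_A_def diag_S_def mat3_mult
    by (simp only: mat3_eq_iff emb_mult mult_zero_left mult_zero_right add_0_left add_0_right)
      (simp only: mult_ac simp_thms)
  moreover have "2 * mk = - (2 * const_k \<i> * kappa)" by simp
  moreover have "- (2 * const_k \<i> * kappa) * mk = - kappa\<^sup>2 * 2"
    by (simp add: power2_eq_square algebra_simps const_k_i_mult)
  ultimately show ?thesis
    using 1 2 by (simp only: dmat_mat_A[OF det_rot unit_factor_A])
qed

lemma Omat_B_eq: "Omat_B g = conv (mat_B (factor_B g))"
  unfolding Omat_B_def Omat_A_eq
proof (rule conj_mat_eqI, rule semilinear_intertwine[OF det_rot S_hat_eq bij_S_hat])
  show "conv diag_S ** dmat rot (conv (mat_B (factor_B g))) = conv (mat_A (factor_A (sigma g))) ** conv diag_S"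
    by (simp only: dmat_conv[OF det_rot] conv_mult diag_S_mat_B)
qed

section \<open>Verification of the defining relations, descent to the quotient, equivariance\<close>

section \<open>The relations\<close>

lemma mat_A_A: "mat_A c ** mat_A d = mat3 (emb (- kappa\<^sup>2) * (c * unit_inv d)) 0 0 0 (emb (- kappa\<^sup>2) * (unit_inv c * d)) 0 0 0 0"
  unfolding mat_A_def mat3_mult mk_mk[symmetric]
  by (simp only: mat3_eq_iff emb_mult mult_zero_left mult_zero_right add_0_left add_0_right)
    (simp only: mult_ac simp_thms)

lemma mat_B_B: "mat_B c ** mat_B d = mat3 0 0 0 0 (emb (- kappa\<^sup>2) * (c * unit_inv d)) 0 0 0 (emb (- kappa\<^sup>2) * (unit_inv c * d))"
  unfolding mat_B_def mat3_mult
  by (simp add: mat3_eq_iff mult_ac)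

lemma mat_A_square: "unit c \<Longrightarrow> mat_A c ** mat_A c = mat3 (emb (- kappa\<^sup>2)) 0 0 0 (emb (- kappa\<^sup>2)) 0 0 0 0"
  unfolding mat_A_A by (simp add: unit_def mult.commute)

lemma mat_B_square: "unit c \<Longrightarrow> mat_B c ** mat_B c = mat3 0 0 0 0 (emb (- kappa\<^sup>2)) 0 0 0 (emb (- kappa\<^sup>2))"
  unfolding mat_B_B by (simp add: unit_def mult.commute)

lemma mat_B_A_B: "mat_B c ** mat_A d ** mat_B e = 0" "mat_A c ** mat_B d ** mat_A e = 0"
  by (simp_all add: mat_A_def mat_B_def mat3_mult mat3_zero)

text \<open>The square of \<open>mat_A 1\<close> is -\<kappa>^2 times the projection to v+, v-. In
  the third identity B maps between v-, inside this span, and w, outside it, so each entry of B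
  receives -\<kappa>^2 from exactly one of the two products.\<close>

lemma mat_A_cubic:
  "mat_A 1 ** mat_A 1 ** mat_A c + mscale (emb (kappa\<^sup>2)) (mat_A c) = 0"
  "mat_A c ** mat_A 1 ** mat_A 1 + mscale (emb (kappa\<^sup>2)) (mat_A c) = 0"
  "mat_A 1 ** mat_A 1 ** mat_B c + mscale (emb (kappa\<^sup>2)) (mat_B c) + mat_B c ** mat_A 1 ** mat_A 1 = 0"
  unfolding matrix_mul_assoc[symmetric, of _ "mat_A 1" "mat_A 1"] mat_A_square[OF unit_one(1)]
  unfolding mat_A_def mat_B_def mat3_mult mscale_mat3 mat3_add mat3_zero
  by (simp_all add: emb_uminus mult_ac)

lemma mat_B_cubic:
  assumes "unit e"
  shows "mat_B e ** mat_B e ** mat_B c + mscale (emb (kappa\<^sup>2)) (mat_B c) = 0"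
    "mat_B c ** mat_B e ** mat_B e + mscale (emb (kappa\<^sup>2)) (mat_B c) = 0"
    "mat_B e ** mat_B e ** mat_A c + mscale (emb (kappa\<^sup>2)) (mat_A c) + mat_A c ** mat_B e ** mat_B e = 0"
  unfolding matrix_mul_assoc[symmetric, of _ "mat_B e" "mat_B e"] mat_B_square[OF assms]
  unfolding mat_A_def mat_B_def mat3_mult mscale_mat3 mat3_add mat3_zero
  by (simp_all add: emb_uminus mult_ac)

text \<open>A A B contributes only the entry from w to v-, and B A A only the one from v- to w,
  whereas B B B has both. The relation thus amounts to two scalar identities.\<close>

lemma mat_A_A_B:
  assumes "unit_inv c * d * F = E * unit_inv G * E" "unit_inv F * (unit_inv d * c) = unit_inv E * G * unit_inv E"
  shows "mat_A c ** mat_A d ** mat_B F + mat_B F ** mat_A d ** mat_A c - mat_B E ** mat_B G ** mat_B E = 0"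
proof -
  let ?b = "emb (- kappa\<^sup>2)"
  have "?b * (unit_inv c * d) * F = ?b * (unit_inv c * d * F)" by (simp only: mult_ac)
  moreover have "?b * (E * unit_inv G) * E = ?b * (E * unit_inv G * E)" by (simp only: mult_ac)
  moreover have "?b * unit_inv F * (?b * (unit_inv d * c)) = ?b * ?b * (unit_inv F * (unit_inv d * c))"
    "?b * unit_inv F * (?b * (c * unit_inv d)) = ?b * ?b * (unit_inv F * (unit_inv d * c))"
    "?b * (unit_inv E * G) * (?b * unit_inv E) = ?b * ?b * (unit_inv E * G * unit_inv E)"
    by (simp_all only: mult_ac)
  ultimately show ?thesis
    unfolding matrix_mul_assoc[symmetric, of "mat_B F"] mat_A_A mat_B_B
    unfolding mat_B_def mat3_mult mat3_add mat3_diff mat3_zero mat3_eq_iff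
    by (simp add: assms)
qed

lemma mat_B_B_A:
  assumes "c * unit_inv d * unit_inv F = unit_inv E * G * unit_inv E" "F * (d * unit_inv c) = E * unit_inv G * E"
  shows "mat_B c ** mat_B d ** mat_A F + mat_A F ** mat_B d ** mat_B c - mat_A E ** mat_A G ** mat_A E = 0"
proof -
  let ?b = "emb (- kappa\<^sup>2)" and ?m = "emb mk"
  have "?b * (c * unit_inv d) * (?m * unit_inv F) = ?b * ?m * (c * unit_inv d * unit_inv F)"
    "?b * (unit_inv E * G) * (?m * unit_inv E) = ?b * ?m * (unit_inv E * G * unit_inv E)"
    "?m * F * (?b * (d * unit_inv c)) = ?b * ?m * (F * (d * unit_inv c))"
    "?b * (E * unit_inv G) * (?m * E) = ?b * ?m * (E * unit_inv G * E)"
    by (simp_all only: mult_ac)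
  then show ?thesis
    unfolding matrix_mul_assoc[symmetric, of "mat_A F"] mat_A_A mat_B_B
    unfolding mat_A_def mat3_mult mat3_add mat3_diff mat3_zero mat3_eq_iff
    by (simp add: assms del: emb_uminus)
qed

lemma factor_A_mult: "factor_A (h * g) = cocycle h (phi g) * factor_A g"
  by (simp add: cocycle_mult[OF det_one] matrix_mul_rid)

lemma factor_B_mult: "factor_B (h * g) = unit_inv (cocycle (sigma h) (rot ** phi g)) * factor_B g"
proof -
  have d: "det (rot ** phi g) = 1" by (simp only: det_mul det_rot det_phi mult_1_right)
  have "cocycle (sigma (h * g)) rot = cocycle (sigma h) (rot ** phi g) * cocycle (sigma g) rot"
    by (simp add: cocycle_mult[OF det_rot] phi_sigma)
  then show ?thesis
    unfolding factor_B_def by (simp add: unit_mult(2) unit_cocycle d det_rot mult_ac)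
qed

lemma zero_matrix_mul: "0 ** M = 0" and matrix_mul_zero: "M ** 0 = 0" for M :: "germR^3^3"
  by (simp_all add: vec_eq_iff matrix_matrix_mult_def)

lemma uminus_matrix_mul: "(- M) ** N = - (M ** N)" for M N :: "int^2^2"
  by (simp add: vec_eq_iff matrix_matrix_mult_def sum_negf)

lemma cocycle_mult_braid:
  assumes "det M = 1"
  shows "cocycle (g * (fa * fb * fa)) M = cocycle g (rot ** M) * cocycle fb (rot ** M)"
    "cocycle (g * (inverse fa * inverse fb * inverse fa)) M = cocycle g (rot ** M) * cocycle (inverse fb) (rot ** M)"
proof -
  have d: "det (rot ** M) = 1" using assms by (simp only: det_mul det_rot mult_1_right)
  show "cocycle (g * (fa * fb * fa)) M = cocycle g (rot ** M) * cocycle fb (rot ** M)"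
    unfolding cocycle_mult[OF assms, of g] phi_braid uminus_matrix_mul cocycle_uminus[OF d] cocycle_braid[OF assms] ..
  show "cocycle (g * (inverse fa * inverse fb * inverse fa)) M = cocycle g (rot ** M) * cocycle (inverse fb) (rot ** M)"
    unfolding cocycle_mult[OF assms, of g] phi_braid cocycle_braid_inverse[OF assms] ..
qed

text \<open>Here c and E stand for C and E at g2, u for the cocycle value of the free argument and v
  for that of the single letter. In the first two identities C gains u v while the two other E
  values gain 1/u and 1/v; in the last two the roles of C and E are exchanged.\<close>

lemma unit_scalar_identities:
  assumes "unit c" "unit E" "unit u" "unit v"
  shows "unit_inv c * (u * v * c) * (unit_inv v * E) = E * unit_inv (unit_inv u * E) * E"
    "unit_inv (unit_inv v * E) * (unit_inv (u * v * c) * c) = unit_inv E * (unit_inv u * E) * unit_inv E"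
    "E * unit_inv (unit_inv (u * v) * E) * unit_inv (v * c) = unit_inv c * (u * c) * unit_inv c"
    "v * c * (unit_inv (u * v) * E * unit_inv E) = c * unit_inv (u * c) * c"
proof -
  have cancel: "c * unit_inv c = 1" "E * unit_inv E = 1" "u * unit_inv u = 1" "v * unit_inv v = 1"
    using assms by (simp_all add: unit_def)
  have inv: "unit_inv (unit_inv u * E) = u * unit_inv E" "unit_inv (unit_inv v * E) = v * unit_inv E"
    "unit_inv (u * v * c) = unit_inv u * unit_inv v * unit_inv c" "unit_inv (unit_inv u * unit_inv v * E) = u * v * unit_inv E"
    "unit_inv (v * c) = unit_inv v * unit_inv c" "unit_inv (u * v) = unit_inv u * unit_inv v"
    "unit_inv (u * c) = unit_inv u * unit_inv c"
    using assms by (simp_all add: unit_mult unit_unit_inv)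
  have "unit_inv c * (u * v * c) * (unit_inv v * E) = u * E * (c * unit_inv c) * (v * unit_inv v)" by (simp only: mult_ac)
  moreover have "E * (u * unit_inv E) * E = u * E * (E * unit_inv E)" by (simp only: mult_ac)
  ultimately show "unit_inv c * (u * v * c) * (unit_inv v * E) = E * unit_inv (unit_inv u * E) * E"
    unfolding inv by (simp only: cancel mult_1_right)
  have "v * unit_inv E * (unit_inv u * unit_inv v * unit_inv c * c) = unit_inv u * unit_inv E * (c * unit_inv c) * (v * unit_inv v)"
    by (simp only: mult_ac)
  moreover have "unit_inv E * (unit_inv u * E) * unit_inv E = unit_inv u * unit_inv E * (E * unit_inv E)" by (simp only: mult_ac)
  ultimately show "unit_inv (unit_inv v * E) * (unit_inv (u * v * c) * c) = unit_inv E * (unit_inv u * E) * unit_inv E"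
    unfolding inv by (simp only: cancel mult_1_right)
  have "E * (u * v * unit_inv E) * (unit_inv v * unit_inv c) = u * unit_inv c * (E * unit_inv E) * (v * unit_inv v)"
    by (simp only: mult_ac)
  moreover have "unit_inv c * (u * c) * unit_inv c = u * unit_inv c * (c * unit_inv c)" by (simp only: mult_ac)
  ultimately show "E * unit_inv (unit_inv (u * v) * E) * unit_inv (v * c) = unit_inv c * (u * c) * unit_inv c"
    unfolding inv by (simp only: cancel mult_1_right)
  have "v * c * (unit_inv u * unit_inv v * E * unit_inv E) = unit_inv u * c * (E * unit_inv E) * (v * unit_inv v)"
    by (simp only: mult_ac)
  moreover have "c * (unit_inv u * unit_inv c) * c = unit_inv u * c * (c * unit_inv c)" by (simp only: mult_ac)
  ultimately show "v * c * (unit_inv (u * v) * E * unit_inv E) = c * unit_inv (u * c) * c"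
    unfolding inv by (simp only: cancel mult_1_right)
qed

text \<open>This serves both signs: h is aba or a^-1 b^-1 a^-1, and x is a or a^-1, so that \<sigma>
  x is the letter b or b^-1 that the braid identities produce.\<close>

lemma braid_relation_A:
  assumes "\<forall>M. det M = 1 \<longrightarrow> cocycle (g1 * h) M = cocycle g1 (rot ** M) * cocycle (sigma x) (rot ** M)"
  shows "mat_A (factor_A g2) ** mat_A (factor_A (g1 * h * g2)) ** mat_B (factor_B (x * g2))
    + mat_B (factor_B (x * g2)) ** mat_A (factor_A (g1 * h * g2)) ** mat_A (factor_A g2)
    - mat_B (factor_B g2) ** mat_B (factor_B (sigma g1 * g2)) ** mat_B (factor_B g2) = 0"
proof -
  let ?K = "rot ** phi g2"
  have "det ?K = 1" by (simp only: det_mul det_rot det_phi mult_1_right)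
  then have u: "unit (cocycle g1 ?K)" "unit (cocycle (sigma x) ?K)" by (simp_all add: unit_cocycle)
  have 1: "factor_A (g1 * h * g2) = cocycle g1 ?K * cocycle (sigma x) ?K * factor_A g2"
    by (simp only: factor_A_mult assms[rule_format, OF det_phi])
  have 2: "factor_B (sigma g1 * g2) = unit_inv (cocycle g1 ?K) * factor_B g2"
    by (simp only: factor_B_mult sigma_sigma)
  show ?thesis
    unfolding 1 2 factor_B_mult[of x]
    by (rule mat_A_A_B) (rule unit_scalar_identities[OF unit_factor_A unit_factor_B u])+
qed

text \<open>The rotation enters twice, once in the passage from C to E and once in the braid
  identity. Its square is -1, which the cocycle does not see.\<close>

lemma braid_relation_B:
  assumes "\<forall>M. det M = 1 \<longrightarrow> cocycle (sigma (g1 * h)) M = cocycle (sigma g1) (rot ** M) * cocycle x (rot ** M)"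
  shows "mat_B (factor_B g2) ** mat_B (factor_B (g1 * h * g2)) ** mat_A (factor_A (x * g2))
    + mat_A (factor_A (x * g2)) ** mat_B (factor_B (g1 * h * g2)) ** mat_B (factor_B g2)
    - mat_A (factor_A g2) ** mat_A (factor_A (sigma g1 * g2)) ** mat_A (factor_A g2) = 0"
proof -
  let ?G = "phi g2"
  have K: "det (rot ** ?G) = 1" by (simp only: det_mul det_rot det_phi mult_1_right)
  have u: "unit (cocycle (sigma g1) ?G)" "unit (cocycle x ?G)" by (simp_all add: unit_cocycle det_phi)
  have "cocycle (sigma (g1 * h)) (rot ** ?G) = cocycle (sigma g1) ?G * cocycle x ?G"
    unfolding assms[rule_format, OF K] rot_rot by (simp only: cocycle_uminus[OF det_phi])
  then have 1: "factor_B (g1 * h * g2) = unit_inv (cocycle (sigma g1) ?G * cocycle x ?G) * factor_B g2"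
    by (simp only: factor_B_mult)
  show ?thesis
    unfolding 1 factor_A_mult[of x] factor_A_mult[of "sigma g1"]
    by (rule mat_B_B_A) (rule unit_scalar_identities[OF unit_factor_A unit_factor_B u])+
qed

section \<open>The representation\<close>

lemma mscale_add_left: "mscale (c + d) M = mscale c M + mscale d M"
  by (simp add: mscale_def vec_eq_iff distrib_right)

lemma mscale_mscale: "mscale c (mscale d M) = mscale (c * d) M"
  by (simp add: mscale_def vec_eq_iff mult.assoc)

lemma mscale_zero: "mscale 0 M = 0" "mscale c 0 = 0"
  by (simp_all add: mscale_def vec_eq_iff)

lemma Psi_free_single:
  "Psi_free (Poly_Mapping.single w c) = mscale (emb c) (foldr (**) (map gen_mat w) (mat 1))"
  by (simp add: Psi_free_def emb_zero mscale_zero)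

lemma Psi_free_zero: "Psi_free 0 = 0"
  by (simp add: Psi_free_def)

lemma Psi_free_add: "Psi_free (x + y) = Psi_free x + Psi_free y"
  unfolding Psi_free_def
  by (rule setsum_keys_plus_distrib) (simp_all add: emb_zero emb_add mscale_zero mscale_add_left)

lemma foldr_matrix_mul: "foldr (**) Ms N = foldr (**) Ms (mat 1) ** N" for N :: "germR^3^3"
  by (induction Ms) (simp_all add: matrix_mul_lid matrix_mul_assoc)

lemma Psi_free_mult: "Psi_free (x * y) = Psi_free x ** Psi_free y"
proof -
  have 1: "Psi_free (Poly_Mapping.single u c * y) = Psi_free (Poly_Mapping.single u c) ** Psi_free y" for u c y
  proof (rule poly_mapping_additive_eqI[of "\<lambda>y. Psi_free (Poly_Mapping.single u c * y)"
        "\<lambda>y. Psi_free (Poly_Mapping.single u c) ** Psi_free y"])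
    fix w d
    have "foldr (**) (map gen_mat (u @ w)) (mat 1) = foldr (**) (map gen_mat u) (mat 1) ** foldr (**) (map gen_mat w) (mat 1)"
      using foldr_matrix_mul[of "map gen_mat u" "foldr (**) (map gen_mat w) (mat 1)"]
      by (simp only: map_append foldr_append)
    then show "Psi_free (Poly_Mapping.single u c * Poly_Mapping.single w d)
        = Psi_free (Poly_Mapping.single u c) ** Psi_free (Poly_Mapping.single w d)"
      by (simp add: mult_single Psi_free_single plus_list_def emb_mult mscale_mult_left mscale_mult_right mscale_mscale mult.commute)
  qed (simp_all add: distrib_left Psi_free_add Psi_free_zero matrix_add_ldistrib matrix_mul_zero)
  show ?thesis
    by (rule poly_mapping_additive_eqI[of "\<lambda>x. Psi_free (x * y)" "\<lambda>x. Psi_free x ** Psi_free y"])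
      (simp_all add: distrib_right Psi_free_add Psi_free_zero matrix_add_rdistrib zero_matrix_mul 1)
qed

lemma Psi_free_uminus: "Psi_free (- x) = - Psi_free x"
  using Psi_free_add[of x "- x"] by (simp add: Psi_free_zero eq_neg_iff_add_eq_0 add.commute)

lemma Psi_free_diff: "Psi_free (x - y) = Psi_free x - Psi_free y"
  using Psi_free_add[of x "- y"] by (simp add: Psi_free_uminus)

lemma Psi_free_of_k: "Psi_free (of_k c) = mscale (emb c) (mat 1)"
  by (simp add: of_k_def Psi_free_single)

lemma Psi_free_one: "Psi_free 1 = mat 1"
proof -
  have "(1 :: free_alg) = of_k 1" by (simp add: of_k_def flip: zero_list_def)
  with Psi_free_of_k[of 1] show ?thesis by (simp only: emb_one mscale_1)
qed

lemma Psi_free_of_k_mult: "Psi_free (of_k c * x) = mscale (emb c) (Psi_free x)"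
  by (simp add: Psi_free_mult Psi_free_of_k mscale_mult_left matrix_mul_lid)

lemma Psi_free_kscale: "Psi_free (kscale_free c x) = mscale (emb c) (Psi_free x)"
  by (simp add: kscale_free_def Psi_free_of_k_mult)

lemma Psi_free_gen: "Psi_free (gA g) = conv (mat_A (factor_A g))" "Psi_free (gB g) = conv (mat_B (factor_B g))"
  by (simp_all add: gen_def Psi_free_single emb_one mscale_1 Omat_A_eq Omat_B_eq matrix_mul_rid)

lemmas Psi_free_hom = Psi_free_zero Psi_free_one Psi_free_add Psi_free_diff Psi_free_uminus Psi_free_of_k
  mscale_mult_left matrix_mul_lid Psi_free_kscale Psi_free_mult Psi_free_gen

lemma conv_zero: "conv 0 = 0"
  by (simp add: conv_def zero_matrix_mul matrix_mul_zero)

lemmas conv_hom = conv_add[symmetric] conv_diff[symmetric] conv_uminus[symmetric] conv_mscale[symmetric] conv_mult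

lemma factor_A_one: "factor_A 1 = 1"
  by (rule cocycle_one)

lemma Psi_free_relators:
  assumes "r \<in> relators"
  shows "Psi_free r = 0"
proof -
  note simps = Psi_free_hom conv_hom factor_A_one
  have z: "conv M = 0" if "M = 0" for M using that conv_zero by simp
  show ?thesis
    using assms
  proof (cases rule: relators.cases)
    case (R0A g)
    then show ?thesis by (simp add: simps factor_A_mult cocycle_gens conv_zero)
  next
    case (R0B g)
    then show ?thesis by (simp add: simps factor_B_mult cocycle_gens conv_zero)
  next
    case (R1A g)
    then show ?thesis by (simp add: simps mat_A_square unit_factor_A conv_zero)
  next
    case (R1B g)
    then show ?thesis by (simp add: simps mat_B_square unit_factor_B conv_zero)
  next
    case (R2 g1 g2 g3)
    then show ?thesis by (simp add: simps mat_B_A_B conv_zero)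
  next
    case (R3 g1 g2 g3)
    then show ?thesis by (simp add: simps mat_B_A_B conv_zero)
  next
    case (R4A g)
    then show ?thesis by (simp add: simps mat_A_cubic conv_zero)
  next
    case (R4B g)
    then show ?thesis by (simp add: simps mat_B_cubic unit_factor_B conv_zero)
  next
    case (R5A g)
    then show ?thesis by (simp add: simps mat_A_cubic conv_zero)
  next
    case (R5B g)
    then show ?thesis by (simp add: simps mat_B_cubic unit_factor_B conv_zero)
  next
    case (R6 g)
    then show ?thesis by (simp add: simps mat_A_cubic conv_zero)
  next
    case (R7 g)
    then show ?thesis by (simp add: simps mat_B_cubic unit_factor_B conv_zero)
  next
    case (R8 g2 g1)
    have "\<forall>M. det M = 1 \<longrightarrow> cocycle (g1 * (fa * fb * fa)) M = cocycle g1 (rot ** M) * cocycle (sigma fa) (rot ** M)"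
      by (intro allI impI) (simp only: sigma_gens cocycle_mult_braid)
    from z[OF braid_relation_A[OF this, of g2]] show ?thesis
      unfolding R8 by (simp only: Psi_free_hom conv_hom mult.assoc[where 'a = free2])
  next
    case (R9 g2 g1)
    have "\<forall>M. det M = 1 \<longrightarrow> cocycle (sigma (g1 * (fb * fa * fb))) M = cocycle (sigma g1) (rot ** M) * cocycle fb (rot ** M)"
      by (intro allI impI) (simp only: sigma_gens sigma_mult cocycle_mult_braid)
    from z[OF braid_relation_B[OF this, of g2]] show ?thesis
      unfolding R9 by (simp only: Psi_free_hom conv_hom mult.assoc[where 'a = free2])
  next
    case (R10 g2 g1)
    have "\<forall>M. det M = 1 \<longrightarrow> cocycle (g1 * (inverse fa * inverse fb * inverse fa)) M
        = cocycle g1 (rot ** M) * cocycle (sigma (inverse fa)) (rot ** M)"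
      by (intro allI impI) (simp only: sigma_gens sigma_inverse cocycle_mult_braid)
    from z[OF braid_relation_A[OF this, of g2]] show ?thesis
      unfolding R10 by (simp only: Psi_free_hom conv_hom mult.assoc[where 'a = free2])
  next
    case (R11 g2 g1)
    have "\<forall>M. det M = 1 \<longrightarrow> cocycle (sigma (g1 * (inverse fb * inverse fa * inverse fb))) M
        = cocycle (sigma g1) (rot ** M) * cocycle (inverse fb) (rot ** M)"
      by (intro allI impI) (simp only: sigma_gens sigma_mult sigma_inverse cocycle_mult_braid)
    from z[OF braid_relation_B[OF this, of g2]] show ?thesis
      unfolding R11 by (simp only: Psi_free_hom conv_hom mult.assoc[where 'a = free2])
  qed
qed

lemma Psi_free_rel_ideal: "x \<in> rel_ideal \<Longrightarrow> Psi_free x = 0"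
  by (induction rule: rel_ideal.induct)
    (simp_all add: Psi_free_relators Psi_free_hom zero_matrix_mul matrix_mul_zero)

section \<open>Equivariance\<close>

text \<open>Both sides are additive, and on a word D can be moved past one letter at a time, so it
  suffices to check generators, already in the free algebra.\<close>

lemma Psi_free_intertwine:
  assumes "det M = 1" "\<And>x. D ** dmat M (Psi_free (v x)) = gen_mat x ** D"
  shows "D ** dmat M (Psi_free (free_lift v x)) = Psi_free x ** D"
proof (rule poly_mapping_additive_eqI[of "\<lambda>x. D ** dmat M (Psi_free (free_lift v x))" "\<lambda>x. Psi_free x ** D"])
  fix w c
  have "D ** dmat M (Psi_free (prod_list (map v w))) = foldr (**) (map gen_mat w) (mat 1) ** D"
  proof (induction w)
    case (Cons x w)
    have "D ** dmat M (Psi_free (prod_list (map v (x # w)))) = (D ** dmat M (Psi_free (v x))) ** dmat M (Psi_free (prod_list (map v w)))"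
      by (simp add: Psi_free_mult dmat_mult assms(1) matrix_mul_assoc)
    also have "\<dots> = gen_mat x ** (D ** dmat M (Psi_free (prod_list (map v w))))"
      by (simp only: assms(2) matrix_mul_assoc)
    finally show ?case by (simp add: Cons matrix_mul_assoc)
  qed (simp add: Psi_free_one dmat_one assms(1) matrix_mul_lid matrix_mul_rid)
  then show "D ** dmat M (Psi_free (free_lift v (Poly_Mapping.single w c))) = Psi_free (Poly_Mapping.single w c) ** D"
    by (simp add: free_lift_single Psi_free_kscale Psi_free_single dmat_mscale assms(1) mscale_mult_left mscale_mult_right)
qed (simp_all add: Psi_free_add Psi_free_zero dmat_add dmat_zero assms(1) matrix_add_ldistrib matrix_add_rdistrib
    zero_matrix_mul matrix_mul_zero)

lemma S_intertwine: "conv diag_S ** dmat rot (Psi_free (act_s_gen x)) = gen_mat x ** conv diag_S"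
  by (cases x) (simp_all add: Psi_free_gen Omat_A_eq Omat_B_eq dmat_conv det_rot conv_mult diag_S_mat_A diag_S_mat_B)

lemma delta_shear_factor_A: "delta shear (factor_A (g * inverse fa)) = factor_A g"
proof -
  have "phi (inverse fa) ** flip2 shear = mat 1"
    by (simp add: phi_inverse_gens flip2_def mat2_def vec_eq_iff forall_2 matrix_matrix_mult_def sum_2 mat_def)
  then show ?thesis
    by (simp add: factor_A_mult cocycle_gens delta_cocycle det_shear det_phi)
qed

text \<open>Since \<sigma>(a^-1) = b^-1, the cocycle of the shifted argument starts in the frame
  \<phi>(b^-1) \<open>rot\<close>, which the shear returns to \<open>rot\<close>. It also gains the
  inverse triangle unit of the rows of \<open>rot\<close>, and \<open>e_tri\<close> absorbs this
  into e.\<close>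

lemma delta_shear_factor_B: "delta shear (factor_B (g * inverse fa)) = factor_B g"
proof -
  let ?N = "phi (inverse fb) ** rot"
  have N: "det ?N = 1" by (simp only: det_mul det_rot det_phi mult_1_right)
  have NS: "?N ** flip2 shear = rot"
    by (simp add: phi_inverse_gens flip2_def mat2_def vec_eq_iff forall_2 matrix_matrix_mult_def sum_2)
  have t: "unit (tri (erow rot 1) (erow rot 2))" by (rule unit_tri(1)[OF indep_rows(1)[OF det_rot]])
  have rot_shear: "rot ** flip2 shear = phi_letter Lb ** rot"
    by (simp add: flip2_def mat2_def vec_eq_iff forall_2 matrix_matrix_mult_def sum_2)
  have "delta shear (cocycle (inverse fb) rot) = cocycle (inverse fb) (phi_letter Lb ** rot)"
    using delta_cocycle[OF det_shear det_rot] by (simp only: rot_shear)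
  also have "\<dots> = unit_inv (tri (erow rot 1) (erow rot 2))"
    unfolding cocycle_gens rows_phi_letter by simp
  finally have b: "delta shear (cocycle (inverse fb) rot) = unit_inv (tri (erow rot 1) (erow rot 2))" .
  have "factor_B (g * inverse fa) = e_germ * unit_inv (cocycle (sigma g) ?N * cocycle (inverse fb) rot)"
    by (simp add: factor_B_def cocycle_mult[OF det_rot])
  then have "delta shear (factor_B (g * inverse fa))
      = delta shear e_germ * unit_inv (delta shear (cocycle (sigma g) ?N) * delta shear (cocycle (inverse fb) rot))"
    by (simp add: delta_mult det_shear unit_mult unit_cocycle N det_rot delta_unit(1)[OF det_shear] flip: delta_unit(2)[OF det_shear])
  also have "\<dots> = delta shear e_germ * unit_inv (cocycle (sigma g) rot * unit_inv (tri (erow rot 1) (erow rot 2)))"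
    unfolding b delta_cocycle[OF det_shear N] NS ..
  also have "\<dots> = delta shear e_germ * tri (erow rot 1) (erow rot 2) * unit_inv (cocycle (sigma g) rot)"
    using t by (simp add: unit_mult unit_unit_inv unit_cocycle det_rot mult_ac)
  finally show ?thesis by (simp only: e_tri factor_B_def)
qed

lemma diag_A_mat_A: "unit c \<Longrightarrow> diag_A ** mat_A (unit_inv c) = mat_A c ** diag_A"
  unfolding diag_A_def mat_A_def mat3_mult by (simp add: mat3_eq_iff unit_unit_inv)

lemma A_action_mat_A:
  "unit c \<Longrightarrow> - mscale (emb (1 / kappa\<^sup>2)) (mat_A 1 ** mat_A c ** mat_A 1) = mat_A (unit_inv c)"
  unfolding mat_A_A unfolding mat_A_def mat3_mult mscale_mat3 mat3_uminus
  by (simp add: mat3_eq_iff emb_combine unit_unit_inv)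

text \<open>A B maps w to v+ and B A maps v+ to w; D_A, exchanging v+ and v-, turns both into maps
  between v- and w. The coefficients Q and -1/Q are matched by the entry -i Q of D_A at w.\<close>

lemma A_action_mat_B:
  "diag_A ** mscale (emb (1 / kappa)) (mscale (emb Qk) (mat_A 1 ** mat_B c) - mscale (emb (inverse Qk)) (mat_B c ** mat_A 1))
    = mat_B c ** diag_A"
  unfolding diag_A_def mat_A_def mat_B_def mat3_mult mscale_mat3 mat3_diff
  by (simp add: mat3_eq_iff emb_combine mult.commute[of c])
    (simp add: field_simps power2_eq_square const_k_i const_k_i_mult)

lemma A_intertwine: "conv diag_A ** dmat shear (Psi_free (act_a_gen x)) = gen_mat x ** conv diag_A"
proof (cases x)
  case (OA g)
  let ?c = "factor_A (g * inverse fa)"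
  have "Psi_free (act_a_gen x) = conv (- mscale (emb (1 / kappa\<^sup>2)) (mat_A 1 ** mat_A ?c ** mat_A 1))"
    by (simp add: OA Psi_free_hom conv_hom factor_A_one)
  also have "\<dots> = conv (mat_A (unit_inv ?c))" by (simp only: A_action_mat_A[OF unit_factor_A])
  finally show ?thesis
    using diag_A_mat_A[OF unit_factor_A[of g]]
    by (simp add: OA Omat_A_eq dmat_conv dmat_mat_A det_shear unit_unit_inv unit_factor_A conv_mult delta_shear_factor_A
        flip: delta_unit(2)[OF det_shear unit_factor_A])
next
  case (OB g)
  let ?c = "factor_B (g * inverse fa)"
  have "Psi_free (act_a_gen x) = conv (mscale (emb (1 / kappa))
      (mscale (emb Qk) (mat_A 1 ** mat_B ?c) - mscale (emb (inverse Qk)) (mat_B ?c ** mat_A 1)))"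
    by (simp add: OB Psi_free_hom conv_hom factor_A_one)
  moreover have "dmat shear (M - N) = dmat shear M - dmat shear N" for M N
    using dmat_add[OF det_shear, of "M - N" N] by (simp add: algebra_simps)
  ultimately show ?thesis
    using A_action_mat_B[of "factor_B g"]
    by (simp add: OB Omat_B_eq dmat_conv dmat_mscale dmat_mult dmat_mat_A dmat_mat_B det_shear unit_factor_B
        delta_one conv_mult delta_shear_factor_B)
qed

theorem theorem50:
  shows "(\<forall>x\<in>rel_ideal. Psi_free x = 0) \<and>
    (\<exists>!\<Psi> :: algA \<Rightarrow> germR^3^3.
       k_alg_hom kscale \<Psi> \<and>
       (\<forall>x. \<Psi> (cls x) = Psi_free x) \<and>
       (\<forall>g. \<Psi> (cls (gA g)) = Omat_A g) \<and>
       (\<forall>g. \<Psi> (cls (gB g)) = Omat_B g) \<and>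
       (\<forall>x. (*v) (\<Psi> (act_a x)) = inv D_A_hat \<circ> (*v) (\<Psi> x) \<circ> D_A_hat) \<and>
       (\<forall>x. (*v) (\<Psi> (act_s x)) = inv S_hat \<circ> (*v) (\<Psi> x) \<circ> S_hat))"
proof (intro conjI ballI)
  show "Psi_free x = 0" if "x \<in> rel_ideal" for x
    by (rule Psi_free_rel_ideal[OF that])
  define \<Psi> where "\<Psi> x = Psi_free (rep_algA x)" for x
  have cls: "\<Psi> (cls x) = Psi_free x" for x
  proof -
    have "cls (rep_algA (cls x)) = cls x" by (rule Quotient_abs_rep[OF Quotient_algA])
    then have "Psi_free (rep_algA (cls x) - x) = 0"
      by (intro Psi_free_rel_ideal) (simp add: cls_eq_iff)
    then show ?thesis by (simp add: \<Psi>_def Psi_free_diff)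
  qed
  have surj: "\<exists>y. x = cls y" for x by (induction x rule: algA.abs_induct) blast
  have "k_alg_hom kscale \<Psi>"
    unfolding k_alg_hom_def
  proof (intro conjI allI)
    show "\<Psi> 1 = mat 1" using cls[of 1] by (simp add: cls_ops Psi_free_one)
    fix x y c
    obtain x' y' where xy: "x = cls x'" "y = cls y'" using surj by blast
    show "\<Psi> (x + y) = \<Psi> x + \<Psi> y" "\<Psi> (x * y) = \<Psi> x ** \<Psi> y" "\<Psi> (kscale c x) = mscale (emb c) (\<Psi> x)"
      unfolding xy cls_ops[symmetric] cls by (simp_all add: Psi_free_hom)
  qed
  moreover have "\<Psi> (cls (gA g)) = Omat_A g" "\<Psi> (cls (gB g)) = Omat_B g" for g
    unfolding cls by (simp_all add: Psi_free_gen Omat_A_eq Omat_B_eq)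
  moreover have "(*v) (\<Psi> (act_a x)) = inv D_A_hat \<circ> (*v) (\<Psi> x) \<circ> D_A_hat" for x
  proof -
    obtain x' where x: "x = cls x'" using surj by blast
    show ?thesis
      unfolding x act_a.abs_eq cls
      by (rule semilinear_intertwine[OF det_shear D_A_hat_eq bij_D_A_hat Psi_free_intertwine[OF det_shear A_intertwine]])
  qed
  moreover have "(*v) (\<Psi> (act_s x)) = inv S_hat \<circ> (*v) (\<Psi> x) \<circ> S_hat" for x
  proof -
    obtain x' where x: "x = cls x'" using surj by blast
    show ?thesis
      unfolding x act_s.abs_eq cls
      by (rule semilinear_intertwine[OF det_rot S_hat_eq bij_S_hat Psi_free_intertwine[OF det_rot S_intertwine]])
  qed
  moreover have "\<Psi>' = \<Psi>" if "\<forall>x. \<Psi>' (cls x) = Psi_free x" for \<Psi>'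
  proof
    fix x
    obtain x' where x: "x = cls x'" using surj by blast
    show "\<Psi>' x = \<Psi> x" unfolding x cls using that by blast
  qed
  ultimately show "\<exists>!\<Psi> :: algA \<Rightarrow> germR^3^3.
       k_alg_hom kscale \<Psi> \<and>
       (\<forall>x. \<Psi> (cls x) = Psi_free x) \<and>
       (\<forall>g. \<Psi> (cls (gA g)) = Omat_A g) \<and>
       (\<forall>g. \<Psi> (cls (gB g)) = Omat_B g) \<and>
       (\<forall>x. (*v) (\<Psi> (act_a x)) = inv D_A_hat \<circ> (*v) (\<Psi> x) \<circ> D_A_hat) \<and>
       (\<forall>x. (*v) (\<Psi> (act_s x)) = inv S_hat \<circ> (*v) (\<Psi> x) \<circ> S_hat)"
    using cls by (intro ex1I[of _ \<Psi>]) blast+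
qed

end
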